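(* Let $R$ be a finite ring with identity, not necessarily commutative. Consider the following list of triples $(k; Q; n)$, where $k$ and $n$ are positive integers and $Q$ is a finite set of positive integers. $k=3$: $(3;\{3,4\};3)$, $(3;\{3,4,7\};2)$. $k=4$: $(4;\{2,9\};5)$, $(4;\{2,5,9\};4)$, $(4;\{2,5,9,13,17,29\};3)$. $k=5$: $(5;\{5,16\};5)$, $(5;\{5,11,16\};3)$, $(5;\{5,11,16,31,41,61\};2)$. $k=6$: $(6;\{2,3,25\};7)$, $(6;\{2,3,7,13,25\};5)$, $(6;\{2,3,7,13,19,25,31\};4)$, $(6;\{2,3,7,13,19,25,31,37,43,61,67,73,79,109,139,223\};3)$. $k=7$: $(7;\{7,8\};4)$, $(7;\{7,8,29,43\};3)$, $(7;\{7,8,29,43,71,113,127\};2)$. $k=8$: $(8;\{2,9,49\};9)$, $(8;\{2,9,17,49\};5)$, $(8;\{2,5,9,17,41,49\};4)$, $(8;\{2,5,9,13,17,29,41,49,73,89,97,113,121,137,233,257,337,761\};3)$. $k=9$: $(9;\{3,4\};9)$, $(9;\{3,4,19\};5)$, $(9;\{3,4,19,37\};3)$, $(9;\{3,4,7,19,37,73,109,127,163,181,199,271,307\};2)$. $k=10$: $(10;\{2,5,81\};11)$, $(10;\{2,5,11,81\};6)$, $(10;\{2,5,11,31,81\};5)$, $(10;\{2,5,11,31,41,61,81\};4)$, $(10;\{2,5,11,31,41,61,71,81,101,131,151,181,191,211,241,251,271,281,311,331,401,421,431,461,491,641,911\};3)$. $k=11$: $(11;\{11,23\};5)$, $(11;\{11,23,67\};4)$,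 $(11;\{11,23,67,89\};3)$, $(11;\{11,23,67,89,199,331,353,419,463,617\};2)$. Then for every triple $(k;Q;n)$ in the list: if no element of $Q$ divides the order $|R|$, then every element of $R$ can be written as a sum of $n$ many $k$-th powers of elements of $R$. In fact, in this case, for every $\alpha\in R$ there exist $B_1,\dots,B_n\in\mathbb{Z}[\alpha]$ with $\alpha=B_1^k+B_2^k+\cdots+B_n^k$.
   Context: For $\alpha\in R$, $\mathbb{Z}[\alpha]=\{a_0\cdot 1+a_1\alpha+\cdots+a_l\alpha^l \mid l\geq 0,\ a_0,\dots,a_l\in\mathbb{Z}\}$ denotes the (commutative, unital) subring of $R$ generated by $\alpha$. The summands $B_i$ are allowed to be zero. *)

theory Defs
  imports "HOL-Algebra.Algebra"
begin

text \<open>The subring $\mathbb{Z}[\alpha]$, as the set of values at $\alpha$ of polynomials with integer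
  coefficients; $R$ need not be commutative.\<close>

definition int_adjoin :: "('a, 'b) ring_scheme \<Rightarrow> 'a \<Rightarrow> 'a set" where
  "int_adjoin R \<alpha> =
     {(\<Oplus>\<^bsub>R\<^esub>i\<in>{..l}. [a i] \<cdot>\<^bsub>R\<^esub> (\<alpha> [^]\<^bsub>R\<^esub> i)) | (l :: nat) (a :: nat \<Rightarrow> int). True}"

text \<open>A triple is (exponent, excluded divisors of the order of the ring, number of summands).\<close>

definition waring_triples :: "(nat \<times> nat set \<times> nat) set" where
  "waring_triples = {
     (3, {3,4}, 3),
     (3, {3,4,7}, 2),

     (4, {2,9}, 5),
     (4, {2,5,9}, 4),
     (4, {2,5,9,13,17,29}, 3),

     (5, {5,16}, 5),
     (5, {5,11,16}, 3),
     (5, {5,11,16,31,41,61}, 2),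

     (6, {2,3,25}, 7),
     (6, {2,3,7,13,25}, 5),
     (6, {2,3,7,13,19,25,31}, 4),
     (6, {2,3,7,13,19,25,31,37,43,61,67,73,79,109,139,223}, 3),

     (7, {7,8}, 4),
     (7, {7,8,29,43}, 3),
     (7, {7,8,29,43,71,113,127}, 2),

     (8, {2,9,49}, 9),
     (8, {2,9,17,49}, 5),
     (8, {2,5,9,17,41,49}, 4),
     (8, {2,5,9,13,17,29,41,49,73,89,97,113,121,137,233,257,337,761}, 3),

     (9, {3,4}, 9),
     (9, {3,4,19}, 5),
     (9, {3,4,19,37}, 3),
     (9, {3,4,7,19,37,73,109,127,163,181,199,271,307}, 2),

     (10, {2,5,81}, 11),
     (10, {2,5,11,81}, 6),
     (10, {2,5,11,31,81}, 5),
     (10, {2,5,11,31,41,61,81}, 4),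
     (10, {2,5,11,31,41,61,71,81,101,131,151,181,191,211,241,251,271,281,311,331,
           401,421,431,461,491,641,911}, 3),

     (11, {11,23}, 5),
     (11, {11,23,67}, 4),
     (11, {11,23,67,89}, 3),
     (11, {11,23,67,89,199,331,353,419,463,617}, 2)}"

end

theory Submission
  imports Defs
begin

text \<open>
  The subring $\mathbb{Z}[\alpha]$ is a finite commutative ring $A$ whose order divides $|R|$ and is
  prime to $k$. Idempotents split $A$ into local rings with residue fields $F$, and if $M$ is the maximal
  ideal of such a ring, then $1 + M$ is a group of order $|M|$ prime to $k$, so that all its elements are
  $k$-th powers. Hence a representation of an element of $F$ by $n$ $k$-th powers that are not all zero
  lifts to $A$, and the problem is reduced to finite fields.

  In a field with $q$ elements put $d = \gcd(k, q - 1)$ and $h = (q - 1) / d$, and let $H$ be the group of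
  nonzero $d$-th powers. If $H + B$ misses $C$, then counting incidences between the points of $H \times C$
  and the lines $z = h u + y$ with $(u, y) \in H \times B$ gives
  $|H|^2 |B| |C| \le q^2 (q - |C|)$, since $H$ is closed under products. As the set of elements that are
  not sums of a given number of $d$-th powers is invariant under $H$, all elements are sums of two or
  three $d$-th powers as soon as $h \ge d^2 (d - 1)$ (and $h \ge 3 d^2$). The remaining fields have fewer
  than 13312 elements and are settled by explicit certificates.
\<close>

section \<open>Sums of powers and finite commutative rings\<close>

text \<open>The obstacle is zero. In a field 0 is trivially a sum of k-th powers, but lifting along
  A -> F alters one summand, which has to be a unit. So 0 must be written with a nonzero summand;
  equivalently, -1 must be a sum of n - 1 powers. If k-th powers are only 0 and 1, as for k = 4 in
  the field with 5 elements, this alone forces n = k + 1.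

  The sets Q have two tasks: they contain the primes dividing k, and they remove the fields that the
  certificates do not settle with n summands. Some fields fail for every n because all k-th powers
  lie in a proper subfield: the fourth powers in the field with 9 elements are 0, 1 and -1.

  The threshold d^2 (d - 1) is the point where h^4 overtakes the leading term of q^2 (q - h) for q =
  d h + 1. As k is at most 11, the orders below it are at most 11 * 1209 + 1 = 13300, whence the
  constant 13312.\<close>

fun psums :: "('a, 'b) ring_scheme \<Rightarrow> nat \<Rightarrow> nat \<Rightarrow> 'a set" where
  "psums R k 0 = {\<zero>\<^bsub>R\<^esub>}"
| "psums R k (Suc n) = {x [^]\<^bsub>R\<^esub> k \<oplus>\<^bsub>R\<^esub> s | x s. x \<in> carrier R \<and> s \<in> psums R k n}"

text \<open>The distinguished nonzero summand is what makes a representation liftable: over a local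
  ring it comes from a unit, and its power can absorb an error from the maximal ideal.\<close>

definition unit_psums :: "('a, 'b) ring_scheme \<Rightarrow> nat \<Rightarrow> nat \<Rightarrow> 'a set" where
  "unit_psums R k n =
     {u [^]\<^bsub>R\<^esub> k \<oplus>\<^bsub>R\<^esub> s | u s. u \<in> carrier R - {\<zero>\<^bsub>R\<^esub>} \<and> s \<in> psums R k (n - 1)}"

lemma (in ring) psums_closed: "psums R k n \<subseteq> carrier R"
  by (induction n) auto

lemma (in ring) psumsI:
  assumes "x \<in> carrier R" "s \<in> psums R k n"
  shows "x [^] k \<oplus> s \<in> psums R k (Suc n)"
  using assms by auto

lemma (in ring) psums_mono_Suc:
  assumes "0 < k" shows "psums R k n \<subseteq> psums R k (Suc n)"
proof
  fix s assume s: "s \<in> psums R k n"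
  have "\<zero> [^] k \<oplus> s = s"
    using s psums_closed[of k n] assms by (auto simp: nat_pow_zero)
  then show "s \<in> psums R k (Suc n)"
    using psumsI[OF zero_closed s] by metis
qed

lemma (in ring) psums_mono:
  assumes "0 < k" "m \<le> n" shows "psums R k m \<subseteq> psums R k n"
  using assms(2) by (induction rule: dec_induct) (use psums_mono_Suc[OF assms(1)] in blast)+

lemma (in ring) psums_finsum:
  assumes "S \<subseteq> carrier R" "a \<in> psums (R\<lparr>carrier := S\<rparr>) k n"
  shows "\<exists>x :: nat \<Rightarrow> 'a. (\<forall>i\<in>{1..n}. x i \<in> S) \<and> a = (\<Oplus>i\<in>{1..n}. x i [^] k)"
  using assms(2)
proof (induction n arbitrary: a)
  case (Suc n)
  then obtain y s where y: "y \<in> S" "s \<in> psums (R\<lparr>carrier := S\<rparr>) k n"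
      "a = y [^] k \<oplus> s"
    by (auto simp: nat_pow_def)
  from Suc.IH[OF y(2)] obtain x where
    x: "\<forall>i\<in>{1..n}. x i \<in> S" "s = (\<Oplus>i\<in>{1..n}. x i [^] k)" by blast
  let ?x = "x(Suc n := y)"
  have "(\<Oplus>i\<in>{1..Suc n}. ?x i [^] k) = y [^] k \<oplus> (\<Oplus>i\<in>{1..n}. ?x i [^] k)"
    using x(1) y(1) assms(1)
    by (subst atLeastAtMostSuc_conv, simp, subst finsum_insert) auto
  also have "(\<Oplus>i\<in>{1..n}. ?x i [^] k) = s"
    unfolding x(2) using x(1) assms(1) by (intro finsum_cong') auto
  finally show ?case
    using y x(1) by (intro exI[of _ ?x]) auto
qed auto

section \<open>Splitting a commutative ring along idempotents\<close>

lemma (in cring) pow_add_orthogonal: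
  assumes "a \<in> carrier R" "b \<in> carrier R" "a \<otimes> b = \<zero>" "0 < k"
  shows "(a \<oplus> b) [^] k = a [^] k \<oplus> b [^] (k::nat)"
  using assms(4)
proof (induction k rule: nat_induct_non_zero)
  case (Suc k)
  have ba: "b \<otimes> a = \<zero>" using assms m_comm by metis
  obtain j where j: "k = Suc j" using Suc.hyps gr0_implies_Suc by blast
  have z1: "a [^] k \<otimes> b = \<zero>" "b [^] k \<otimes> a = \<zero>"
    using assms ba by (simp_all add: j m_assoc)
  have "(a \<oplus> b) [^] Suc k = (a [^] k \<oplus> b [^] k) \<otimes> (a \<oplus> b)"
    using Suc.IH by simp
  also have "\<dots> = (a [^] k \<otimes> a \<oplus> b [^] k \<otimes> a) \<oplus> (a [^] k \<otimes> b \<oplus> b [^] k \<otimes> b)"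
    using assms by (simp add: r_distr l_distr)
  also have "\<dots> = a [^] Suc k \<oplus> b [^] Suc k"
    using assms by (simp add: z1)
  finally show ?case .
qed (use assms in simp)

lemma (in ring) card_dvd_of_subgroup:
  assumes "subgroup H (add_monoid R)"
  shows "card H dvd card (carrier R)"
  using add.lagrange[OF assms] unfolding order_def by (metis dvd_triv_right partial_object.select_convs(1))

text \<open>This is the ideal generated by the idempotent \<open>e\<close>, with \<open>e\<close> as
  its identity. Membership is stated as an equation, which makes closure under the operations a
  calculation.\<close>

definition corner :: "('a, 'b) ring_scheme \<Rightarrow> 'a \<Rightarrow> ('a, 'b) ring_scheme" where
  "corner R e = R\<lparr>carrier := {x \<in> carrier R. e \<otimes>\<^bsub>R\<^esub> x = x}, one := e\<rparr>"

context cring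
begin

lemma corner_cring:
  assumes "e \<in> carrier R" "e \<otimes> e = e"
  shows "cring (corner R e)"
proof (rule cringI)
  show "abelian_group (corner R e)"
    unfolding corner_def
  proof (rule abelian_groupI, simp_all)
    show "\<exists>y. y \<in> carrier R \<and> e \<otimes> y = y \<and> y \<oplus> x = \<zero>"
      if "x \<in> carrier R \<and> e \<otimes> x = x" for x
      using that assms by (intro exI[of _ "\<ominus> x"]) (simp add: r_minus l_neg)
  qed (use assms in \<open>auto simp: r_distr a_ac\<close>)
  show "comm_monoid (corner R e)"
    unfolding corner_def
  proof (rule comm_monoidI, simp_all)
    show "e \<otimes> (x \<otimes> y) = x \<otimes> y" if "x \<in> carrier R \<and> e \<otimes> x = x" "y \<in> carrier R \<and> e \<otimes> y = y" for x y
      using that assms by (metis m_assoc)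
  qed (use assms in \<open>auto simp: m_ac\<close>)
qed (auto simp: corner_def l_distr)

lemma corner_pow:
  assumes "e \<in> carrier R" "x \<in> carrier (corner R e)" "0 < k"
  shows "x [^]\<^bsub>corner R e\<^esub> k = x [^] (k::nat)"
  using assms(3)
proof (induction k rule: nat_induct_non_zero)
  case 1
  then show ?case using assms by (simp add: corner_def nat_pow_def)
next
  case (Suc k)
  then show ?case by (simp add: corner_def nat_pow_def)
qed

lemma corner_card:
  assumes "e \<in> carrier R" "e \<otimes> e = e"
  shows "card (carrier (corner R e)) dvd card (carrier R)"
proof (rule card_dvd_of_subgroup)
  show "subgroup (carrier (corner R e)) (add_monoid R)"
    using assms by (intro add.subgroupI) (auto simp: corner_def r_distr r_minus a_inv_def[symmetric])
qed

text \<open>Summands from orthogonal corners can be added in pairs, since all mixed terms of (a +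
  b)^k vanish. So the number of summands does not grow when the corners are recombined.\<close>

lemma psums_corner:
  assumes "e \<in> carrier R" "f \<in> carrier R" "e \<otimes> f = \<zero>" "0 < k"
    "x \<in> psums (corner R e) k n" "y \<in> psums (corner R f) k n"
  shows "x \<oplus> y \<in> psums R k n"
  using assms(5,6)
proof (induction n arbitrary: x y)
  case 0
  then show ?case by (simp add: corner_def)
next
  case (Suc n)
  obtain a s where a: "a \<in> carrier (corner R e)" "s \<in> psums (corner R e) k n"
    "x = a [^]\<^bsub>corner R e\<^esub> k \<oplus>\<^bsub>corner R e\<^esub> s" using Suc.prems by auto
  obtain b t where b: "b \<in> carrier (corner R f)" "t \<in> psums (corner R f) k n"
    "y = b [^]\<^bsub>corner R f\<^esub> k \<oplus>\<^bsub>corner R f\<^esub> t" using Suc.prems by auto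
  have ca: "a \<in> carrier R" "b \<in> carrier R" "e \<otimes> a = a" "f \<otimes> b = b"
    using a b by (auto simp: corner_def)
  have sub: "psums (corner R g) k m \<subseteq> carrier R" if "g \<in> carrier R" for g m
  proof (induction m)
    case (Suc m)
    show ?case
    proof
      fix z assume "z \<in> psums (corner R g) k (Suc m)"
      then obtain w v where "w \<in> carrier (corner R g)" "v \<in> psums (corner R g) k m"
        "z = w [^]\<^bsub>corner R g\<^esub> k \<oplus>\<^bsub>corner R g\<^esub> v" by auto
      with Suc show "z \<in> carrier R"
        using corner_pow[OF that _ assms(4)] by (auto simp: corner_def)
    qed
  qed (simp add: corner_def)
  have st: "s \<in> carrier R" "t \<in> carrier R" using a b sub assms by blast+
  have "a \<otimes> b = (e \<otimes> a) \<otimes> (f \<otimes> b)" using ca by simp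
  also have "\<dots> = (e \<otimes> f) \<otimes> (a \<otimes> b)" using ca(1,2) assms(1,2) by (simp add: m_ac)
  also have "\<dots> = \<zero>" using ca assms by simp
  finally have ab: "a \<otimes> b = \<zero>" .
  have "x = a [^] k \<oplus> s" "y = b [^] k \<oplus> t"
    using a(3) b(3) corner_pow[OF assms(1) a(1) assms(4)] corner_pow[OF assms(2) b(1) assms(4)]
    by (simp_all add: corner_def)
  then have "x \<oplus> y = (a \<oplus> b) [^] k \<oplus> (s \<oplus> t)"
    using ca(1,2) st pow_add_orthogonal[OF ca(1,2) ab assms(4)] by (simp add: a_ac)
  moreover have "s \<oplus> t \<in> psums R k n" using Suc.IH a b by blast
  ultimately show ?case using ca by auto
qed

text \<open>By the pigeonhole principle the powers of x are periodic from some exponent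
  \<open>i\<close> on; an exponent beyond \<open>i\<close> that is a multiple of the period gives an
  idempotent.\<close>

lemma finite_idempotent_power:
  assumes "finite (carrier R)" "x \<in> carrier R"
  shows "\<exists>m>0. x [^] (m::nat) \<otimes> x [^] m = x [^] m"
proof -
  have "\<not> inj (\<lambda>i::nat. x [^] i)"
    using finite_subset[of "range (\<lambda>i::nat. x [^] i)" "carrier R"] assms
      finite_imageD[of "\<lambda>i::nat. x [^] i" UNIV] by auto
  then obtain i j :: nat where ij: "i < j" "x [^] i = x [^] j"
    unfolding inj_def by (metis linorder_neqE_nat)
  define p where "p = j - i"
  have p: "0 < p" "j = i + p" using ij by (auto simp: p_def)
  have step: "x [^] (t + p) = x [^] t" if "i \<le> t" for t
  proof -
    have "x [^] (t + p) = x [^] (t - i) \<otimes> x [^] j"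
      using assms that p by (simp add: nat_pow_mult)
    also have "\<dots> = x [^] t"
      using assms that by (simp add: ij(2)[symmetric] nat_pow_mult)
    finally show ?thesis .
  qed
  have steps: "x [^] (t + c * p) = x [^] t" if "i \<le> t" for t c
  proof (induction c)
    case (Suc c)
    have "x [^] (t + Suc c * p) = x [^] ((t + c * p) + p)" by (simp add: algebra_simps)
    with Suc step[of "t + c * p"] that show ?case by simp
  qed simp
  \<comment> \<open>The factor \<open>Suc i\<close> instead of \<open>i\<close> keeps the exponent
    positive when \<open>i = 0\<close>.\<close>
  have "i \<le> Suc i * p" using p by (cases p) auto
  from steps[OF this, of "Suc i"] have "x [^] (Suc i * p) \<otimes> x [^] (Suc i * p) = x [^] (Suc i * p)"
    using assms(2) by (simp add: nat_pow_mult)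
  then show ?thesis using p(1) by (intro exI[of _ "Suc i * p"]) simp
qed

lemma exists_maximalideal:
  assumes "finite (carrier R)" "\<one> \<noteq> \<zero>"
  shows "\<exists>M. maximalideal M R"
proof -
  let ?S = "{I. ideal I R \<and> I \<noteq> carrier R}"
  have "finite ?S"
    by (rule finite_subset[of _ "Pow (carrier R)"]) (auto simp: assms dest: ideal.Icarr)
  moreover have "{\<zero>} \<noteq> carrier R"
    using assms(2) by blast
  then have "{\<zero>} \<in> ?S" using zeroideal by blast
  then have "?S \<noteq> {}" by blast
  ultimately have "\<exists>M\<in>?S. \<forall>I\<in>?S. M \<subseteq> I \<longrightarrow> M = I" by (rule finite_has_maximal)
  then obtain M where M: "M \<in> ?S" "\<And>I. I \<in> ?S \<Longrightarrow> M \<subseteq> I \<Longrightarrow> M = I" by blast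
  have "maximalideal M R"
    by (rule maximalidealI) (use M in auto)
  then show ?thesis by blast
qed

end

section \<open>Finite rings without nontrivial idempotents: lifting from the residue field\<close>

locale finite_local_cring = cring +
  fixes M
  assumes finite_carrier: "finite (carrier R)"
    and max: "maximalideal M R"
    and idem: "\<And>e. e \<in> carrier R \<Longrightarrow> e \<otimes> e = e \<Longrightarrow> e = \<zero> \<or> e = \<one>"
begin

lemma M_ideal: "ideal M R" and M_prime: "primeideal M R"
  using max maximalideal_prime by (auto simp: maximalideal_def)

lemma M_sub: "M \<subseteq> carrier R"
  using M_ideal by (meson ideal.Icarr subsetI)

lemma one_notin_M: "\<one> \<notin> M"
  using M_prime by (metis M_ideal ideal.one_imp_carrier primeideal.I_notcarr)

lemma pow_in_M: "x \<in> carrier R \<Longrightarrow> x [^] (m::nat) \<in> M \<Longrightarrow> x \<in> M"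
proof (induction m)
  case (Suc m)
  then show ?case using primeideal.I_prime[OF M_prime, of "x [^] m" x] by auto
qed (use one_notin_M in auto)

text \<open>Some power of x is idempotent. It is nonzero because M is prime and does not contain x,
  so it is 1.\<close>

lemma unit_of_notin_M:
  assumes "x \<in> carrier R" "x \<notin> M"
  shows "x \<in> Units R"
proof -
  obtain m :: nat where m: "0 < m" "x [^] m \<otimes> x [^] m = x [^] m"
    using finite_idempotent_power[OF finite_carrier assms(1)] by blast
  have "x [^] m \<noteq> \<zero>"
    using pow_in_M[OF assms(1), of m] assms(2) additive_subgroup.zero_closed[OF ideal.axioms(1)[OF M_ideal]]
    by auto
  then have "x [^] m = \<one>" using idem[of "x [^] m"] m(2) assms by auto
  then have "x \<otimes> x [^] (m - 1) = \<one>"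
    using m(1) assms(1) nat_pow_Suc2[of x "m - 1"] by simp
  then show ?thesis
    using assms(1) m(1) m_comm[of x "x [^] (m - 1)"] by (auto simp: Units_def)
qed

lemma one_units: "{\<one> \<oplus> y | y. y \<in> M} \<subseteq> Units R"
proof
  fix u assume "u \<in> {\<one> \<oplus> y | y. y \<in> M}"
  then obtain y where y: "y \<in> M" "u = \<one> \<oplus> y" by blast
  have yc: "y \<in> carrier R" using y M_sub by blast
  have "u \<notin> M"
  proof
    assume "u \<in> M"
    then have "u \<ominus> y \<in> M"
      using y(1) additive_subgroup.a_closed[OF ideal.axioms(1)[OF M_ideal]]
        additive_subgroup.a_inv_closed[OF ideal.axioms(1)[OF M_ideal]] by (simp add: minus_eq)
    moreover have "u \<ominus> y = \<one>" using yc by (simp add: y(2) minus_eq a_assoc r_neg)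
    ultimately show False using one_notin_M by simp
  qed
  then show "u \<in> Units R" using unit_of_notin_M y yc by auto
qed

lemma one_units_subgroup: "subgroup {\<one> \<oplus> y | y. y \<in> M} (units_of R)"
proof -
  interpret U: group "units_of R" by (rule units_group)
  interpret M: ideal M R by (rule M_ideal)
  let ?U = "{\<one> \<oplus> y | y. y \<in> M}"
  show ?thesis
  proof (rule U.subgroupI)
    show "?U \<subseteq> carrier (units_of R)" using one_units by (simp add: units_of_carrier)
    show "?U \<noteq> {}" using M.zero_closed by blast
  next
    fix u assume u: "u \<in> ?U"
    then obtain y where y: "y \<in> M" "u = \<one> \<oplus> y" by blast
    have uU: "u \<in> Units R" using u one_units by blast
    have c: "u \<in> carrier R" "inv u \<in> carrier R" "y \<in> carrier R" using uU y M_sub by auto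
    have "inv u = \<one> \<oplus> \<ominus> (inv u \<otimes> y)"
    proof -
      have "\<one> = inv u \<otimes> (\<one> \<oplus> y)" using uU y by simp
      also have "\<dots> = inv u \<oplus> inv u \<otimes> y" using c by (simp add: r_distr)
      finally show ?thesis using c by (simp add: a_assoc r_neg)
    qed
    moreover have "\<ominus> (inv u \<otimes> y) \<in> M" using y(1) c M.I_l_closed M.a_inv_closed by blast
    ultimately show "inv\<^bsub>units_of R\<^esub> u \<in> ?U" using units_of_inv[OF uU] by auto
  next
    fix u v assume "u \<in> ?U" "v \<in> ?U"
    then obtain y z where y: "y \<in> M" "u = \<one> \<oplus> y" "z \<in> M" "v = \<one> \<oplus> z" by blast
    have c: "y \<in> carrier R" "z \<in> carrier R" using y M_sub by auto
    have "u \<otimes> v = \<one> \<oplus> (y \<oplus> z \<oplus> y \<otimes> z)" using c by (simp add: y r_distr l_distr a_ac)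
    moreover have "y \<oplus> z \<oplus> y \<otimes> z \<in> M" using y c M.I_l_closed M.a_closed by blast
    ultimately show "u \<otimes>\<^bsub>units_of R\<^esub> v \<in> ?U" by (auto simp: units_of_mult)
  qed
qed

lemma one_units_root:
  assumes "coprime k (card (carrier R))" "0 < k" "y \<in> M"
  shows "\<exists>v\<in>carrier R. v [^] (k::nat) = \<one> \<oplus> y"
proof -
  let ?U = "{\<one> \<oplus> y | y. y \<in> M}"
  interpret U: group "units_of R" by (rule units_group)
  interpret M: ideal M R by (rule M_ideal)
  let ?G = "(units_of R)\<lparr>carrier := ?U\<rparr>"
  interpret G: group ?G by (rule U.subgroup_imp_group[OF one_units_subgroup])
  let ?u = "\<one> \<oplus> y"
  have u: "?u \<in> ?U" "?u \<in> Units R" using assms(3) one_units by blast+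
  have "?U = (\<lambda>y. \<one> \<oplus> y) ` M" by auto
  moreover have "inj_on (\<lambda>y. \<one> \<oplus> y) M" using M_sub by (intro inj_onI) auto
  ultimately have cU: "card ?U = card M" using card_image by auto
  have pw: "?u [^]\<^bsub>?G\<^esub> n = ?u [^] n" for n :: nat
    by (simp add: nat_pow_def units_of_mult units_of_one)
  have "?u [^]\<^bsub>?G\<^esub> order ?G = \<one>\<^bsub>?G\<^esub>" using u by (intro G.pow_order_eq_1) simp
  then have one: "?u [^] card M = \<one>" by (simp add: pw order_def cU units_of_one)
  have "card M dvd card (carrier R)" using M.a_subgroup by (rule card_dvd_of_subgroup)
  then have cop: "coprime k (card M)" using assms(1) by (meson coprime_divisors dvd_refl)
    \<comment> \<open>Raising to the power \<open>s\<close> inverts the k-th power map, because the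
      element to the power \<open>card M\<close> is 1.\<close>
    obtain s t where st: "k * s = card M * t + 1"
    using bezout_nat[of k "card M"] cop assms(2) by auto
  have uc: "?u \<in> carrier R" using u(2) by blast
  have "(?u [^] s) [^] k = ?u [^] (k * s)" using nat_pow_pow[OF uc] by (simp add: mult.commute)
  also have "\<dots> = ?u" using uc nat_pow_pow[OF uc, of "card M" t] by (simp add: st one nat_pow_mult[OF uc, symmetric])
  finally show ?thesis using u by blast
qed

lemma carrier_quot: "carrier (R Quot M) = (\<lambda>x. M +> x) ` carrier R"
  unfolding FactRing_def using A_RCOSETS_def'[of R M] by auto

lemma psums_lift:
  assumes "S \<in> psums (R Quot M) k n"
  shows "\<exists>s\<in>psums R k n. S = M +> s"
  using assms
proof (induction n arbitrary: S)
  case 0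
  interpret M: ideal M R by (rule M_ideal)
  show ?case using 0 M.a_rcos_const[OF M.zero_closed] by (auto simp: FactRing_def)
next
  case (Suc n)
  interpret M: ideal M R by (rule M_ideal)
  interpret h: ring_hom_ring R "R Quot M" "(+>) M" by (rule M.rcos_ring_hom_ring)
  obtain Y T where Y: "Y \<in> carrier (R Quot M)" "T \<in> psums (R Quot M) k n"
    "S = Y [^]\<^bsub>R Quot M\<^esub> k \<oplus>\<^bsub>R Quot M\<^esub> T"
    using Suc.prems unfolding psums.simps by blast
  obtain x where x: "x \<in> carrier R" "Y = M +> x" using Y(1) unfolding carrier_quot by blast
  obtain t where t: "t \<in> psums R k n" "T = M +> t" using Suc.IH Y by blast
  have "t \<in> carrier R" using t psums_closed by blast
  then have "S = M +> (x [^] k \<oplus> t)" using x t Y(3) by (simp add: h.hom_nat_pow[symmetric])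
  then show ?case using psumsI[OF x(1) t(1)] by blast
qed

text \<open>Lifting all summands of a representation modulo M leaves an error y in M. If w = b^k
  lifts the nonzero summand, then w + y = w (1 + w^(-1) y), and the second factor is a k-th
  power.\<close>

lemma psums_local:
  assumes "coprime k (card (carrier R))" "carrier (R Quot M) \<subseteq> unit_psums (R Quot M) k n" "0 < k" "0 < n"
  shows "carrier R \<subseteq> psums R k n"
proof
  fix \<alpha> assume a: "\<alpha> \<in> carrier R"
  interpret M: ideal M R by (rule M_ideal)
  interpret h: ring_hom_ring R "R Quot M" "(+>) M" by (rule M.rcos_ring_hom_ring)
  have "M +> \<alpha> \<in> carrier (R Quot M)" using a h.hom_closed by blast
  then obtain U S where U: "U \<in> carrier (R Quot M)" "U \<noteq> \<zero>\<^bsub>R Quot M\<^esub>" "S \<in> psums (R Quot M) k (n - 1)"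
    "M +> \<alpha> = U [^]\<^bsub>R Quot M\<^esub> k \<oplus>\<^bsub>R Quot M\<^esub> S"
    using assms(2) unfolding unit_psums_def by blast
  obtain b where b: "b \<in> carrier R" "U = M +> b" using U(1) unfolding carrier_quot by blast
  obtain s where s: "s \<in> psums R k (n - 1)" "S = M +> s" using psums_lift U(3) by blast
  have sc: "s \<in> carrier R" using s psums_closed by blast
  have "M +> b \<noteq> M" using U(2) unfolding b(2) FactRing_def by simp
  then have "b \<notin> M" using M.a_rcos_const by blast
  then have bU: "b \<in> Units R" using unit_of_notin_M b by blast
  define w where "w = b [^] k"
  have wU: "w \<in> Units R" unfolding w_def using bU by (induction k) auto
  have wc: "w \<in> carrier R" "inv w \<in> carrier R" using wU by auto
  have "M +> \<alpha> = M +> (w \<oplus> s)" using U b s sc by (simp add: w_def h.hom_nat_pow[symmetric])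
  then have "\<alpha> \<in> M +> (w \<oplus> s)" using a M.a_rcos_self by auto
  then obtain y where y: "y \<in> M" "\<alpha> = y \<oplus> (w \<oplus> s)" unfolding a_r_coset_def' by auto
  have yc: "y \<in> carrier R" using y M_sub by blast
  have "inv w \<otimes> y \<in> M" using y(1) wc M.I_l_closed by blast
  then obtain v where v: "v \<in> carrier R" "v [^] k = \<one> \<oplus> inv w \<otimes> y"
    using one_units_root[OF assms(1,3)] by blast
  have "(b \<otimes> v) [^] k = w \<otimes> (\<one> \<oplus> inv w \<otimes> y)" using b v by (simp add: nat_pow_distrib w_def)
  also have "\<dots> = w \<oplus> y" using wU wc yc by (simp add: r_distr m_assoc[symmetric])
  finally have "\<alpha> = (b \<otimes> v) [^] k \<oplus> s" using y wc yc sc by (simp add: a_ac)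
  then show "\<alpha> \<in> psums R k n" using psumsI[OF _ s(1), of "b \<otimes> v"] b v assms(4) by simp
qed

end

text \<open>Induction on the order: an idempotent e other than 0 and 1 yields the two smaller
  corners of e and 1 - e; without one the ring is local. Residue fields consist of cosets, hence the
  type \<open>'a set\<close> of F; corners keep the type \<open>'a\<close>, so one hypothesis on F
  serves all stages.\<close>

lemma finite_cring_psums:
  fixes A :: "('a, 'b) ring_scheme"
  assumes "cring A" "finite (carrier A)" "coprime k (card (carrier A))" "0 < k" "0 < n"
    and "\<And>F :: 'a set ring. field F \<Longrightarrow> finite (carrier F) \<Longrightarrow>
      card (carrier F) dvd card (carrier A) \<Longrightarrow> carrier F \<subseteq> unit_psums F k n"
  shows "carrier A \<subseteq> psums A k n"
  using assms
proof (induction "card (carrier A)" arbitrary: A rule: less_induct)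
  case (less A)
  interpret A: cring A by fact
  consider "\<one>\<^bsub>A\<^esub> = \<zero>\<^bsub>A\<^esub>"
    | e where "e \<in> carrier A" "e \<otimes>\<^bsub>A\<^esub> e = e" "e \<noteq> \<zero>\<^bsub>A\<^esub>" "e \<noteq> \<one>\<^bsub>A\<^esub>"
    | "\<one>\<^bsub>A\<^esub> \<noteq> \<zero>\<^bsub>A\<^esub>" "\<And>e. e \<in> carrier A \<Longrightarrow> e \<otimes>\<^bsub>A\<^esub> e = e \<Longrightarrow> e = \<zero>\<^bsub>A\<^esub> \<or> e = \<one>\<^bsub>A\<^esub>"
    by blast
  then show ?case
  proof cases
    case 1
    then have "carrier A = {\<zero>\<^bsub>A\<^esub>}" using A.one_zeroD by blast
    moreover have "\<zero>\<^bsub>A\<^esub> \<in> psums A k n" using A.psums_mono[OF less.prems(4), of 0 n] by simp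
    ultimately show ?thesis by simp
  next
    case 2
    define f where "f = \<one>\<^bsub>A\<^esub> \<ominus>\<^bsub>A\<^esub> e"
    have f: "f \<in> carrier A" "e \<otimes>\<^bsub>A\<^esub> f = \<zero>\<^bsub>A\<^esub>" "e \<oplus>\<^bsub>A\<^esub> f = \<one>\<^bsub>A\<^esub>"
      using 2 unfolding f_def A.minus_eq
      using A.a_lcomm[of e "\<one>\<^bsub>A\<^esub>" "\<ominus>\<^bsub>A\<^esub> e"]
      by (simp_all add: A.r_distr A.r_minus A.r_neg)
    have ff: "f \<otimes>\<^bsub>A\<^esub> f = f"
    proof -
      have "f \<otimes>\<^bsub>A\<^esub> f = (e \<oplus>\<^bsub>A\<^esub> f) \<otimes>\<^bsub>A\<^esub> f" using 2 f(1,2) by (simp add: A.l_distr)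
      then show ?thesis using f by simp
    qed
    have fne: "f \<noteq> \<one>\<^bsub>A\<^esub>" using 2 f by auto
    have sm: "carrier (corner A g) \<subseteq> psums (corner A g) k n"
      if g: "g \<in> carrier A" "g \<otimes>\<^bsub>A\<^esub> g = g" "g \<noteq> \<one>\<^bsub>A\<^esub>" for g
    proof (rule less.hyps)
      have "\<one>\<^bsub>A\<^esub> \<notin> carrier (corner A g)" using g by (auto simp: corner_def)
      then have "carrier (corner A g) \<subset> carrier A" by (auto simp: corner_def)
      then show "card (carrier (corner A g)) < card (carrier A)" "finite (carrier (corner A g))"
        using less.prems(2) psubset_card_mono finite_subset by blast+
      show "cring (corner A g)" using A.corner_cring g by blast
      have dv: "card (carrier (corner A g)) dvd card (carrier A)" using A.corner_card g by blast
      then show "coprime k (card (carrier (corner A g)))"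
        using less.prems(3) by (meson coprime_divisors dvd_refl)
      show "carrier F \<subseteq> unit_psums F k n" if "field F" "finite (carrier F)"
        "card (carrier F) dvd card (carrier (corner A g))" for F :: "'a set ring"
        using less.prems(6) that dv dvd_trans by blast
    qed (use less.prems in auto)
    show ?thesis
    proof
      fix x assume x: "x \<in> carrier A"
      have ex: "e \<otimes>\<^bsub>A\<^esub> x \<in> carrier (corner A e)" "f \<otimes>\<^bsub>A\<^esub> x \<in> carrier (corner A f)"
        using x 2 f ff by (simp_all add: corner_def A.m_assoc[symmetric])
      have "e \<otimes>\<^bsub>A\<^esub> x \<oplus>\<^bsub>A\<^esub> f \<otimes>\<^bsub>A\<^esub> x \<in> psums A k n"
        using A.psums_corner[OF 2(1) f(1,2) less.prems(4)] sm[OF 2(1,2,4)] sm[OF f(1) ff fne] ex by blast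
      moreover have "e \<otimes>\<^bsub>A\<^esub> x \<oplus>\<^bsub>A\<^esub> f \<otimes>\<^bsub>A\<^esub> x = x"
        using x 2 f by (simp add: A.l_distr[symmetric])
      ultimately show "x \<in> psums A k n" by simp
    qed
  next
    case 3
    obtain M where M: "maximalideal M A" using A.exists_maximalideal[OF less.prems(2) 3(1)] by blast
    interpret finite_local_cring A M
      by (intro finite_local_cring.intro finite_local_cring_axioms.intro A.cring_axioms M less.prems(2) 3(2))
    interpret M: ideal M A by (rule M_ideal)
    have F: "field (A Quot M)" using maximalideal.quotient_is_field[OF M A.cring_axioms] .
    have cF: "carrier (A Quot M) = a_rcosets\<^bsub>A\<^esub> M" by (simp add: FactRing_def)
    have "card (a_rcosets\<^bsub>A\<^esub> M) * card M = card (carrier A)"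
      using A.add.lagrange[OF M.a_subgroup] by (simp add: order_def A_RCOSETS_def)
    then have d: "card (carrier (A Quot M)) dvd card (carrier A)" unfolding cF by (metis dvd_triv_left)
    have "finite (carrier (A Quot M))" unfolding carrier_quot using less.prems(2) by blast
    from psums_local[OF less.prems(3) less.prems(6)[OF F this d] less.prems(4,5)]
    show ?thesis .
  qed
qed

section \<open>The subring generated by one element\<close>

text \<open>Integer polynomials are coefficient lists, constant term first, and are evaluated by the
  Horner scheme, so that the ring operations on the values are inductions on lists. The same
  function later evaluates polynomials in residue rings and decodes the elements of extension
  fields.\<close>

fun horner :: "('a, 'b) ring_scheme \<Rightarrow> 'a \<Rightarrow> int list \<Rightarrow> 'a" where
  "horner R s [] = \<zero>\<^bsub>R\<^esub>"
| "horner R s (c # cs) = [c] \<cdot>\<^bsub>R\<^esub> \<one>\<^bsub>R\<^esub> \<oplus>\<^bsub>R\<^esub> s \<otimes>\<^bsub>R\<^esub> horner R s cs"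

fun poly_plus :: "int list \<Rightarrow> int list \<Rightarrow> int list" where
  "poly_plus [] bs = bs"
| "poly_plus as [] = as"
| "poly_plus (a # as) (b # bs) = (a + b) # poly_plus as bs"

context ring
begin

lemma int_mult_one:
  assumes "x \<in> carrier R"
  shows "[(c::int)] \<cdot> \<one> \<otimes> x = [c] \<cdot> x" "x \<otimes> [c] \<cdot> \<one> = [c] \<cdot> x"
  using assms add_pow_ldistr_int[of \<one> x c] add_pow_rdistr_int[of x \<one> c] by simp_all

lemma int_embed_add: "[(a + b :: int)] \<cdot> \<one> = [a] \<cdot> \<one> \<oplus> [b] \<cdot> \<one>"
  by (simp add: add.int_pow_mult)

lemma int_embed_mult: "[(a * b :: int)] \<cdot> \<one> = [a] \<cdot> \<one> \<otimes> [b] \<cdot> \<one>"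
  using add.int_pow_pow[of \<one> a b] by (simp add: int_mult_one(1) mult.commute)

lemma int_embed_neg: "[(- a :: int)] \<cdot> \<one> = \<ominus> ([a] \<cdot> \<one>)"
  by (simp add: add.int_pow_neg)

lemma int_embed_one: "[(1::int)] \<cdot> \<one> = \<one>" and int_embed_zero: "[(0::int)] \<cdot> \<one> = \<zero>"
  by (simp_all add: add_pow_int_ge add.nat_pow_eone)

lemma horner_closed [simp]: "s \<in> carrier R \<Longrightarrow> horner R s cs \<in> carrier R"
  by (induction cs) auto

lemma horner_plus:
  assumes "s \<in> carrier R"
  shows "horner R s (poly_plus as bs) = horner R s as \<oplus> horner R s bs"
  by (induction as bs rule: poly_plus.induct)
    (use assms in \<open>simp_all add: int_embed_add r_distr a_ac\<close>)

lemma horner_smult: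
  assumes "s \<in> carrier R"
  shows "horner R s (map ((*) c) as) = [c] \<cdot> \<one> \<otimes> horner R s as"
proof (induction as)
  case (Cons a as)
  have "s \<otimes> ([c] \<cdot> \<one> \<otimes> horner R s as) = [c] \<cdot> \<one> \<otimes> (s \<otimes> horner R s as)"
    using assms by (simp add: int_mult_one add_pow_rdistr_int)
  with Cons show ?case using assms by (simp add: int_embed_mult r_distr)
qed (use assms in simp)

text \<open>The ring R need not be commutative. That two polynomials in s commute follows by
  applying this twice, with x equal to s and then to the other polynomial.\<close>

lemma horner_commute:
  assumes "s \<in> carrier R" "x \<in> carrier R" "s \<otimes> x = x \<otimes> s"
  shows "horner R s as \<otimes> x = x \<otimes> horner R s as"
proof (induction as)
  case (Cons a as)
  have "(s \<otimes> horner R s as) \<otimes> x = s \<otimes> (x \<otimes> horner R s as)"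
    using assms Cons by (simp add: m_assoc)
  also have "\<dots> = x \<otimes> (s \<otimes> horner R s as)" using assms by (simp add: m_assoc[symmetric])
  finally show ?case using assms by (simp add: l_distr r_distr int_mult_one)
qed (use assms in simp)

lemma horner_mult_closed:
  assumes "s \<in> carrier R"
  shows "horner R s as \<otimes> horner R s bs \<in> range (horner R s)"
proof (induction as)
  case Nil
  show ?case using assms by (intro range_eqI[of _ _ "[]"]) simp
next
  case (Cons a as)
  then obtain cs where "horner R s as \<otimes> horner R s bs = horner R s cs" by blast
  then have "horner R s (a # as) \<otimes> horner R s bs = horner R s (poly_plus (map ((*) a) bs) (0 # cs))"
    using assms by (simp add: horner_plus horner_smult l_distr m_assoc int_embed_zero)
  then show ?case by blast
qed

lemma horner_subcring:
  assumes "s \<in> carrier R"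
  shows "subcring (range (horner R s)) R"
proof (rule subcringI, rule subringI)
  show "\<one> \<in> range (horner R s)"
    using assms by (intro range_eqI[of _ _ "[1]"]) (simp add: int_embed_one)
next
  fix x assume "x \<in> range (horner R s)"
  then obtain as where "x = horner R s as" by blast
  then have "\<ominus> x = horner R s (map ((*) (-1)) as)"
    using assms by (simp only: horner_smult) (simp add: int_embed_neg int_embed_one l_minus)
  then show "\<ominus> x \<in> range (horner R s)" by blast
next
  fix x y assume "x \<in> range (horner R s)" "y \<in> range (horner R s)"
  then obtain as bs where xy: "x = horner R s as" "y = horner R s bs" by blast
  show "x \<otimes> y \<in> range (horner R s)" using horner_mult_closed assms xy by blast
  show "x \<oplus> y \<in> range (horner R s)" using horner_plus[OF assms, of as bs] xy by (metis rangeI)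
  have "s \<otimes> horner R s bs = horner R s bs \<otimes> s"
    using horner_commute[OF assms assms] by simp
  from horner_commute[OF assms horner_closed[OF assms] this]
  show "x \<otimes> y = y \<otimes> x" unfolding xy .
qed (use assms in auto)

text \<open>A sum over \<open>{..l}\<close> always has at least one term, while the list may be
  empty; therefore one further term with coefficient 0 is included.\<close>

lemma horner_finsum:
  assumes "s \<in> carrier R"
  shows "horner R s cs = (\<Oplus>i\<in>{..length cs}. [(if i < length cs then cs ! i else 0)] \<cdot> (s [^] i))"
proof (induction cs)
  case (Cons c cs)
  let ?f = "\<lambda>cs i. [(if i < length cs then cs ! i else (0::int))] \<cdot> (s [^] i)"
  have "(\<Oplus>i\<in>{..length (c # cs)}. ?f (c # cs) i)
      = (\<Oplus>i\<in>{..length cs}. ?f (c # cs) (Suc i)) \<oplus> ?f (c # cs) 0"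
    using assms by (simp only: list.size(4) add_Suc_right add_0_right, intro finsum_Suc2) auto
  also have "(\<Oplus>i\<in>{..length cs}. ?f (c # cs) (Suc i)) = (\<Oplus>i\<in>{..length cs}. s \<otimes> ?f cs i)"
    using assms nat_pow_Suc2[of s] by (intro finsum_cong') (auto simp: add_pow_rdistr_int)
  also have "\<dots> = s \<otimes> (\<Oplus>i\<in>{..length cs}. ?f cs i)"
    using assms by (intro finsum_rdistr[symmetric]) auto
  finally show ?case using assms Cons by (simp add: a_comm)
qed (simp add: int_embed_zero)

lemma horner_int_adjoin:
  assumes "s \<in> carrier R"
  shows "range (horner R s) \<subseteq> int_adjoin R s"
proof
  fix x assume "x \<in> range (horner R s)"
  then obtain cs where "x = horner R s cs" by blast
  then show "x \<in> int_adjoin R s"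
    unfolding int_adjoin_def horner_finsum[OF assms, of cs]
    by (intro CollectI exI conjI TrueI)
qed

lemma in_range_horner:
  assumes "s \<in> carrier R"
  shows "s \<in> range (horner R s)"
  using assms by (intro range_eqI[of _ _ "[0, 1]"]) (simp add: int_embed_one int_embed_zero)

end

section \<open>Powers in finite fields\<close>

context field
begin

text \<open>The common line of two points (h, z) and (h', z') with h and h' distinct has slope (z -
  z') / (h - h').\<close>

lemma card_slopes:
  assumes "h \<in> carrier R" "h' \<in> carrier R" "h \<noteq> h'" "z \<in> carrier R" "z' \<in> carrier R"
  shows "card {u \<in> carrier R. z \<ominus> h \<otimes> u = z' \<ominus> h' \<otimes> u} = 1"
proof -
  let ?v = "inv (h \<ominus> h') \<otimes> (z \<ominus> z')"
  have nz: "h \<ominus> h' \<in> Units R" using assms r_right_minus_eq[of h h'] by (simp add: field_Units)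
  have "{u \<in> carrier R. z \<ominus> h \<otimes> u = z' \<ominus> h' \<otimes> u} = {?v}"
  proof (intro equalityI subsetI)
    fix u assume "u \<in> {u \<in> carrier R. z \<ominus> h \<otimes> u = z' \<ominus> h' \<otimes> u}"
    then have u: "u \<in> carrier R" "z \<ominus> h \<otimes> u = z' \<ominus> h' \<otimes> u" by auto
    have "(h \<ominus> h') \<otimes> u = (z \<ominus> z') \<oplus> (\<ominus> (z \<ominus> h \<otimes> u) \<oplus> (z' \<ominus> h' \<otimes> u))"
      using assms u(1) by algebra
    also have "\<dots> = z \<ominus> z'" using u assms by (simp add: l_neg)
    finally have "inv (h \<ominus> h') \<otimes> ((h \<ominus> h') \<otimes> u) = ?v" by simp
    then show "u \<in> {?v}" using nz u assms by (simp add: m_assoc[symmetric])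
  next
    fix u assume "u \<in> {?v}"
    then have u: "u = ?v" "u \<in> carrier R" using nz assms by auto
    then have "(h \<ominus> h') \<otimes> u = z \<ominus> z'" using nz assms by (simp add: m_assoc[symmetric])
    then have "z \<ominus> h \<otimes> u = (z' \<oplus> (h \<ominus> h') \<otimes> u) \<ominus> h \<otimes> u" using assms u(2) by algebra
    also have "\<dots> = z' \<ominus> h' \<otimes> u" using assms u(2) by algebra
    finally show "u \<in> {u \<in> carrier R. z \<ominus> h \<otimes> u = z' \<ominus> h' \<otimes> u}" using u by simp
  qed
  then show ?thesis by simp
qed

text \<open>Below, \<open>n u y\<close> counts the points of \<open>H \<times> C\<close> on the line \<open>z = h u + y\<close>. Its second moment over all
  lines is nearly the square of its mean because two points with distinct abscissae lie on one common line;
  but \<open>n\<close> vanishes on the lines with \<open>(u, y)\<close> in \<open>H \<times> B\<close>.\<close>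

lemma incidence_bound:
  assumes fin: "finite (carrier R)"
    and H: "H \<subseteq> carrier R" "H \<noteq> {}" "\<And>u v. u \<in> H \<Longrightarrow> v \<in> H \<Longrightarrow> u \<otimes> v \<in> H"
    and B: "B \<subseteq> carrier R" and C: "C \<subseteq> carrier R"
    and no: "\<And>h b. h \<in> H \<Longrightarrow> b \<in> B \<Longrightarrow> h \<oplus> b \<notin> C"
  shows "(card H)\<^sup>2 * card B * card C \<le> (card (carrier R))\<^sup>2 * (card (carrier R) - card C)"
proof -
  let ?F = "carrier R" and ?l = "\<lambda>u p. snd p \<ominus> fst p \<otimes> u"
  define q where "q = card ?F"
  define P where "P = H \<times> C"
  define n where "n u y = card {p \<in> P. ?l u p = y}" for u y
  have finB: "finite B" "finite H" "finite C"
    using fin H(1) B C finite_subset by blast+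
  then have finP: "finite P" by (simp add: P_def)
  \<comment> \<open>For a fixed slope every point lies on exactly one line.\<close>
  have n_sum: "(\<Sum>y\<in>?F. int (n u y)) = int (card P)" if "u \<in> ?F" for u
  proof -
    have "(\<Sum>y\<in>?F. n u y) = (\<Sum>y\<in>?F. \<Sum>p\<in>P. if ?l u p = y then 1 else 0)"
      unfolding n_def using finP by (intro sum.cong) (auto simp: sum.If_cases Int_def)
    also have "\<dots> = (\<Sum>p\<in>P. \<Sum>y\<in>?F. if ?l u p = y then 1 else 0)"
      by (rule sum.swap)
    also have "\<dots> = (\<Sum>p\<in>P. 1)"
      using that H(1) C fin by (intro sum.cong) (auto simp: P_def sum.delta' subset_iff)
    finally show ?thesis by (simp flip: of_nat_sum)
  qed
  \<comment> \<open>The second moment counts pairs of points with a common line: a pair of equal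
    points has q lines, distinct points with the same abscissa have none, all others have one. Each
    point thus contributes q + |P| - |C|.\<close>
  have n_sq: "(\<Sum>u\<in>?F. \<Sum>y\<in>?F. int (n u y ^ 2))
      \<le> int (q * card P + card P * card P - card H * card C * card C)"
  proof -
    let ?e = "\<lambda>u p p'. ?l u p = ?l u p'"
    have "(\<Sum>u\<in>?F. \<Sum>y\<in>?F. n u y ^ 2) = (\<Sum>u\<in>?F. \<Sum>p\<in>P. \<Sum>p'\<in>P. if ?e u p p' then 1 else 0)"
    proof (intro sum.cong refl)
      fix u assume u: "u \<in> ?F"
      have "(\<Sum>y\<in>?F. n u y ^ 2) = (\<Sum>y\<in>?F. \<Sum>p\<in>P. \<Sum>p'\<in>P.
          if ?l u p = y then if ?l u p' = y then 1 else 0 else 0)"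
      proof (intro sum.cong refl)
        fix y
        have "n u y = (\<Sum>p\<in>P. if ?l u p = y then 1 else 0)"
          unfolding n_def using finP by (auto simp: sum.If_cases Int_def)
        then show "n u y ^ 2 = (\<Sum>p\<in>P. \<Sum>p'\<in>P.
          if ?l u p = y then if ?l u p' = y then 1 else 0 else 0)"
          by (simp add: power2_eq_square sum_product) (intro sum.cong refl, auto)
      qed
      also have "\<dots> = (\<Sum>p\<in>P. \<Sum>y\<in>?F. \<Sum>p'\<in>P.
          if ?l u p = y then if ?l u p' = y then 1 else 0 else 0)"
        by (rule sum.swap)
      also have "\<dots> = (\<Sum>p\<in>P. \<Sum>p'\<in>P. \<Sum>y\<in>?F.
          if ?l u p = y then if ?l u p' = y then 1 else 0 else 0)"
        by (intro sum.cong refl) (rule sum.swap)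
      also have "\<dots> = (\<Sum>p\<in>P. \<Sum>p'\<in>P. if ?e u p p' then 1 else 0)"
        using u H(1) C fin by (intro sum.cong refl) (auto simp: P_def sum.delta' subset_iff)
      finally show "(\<Sum>y\<in>?F. n u y ^ 2) = (\<Sum>p\<in>P. \<Sum>p'\<in>P. if ?e u p p' then 1 else 0)" .
    qed
    also have "\<dots> = (\<Sum>p\<in>P. \<Sum>u\<in>?F. \<Sum>p'\<in>P. if ?e u p p' then 1 else 0)"
      by (rule sum.swap)
    also have "\<dots> = (\<Sum>p\<in>P. \<Sum>p'\<in>P. \<Sum>u\<in>?F. if ?e u p p' then 1 else 0)"
      by (intro sum.cong refl) (rule sum.swap)
    also have "\<dots> = (\<Sum>p\<in>P. \<Sum>p'\<in>P. card {u\<in>?F. ?e u p p'})"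
      using fin by (intro sum.cong refl) (auto simp: sum.If_cases Int_def)
    also have "\<dots> = (\<Sum>p\<in>P. \<Sum>p'\<in>P. (if p = p' then q else 0) + (if fst p = fst p' then 0 else 1))"
    proof (intro sum.cong refl)
      fix p p' assume "p \<in> P" "p' \<in> P"
      then obtain h z h' z' where p: "p = (h, z)" "p' = (h', z')"
        "h \<in> ?F" "z \<in> ?F" "h' \<in> ?F" "z' \<in> ?F"
        using H(1) C unfolding P_def by blast
      show "card {u\<in>?F. ?e u p p'} = (if p = p' then q else 0) + (if fst p = fst p' then 0 else 1)"
      proof (cases "h = h'")
        case True
        have "{u\<in>?F. ?e u p p'} = (if p = p' then ?F else {})"
          using p True by (auto simp: minus_eq)
        then show ?thesis using True p by (auto simp: q_def)
      next
        case False
        then show ?thesis using card_slopes[of h h' z z'] p by simp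
      qed
    qed
    also have "\<dots> = (\<Sum>p\<in>P. q + (card P - card C))"
    proof (intro sum.cong refl)
      fix p assume p: "p \<in> P"
      have "(\<Sum>p'\<in>P. if fst p = fst p' then 0 else 1 :: nat) = card (P - {fst p} \<times> C)"
      proof -
        have "{p' \<in> P. fst p \<noteq> fst p'} = P - {fst p} \<times> C" using p by (auto simp: P_def)
        then show ?thesis using finP by (simp add: sum.If_cases Int_def)
      qed
      also have "\<dots> = card P - card C"
        using p finB by (subst card_Diff_subset) (auto simp: P_def card_cartesian_product)
      finally show "(\<Sum>p'\<in>P. (if p = p' then q else 0) + (if fst p = fst p' then 0 else 1))
          = q + (card P - card C)"
        using p finP by (simp add: sum.distrib)
    qed
    also have "\<dots> = q * card P + card P * card P - card H * card C * card C"
    proof -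
      have "card P = card H * card C" by (simp add: P_def card_cartesian_product)
      moreover have "card H > 0" using H finB by (simp add: card_gt_0_iff)
      ultimately have "card C \<le> card P" by simp
      then show ?thesis
        by (simp add: P_def card_cartesian_product algebra_simps diff_mult_distrib2)
    qed
    finally show ?thesis by (simp flip: of_nat_sum of_nat_power)
  qed
  \<comment> \<open>Only here closure of \<open>H\<close> under products enters: a point (h, z) on
    the line gives z = h u + y with h u in \<open>H\<close>, against the assumption on
    \<open>H + B\<close>.\<close>
  have zero: "n u y = 0" if "u \<in> H" "y \<in> B" for u y
  proof -
    have "False" if hz: "h \<in> H" "z \<in> C" "z \<ominus> h \<otimes> u = y" for h z
    proof -
      have "z = h \<otimes> u \<oplus> y"
        using hz \<open>u \<in> H\<close> H(1) C by (auto simp: minus_eq a_ac r_neg subset_iff r_neg1 r_neg2)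
      then show False using no[of "h \<otimes> u" y] hz \<open>u \<in> H\<close> \<open>y \<in> B\<close> H(3) by auto
    qed
    then have "{p \<in> P. ?l u p = y} = {}" by (auto simp: P_def)
    then show ?thesis unfolding n_def by (metis card.empty)
  qed
  \<comment> \<open>The mean of \<open>n\<close> over all q^2 lines is |P| / q; the deviation is
    multiplied by q to remain in the integers. The lines with \<open>n u y = 0\<close> each
    contribute |P|^2.\<close>
  let ?v = "\<lambda>u y. (int q * int (n u y) - int (card P))\<^sup>2"
  let ?s2 = "\<Sum>u\<in>?F. \<Sum>y\<in>?F. int (n u y ^ 2)"
  have "int (card H * card B * (card P)\<^sup>2) = (\<Sum>u\<in>H. \<Sum>y\<in>B. ?v u y)"
    using zero by simp
  moreover have "(\<Sum>u\<in>H. \<Sum>y\<in>B. ?v u y) \<le> (\<Sum>u\<in>?F. \<Sum>y\<in>?F. ?v u y)"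
    using fin H(1) B by (intro order_trans[OF sum_mono sum_mono2] sum_mono2 sum_nonneg) auto
  moreover have "(\<Sum>u\<in>?F. \<Sum>y\<in>?F. ?v u y) = (\<Sum>u\<in>?F. (int q)\<^sup>2 * (\<Sum>y\<in>?F. int (n u y ^ 2))
      - 2 * int q * int (card P) * (\<Sum>y\<in>?F. int (n u y)) + int q * (int (card P))\<^sup>2)"
    by (intro sum.cong refl)
      (simp add: power2_diff sum.distrib sum_subtractf sum_distrib_left power_mult_distrib algebra_simps q_def)
  moreover have "\<dots> = (int q)\<^sup>2 * ?s2 - (int q)\<^sup>2 * (int (card P))\<^sup>2"
    using n_sum by (simp add: sum.distrib sum_subtractf sum_distrib_left q_def power2_eq_square)
  moreover have "(int q)\<^sup>2 * ?s2
      \<le> (int q)\<^sup>2 * int (q * card P + card P * card P - card H * card C * card C)"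
    using n_sq by (simp add: mult_left_mono)
  moreover have "(int q)\<^sup>2 * int (q * card P + card P * card P - card H * card C * card C)
      - (int q)\<^sup>2 * (int (card P))\<^sup>2
      = (int q)\<^sup>2 * (int (card H) * int (card C) * (int q - int (card C)))"
  proof -
    have "card C \<le> q" unfolding q_def using C fin card_mono by blast
    then have "card H * card C * card C \<le> q * (card H * card C)" by (simp add: mult.commute)
    then have "int (q * card P + card P * card P - card H * card C * card C)
        = int q * int (card P) + int (card P) * int (card P) - int (card H) * int (card C) * int (card C)"
      by (subst of_nat_diff) (simp_all add: P_def card_cartesian_product trans_le_add1)
    then show ?thesis
      by (simp only:) (simp add: P_def card_cartesian_product power2_eq_square algebra_simps)
  qed
  ultimately have main: "int (card H * card B * (card P)\<^sup>2)
      \<le> (int q)\<^sup>2 * (int (card H) * int (card C) * (int q - int (card C)))"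
    by linarith
  have Cq: "card C \<le> q" unfolding q_def using C fin card_mono by blast
  show ?thesis
  proof (cases "card C = 0")
    case False
    have "card H > 0" using H finB by (simp add: card_gt_0_iff)
    have "int (card H * card C) * int ((card H)\<^sup>2 * card B * card C)
        \<le> int (card H * card C) * int (q\<^sup>2 * (q - card C))"
      using main Cq by (simp add: P_def card_cartesian_product of_nat_diff power2_eq_square algebra_simps)
    then have "int ((card H)\<^sup>2 * card B * card C) \<le> int (q\<^sup>2 * (q - card C))"
      using \<open>card H > 0\<close> False by (simp add: mult_le_cancel_left_pos)
    then show ?thesis unfolding q_def by linarith
  qed simp
qed

end

section \<open>Representations with a nonzero summand, and exponents modulo q - 1\<close>

context field
begin

lemma pow_card_minus_one:
  assumes "finite (carrier R)" "x \<in> carrier R" "x \<noteq> \<zero>"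
  shows "x [^] (card (carrier R) - 1) = \<one>"
proof -
  interpret U: group "units_of R" by (rule units_group)
  have x: "x \<in> Units R" using assms by (simp add: field_Units)
  have "order (units_of R) = card (carrier R) - 1"
    using assms(1) by (simp add: order_def units_of_carrier field_Units card_Diff_singleton)
  then have "x [^]\<^bsub>units_of R\<^esub> (card (carrier R) - 1) = \<one>"
    using U.pow_order_eq_1[of x] x by (simp add: units_of_carrier units_of_one)
  then show ?thesis using units_of_pow[OF x] by metis
qed

lemma pow_eq_zero_iff:
  assumes "x \<in> carrier R" "0 < n"
  shows "x [^] (n::nat) = \<zero> \<longleftrightarrow> x = \<zero>"
proof
  show "x [^] n = \<zero> \<Longrightarrow> x = \<zero>"
    using assms(1) by (induction n) (auto dest: integral)
qed (use assms in \<open>simp add: nat_pow_zero\<close>)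

text \<open>A leading zero can be moved to the end until a nonzero summand comes first. So only 0
  distinguishes the two kinds of sums.\<close>

lemma unit_psums_of_psums:
  assumes "0 < d" "a \<in> psums R d n" "a \<noteq> \<zero>"
  shows "a \<in> unit_psums R d n"
  using assms(2)
proof (induction n)
  case (Suc n)
  then obtain x s where x: "x \<in> carrier R" "s \<in> psums R d n" "a = x [^] d \<oplus> s" by auto
  show ?case
  proof (cases "x = \<zero>")
    case True
    have "s \<in> carrier R" using x psums_closed by blast
    then have "a = s" using x True assms(1) by (simp add: nat_pow_zero)
    then have "a \<in> unit_psums R d n" using Suc.IH x by simp
    then obtain u t where "u \<in> carrier R - {\<zero>}" "t \<in> psums R d (n - 1)" "a = u [^] d \<oplus> t"
      by (auto simp: unit_psums_def)
    moreover have "psums R d (n - 1) \<subseteq> psums R d n" using psums_mono assms(1) by simp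
    ultimately show ?thesis by (auto simp: unit_psums_def)
  next
    case False
    then show ?thesis using x by (auto simp: unit_psums_def)
  qed
qed (use assms in auto)

text \<open>Zero is written as 1^d + (-1). This is why -1 is treated separately everywhere below,
  with one summand fewer.\<close>

lemma carrier_unit_psumsI:
  assumes "0 < d" "\<And>a. a \<in> carrier R \<Longrightarrow> a \<noteq> \<zero> \<Longrightarrow> a \<in> psums R d n"
    and "\<ominus> \<one> \<in> psums R d (n - 1)"
  shows "carrier R \<subseteq> unit_psums R d n"
proof
  fix a assume a: "a \<in> carrier R"
  have "\<one> [^] d \<oplus> \<ominus> \<one> = \<zero>" by (simp add: r_neg)
  then have "\<zero> \<in> unit_psums R d n"
    using assms(3) one_not_zero one_closed unfolding unit_psums_def
    by (intro CollectI exI[of _ \<one>] exI[of _ "\<ominus> \<one>"]) auto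
  then show "a \<in> unit_psums R d n" using unit_psums_of_psums assms a by blast
qed

lemma psums_mult_pow:
  assumes "c \<in> carrier R" "s \<in> psums R d n"
  shows "c [^] d \<otimes> s \<in> psums R d n"
  using assms(2)
proof (induction n arbitrary: s)
  case (Suc n)
  then obtain x t where x: "x \<in> carrier R" "t \<in> psums R d n" "s = x [^] d \<oplus> t" by auto
  have "t \<in> carrier R" using x psums_closed by blast
  then have "c [^] d \<otimes> s = (c \<otimes> x) [^] d \<oplus> c [^] d \<otimes> t"
    using x assms(1) by (simp add: r_distr nat_pow_distrib)
  then show ?case using psumsI[of "c \<otimes> x" "c [^] d \<otimes> t"] Suc.IH x assms(1) by simp
qed (use assms in simp)

text \<open>By Bezout k i = (q - 1) j + d, so x^d = (x^i)^k for every nonzero x.\<close>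

lemma psums_gcd:
  assumes fin: "finite (carrier R)" and "0 < k" and d: "d = gcd k (card (carrier R) - 1)"
  shows "unit_psums R d n \<subseteq> unit_psums R k n"
proof -
  have ex: "\<exists>y \<in> carrier R. y [^] k = x [^] d \<and> (x \<noteq> \<zero> \<longrightarrow> y \<noteq> \<zero>)" if x: "x \<in> carrier R" for x
  proof (cases "x = \<zero>")
    case True
    then show ?thesis using assms by (intro bexI[of _ \<zero>]) (auto simp: nat_pow_zero)
  next
    case False
    obtain i j where ij: "k * i = (card (carrier R) - 1) * j + d"
      using bezout_nat[of k "card (carrier R) - 1"] assms by auto
    have "(x [^] i) [^] k = x [^] (k * i)" using x by (simp add: nat_pow_pow mult.commute)
    also have "\<dots> = (x [^] (card (carrier R) - 1)) [^] j \<otimes> x [^] d"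
      using x by (simp add: ij nat_pow_mult nat_pow_pow)
    also have "\<dots> = x [^] d" using pow_card_minus_one[OF fin x False] x by simp
    finally show ?thesis using x False pow_eq_zero_iff[of x i]
      by (intro bexI[of _ "x [^] i"]) (auto, cases i, auto)
  qed
  have sub: "psums R d m \<subseteq> psums R k m" for m
  proof (induction m)
    case (Suc m)
    show ?case
    proof
      fix s assume "s \<in> psums R d (Suc m)"
      then obtain x t where "x \<in> carrier R" "t \<in> psums R d m" "s = x [^] d \<oplus> t" by auto
      with ex[of x] Suc show "s \<in> psums R k (Suc m)" using psumsI by (metis subsetD)
    qed
  qed simp
  show ?thesis
  proof
    fix a assume "a \<in> unit_psums R d n"
    then obtain u s where u: "u \<in> carrier R" "u \<noteq> \<zero>" "s \<in> psums R d (n - 1)" "a = u [^] d \<oplus> s"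
      by (auto simp: unit_psums_def)
    obtain y where "y \<in> carrier R" "y [^] k = u [^] d" "y \<noteq> \<zero>" using ex u by blast
    then show "a \<in> unit_psums R k n" using u sub unfolding unit_psums_def by (auto simp: subset_iff) metis
  qed
qed

end

section \<open>The group of d-th powers and sums of two or three powers\<close>

locale finite_field_powers = field +
  fixes d h :: nat
  assumes finite_carrier: "finite (carrier R)"
    and card_carrier: "card (carrier R) = d * h + 1"
    and d_pos: "0 < d"
begin

definition H where "H = (\<lambda>x. x [^] d) ` (carrier R - {\<zero>})"

lemma H_sub: "H \<subseteq> carrier R - {\<zero>}"
  by (auto simp: H_def pow_eq_zero_iff d_pos)

lemma h_pos: "0 < h"
proof (rule ccontr)
  assume "\<not> 0 < h"
  then have "card (carrier R) = 1" using card_carrier by simp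
  then show False using one_not_zero one_closed zero_closed by (metis card_1_singletonE singletonD)
qed

lemma pow_dh: "x \<in> carrier R \<Longrightarrow> x \<noteq> \<zero> \<Longrightarrow> x [^] (d * h) = \<one>"
  using pow_card_minus_one[OF finite_carrier, of x] card_carrier by simp

lemma H_sub_kernel: "H \<subseteq> {x \<in> carrier R. x [^] h = \<one>}"
  using pow_dh by (auto simp: H_def nat_pow_pow)

lemma card_kernel_le: "card {x \<in> carrier R. x [^] h = \<one>} \<le> h"
  using num_roots_le_deg[OF finite_carrier, of h] h_pos by simp

text \<open>Every fibre of the d-th power map on nonzero elements is a translate of the set of d-th
  roots of unity, which has at most d elements; there are d h elements to distribute.\<close>

lemma h_le_card_H: "h \<le> card H"
proof -
  have finH: "finite H" using H_sub finite_carrier finite_subset by blast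
  have "carrier R - {\<zero>} = (\<Union>y\<in>H. {x \<in> carrier R - {\<zero>}. x [^] d = y})"
    by (auto simp: H_def)
  then have "card (carrier R - {\<zero>}) \<le> (\<Sum>y\<in>H. card {x \<in> carrier R - {\<zero>}. x [^] d = y})"
    using card_UN_le[OF finH, of "\<lambda>y. {x \<in> carrier R - {\<zero>}. x [^] d = y}"] by (simp only:)
  also have "\<dots> \<le> (\<Sum>y\<in>H. d)"
  proof (rule sum_mono)
    fix y assume "y \<in> H"
    then obtain x where x: "x \<in> carrier R" "x \<noteq> \<zero>" "y = x [^] d" unfolding H_def by blast
    then have xU: "x \<in> Units R" by (simp add: field_Units)
    let ?A = "{x \<in> carrier R - {\<zero>}. x [^] d = y}"
    have "inj_on (\<lambda>z. inv x \<otimes> z) ?A" using xU by (intro inj_onI) auto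
    moreover have "(\<lambda>z. inv x \<otimes> z) ` ?A \<subseteq> {z \<in> carrier R. z [^] d = \<one>}"
    proof (rule image_subsetI)
      fix z assume "z \<in> ?A"
      then have z: "z \<in> carrier R" "z [^] d = y" by auto
      have "(inv x \<otimes> z) [^] d = inv x [^] d \<otimes> x [^] d" using z x xU by (simp add: nat_pow_distrib)
      also have "\<dots> = \<one>" using xU x by (simp flip: nat_pow_distrib)
      finally show "inv x \<otimes> z \<in> {z \<in> carrier R. z [^] d = \<one>}" using z xU by simp
    qed
    ultimately have "card ?A \<le> card {z \<in> carrier R. z [^] d = \<one>}"
      using finite_carrier by (intro card_inj_on_le[of _ ?A]) auto
    then show "card ?A \<le> d" using num_roots_le_deg[OF finite_carrier, of d] d_pos by linarith
  qed
  finally have "d * h \<le> card H * d"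
    using card_carrier finite_carrier by (simp add: card_Diff_singleton)
  then show ?thesis using d_pos by simp
qed

text \<open>The inclusion of \<open>H\<close> in the h-th roots of unity is an equality by counting:
  at most h roots on one side, at least h powers on the other.\<close>

lemma kernel_eq_H: "{x \<in> carrier R. x [^] h = \<one>} = H"
  using card_seteq[OF _ H_sub_kernel] card_kernel_le h_le_card_H finite_carrier by fastforce

lemma card_H: "card H = h"
  using card_kernel_le h_le_card_H kernel_eq_H by simp

lemma H_mult: "u \<in> H \<Longrightarrow> v \<in> H \<Longrightarrow> u \<otimes> v \<in> H"
  unfolding H_def using integral by (force simp: nat_pow_distrib[symmetric])

lemma psums_one: "psums R d 1 = insert \<zero> H"
proof -
  have "psums R d 1 = (\<lambda>x. x [^] d) ` carrier R" 
    unfolding One_nat_def psums.simps image_def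
    by (intro Collect_cong) (metis r_zero nat_pow_closed singleton_iff)
  also have "(\<lambda>x. x [^] d) ` carrier R = (\<lambda>x. x [^] d) ` ({\<zero>} \<union> (carrier R - {\<zero>}))"
    by (intro arg_cong2[where f = image]) auto
  also have "\<dots> = insert \<zero> H"
    unfolding H_def image_Un using d_pos by (simp add: nat_pow_zero)
  finally show ?thesis .
qed

lemma card_psums_one: "card (psums R d 1) = h + 1"
proof -
  have "finite H" using H_sub finite_carrier finite_subset by blast
  moreover have "\<zero> \<notin> H" using H_sub by blast
  ultimately show ?thesis unfolding psums_one by (metis card_insert_disjoint card_H Suc_eq_plus1)
qed

text \<open>The coset a H has h elements. If H plus the sums of n powers missed it, the incidence
  bound with C = a H would contradict the numerical hypothesis. A hit x^d + b = a y^d with y nonzero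
  is divided by y^d.\<close>

lemma psums_coset:
  assumes "a \<in> carrier R" "a \<noteq> \<zero>"
    and "h ^ 3 * card (psums R d n) > (d * h + 1)\<^sup>2 * (d * h + 1 - h)"
  shows "a \<in> psums R d (Suc n)"
proof -
  let ?C = "(\<lambda>x. a \<otimes> x) ` H"
  have aU: "a \<in> Units R" using assms by (simp add: field_Units)
  have Hc: "H \<subseteq> carrier R" using H_sub by blast
  have "inj_on (\<lambda>x. a \<otimes> x) H" using aU Hc by (intro inj_onI) (metis Units_l_cancel subsetD)
  then have cC: "card ?C = h" by (simp add: card_image card_H)
  have "H \<noteq> {}" using card_H h_pos by auto
  have "\<exists>u\<in>H. \<exists>b\<in>psums R d n. u \<oplus> b \<in> ?C"
  proof (rule ccontr)
    assume "\<not> ?thesis"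
    then have "(card H)\<^sup>2 * card (psums R d n) * card ?C
        \<le> (card (carrier R))\<^sup>2 * (card (carrier R) - card ?C)"
      using Hc assms(1) psums_closed \<open>H \<noteq> {}\<close>
      by (intro incidence_bound finite_carrier) (auto simp: H_mult)
    then have "h\<^sup>2 * card (psums R d n) * h \<le> (d * h + 1)\<^sup>2 * (d * h + 1 - h)"
      by (simp only: cC card_H card_carrier)
    moreover have "h\<^sup>2 * card (psums R d n) * h = h ^ 3 * card (psums R d n)"
      by (simp add: power2_eq_square power3_eq_cube)
    ultimately show False using assms(3) by linarith
  qed
  then obtain x b y where x: "x \<in> carrier R" "b \<in> psums R d n"
    and y: "y \<in> carrier R" "y \<noteq> \<zero>" "x [^] d \<oplus> b = a \<otimes> y [^] d"
    unfolding H_def by auto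
  have yU: "y \<in> Units R" using y by (simp add: field_Units)
  have yy: "y [^] d \<otimes> inv y [^] d = \<one>" using yU y by (simp flip: nat_pow_distrib)
  have bc: "b \<in> carrier R" using x psums_closed by blast
  have "a = (a \<otimes> y [^] d) \<otimes> inv y [^] d" using assms(1) y yU yy by (simp add: m_assoc)
  also have "\<dots> = (x \<otimes> inv y) [^] d \<oplus> inv y [^] d \<otimes> b"
    using x yU bc m_comm[OF bc, of "inv y [^] d"] by (simp add: y(3)[symmetric] l_distr nat_pow_distrib)
  finally show ?thesis
    using psumsI[of "x \<otimes> inv y" "inv y [^] d \<otimes> b"] psums_mult_pow[of "inv y" b] x yU by simp
qed

lemma psums_two:
  assumes "h ^ 3 * (h + 1) > (d * h + 1)\<^sup>2 * (d * h + 1 - h)" "a \<in> carrier R" "a \<noteq> \<zero>"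
  shows "a \<in> psums R d 2"
  using psums_coset[of a 1] assms card_psums_one by (simp add: numeral_2_eq_2 del: psums.simps)

text \<open>The incidence bound is used twice: first with C the set of elements that are not sums of
  two powers, which yields many sums of two powers, then with these sums as B. This lowers the size
  of h required from the order of d^3 to that of d^2 and settles many fields for which
  \<open>psums_two\<close> is too weak.\<close>

lemma psums_three:
  assumes bound: "h ^ 5 * (h + 1) > (d * h + 1) * (d * h + 1 - h) * ((d * h + 1)\<^sup>2 + h ^ 3 + h\<^sup>2)"
    and a: "a \<in> carrier R" "a \<noteq> \<zero>"
  shows "a \<in> psums R d 3"
proof -
  define q where "q = d * h + 1"
  define b where "b = card (psums R d 2)"
  define w where "w = h\<^sup>2 * (h + 1)"
  let ?D = "carrier R - psums R d 2"
  have Hc: "H \<subseteq> carrier R" using H_sub by blast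
  have "H \<noteq> {}" using card_H h_pos by auto
  have no: "u \<oplus> s \<notin> ?D" if u: "u \<in> H" and s: "s \<in> psums R d 1" for u s
  proof -
    obtain x where "x \<in> carrier R" "u = x [^] d" using u by (auto simp: H_def)
    then have "u \<oplus> s \<in> psums R d (Suc 1)" using psumsI s by blast
    then show ?thesis by (simp add: numeral_2_eq_2 del: psums.simps)
  qed
  have "b \<le> q"
    unfolding b_def q_def card_carrier[symmetric] by (rule card_mono[OF finite_carrier psums_closed])
  have cD: "card ?D = q - b"
    using card_Diff_subset[OF finite_subset[OF psums_closed finite_carrier] psums_closed]
    by (simp add: b_def q_def card_carrier)
  have "(card H)\<^sup>2 * card (psums R d 1) * card ?D \<le> (card (carrier R))\<^sup>2 * (card (carrier R) - card ?D)"
    using Hc \<open>H \<noteq> {}\<close> no psums_closed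
    by (intro incidence_bound finite_carrier) (auto simp: H_mult simp del: psums.simps)
  then have "h\<^sup>2 * (h + 1) * (q - b) \<le> q\<^sup>2 * (q - (q - b))"
    by (simp only: card_H card_psums_one cD card_carrier q_def)
  \<comment> \<open>This is the lower bound w q / (q^2 + w) for the number b of sums of two powers,
    with the denominator cleared.\<close>
  then have "w * q \<le> q\<^sup>2 * b + w * b"
    using \<open>b \<le> q\<close> unfolding w_def[symmetric] diff_mult_distrib2 by simp
  then have "h ^ 3 * (w * q) \<le> h ^ 3 * (b * (q\<^sup>2 + w))"
    by (intro mult_le_mono2) (simp add: algebra_simps)
  \<comment> \<open>The numerical hypothesis says that this lower bound for b exceeds q^2 (q - h) /
    h^3, which is what \<open>psums_coset\<close> asks for.\<close>
  moreover have "(q * (q - h) * (q\<^sup>2 + w)) * q < h ^ 3 * (w * q)"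
  proof -
    have "h ^ 3 * w = h ^ 5 * (h + 1)" by (simp add: w_def eval_nat_numeral algebra_simps)
    moreover have "w = h ^ 3 + h\<^sup>2" by (simp add: w_def algebra_simps power2_eq_square power3_eq_cube)
    ultimately have "q * (q - h) * (q\<^sup>2 + w) < h ^ 3 * w"
      using bound by (simp add: q_def add.assoc)
    moreover have "0 < q" by (simp add: q_def)
    ultimately have "(q * (q - h) * (q\<^sup>2 + w)) * q < h ^ 3 * w * q" by (rule mult_strict_right_mono)
    then show ?thesis by (simp add: mult.assoc)
  qed
  ultimately have "(q\<^sup>2 * (q - h)) * (q\<^sup>2 + w) < (h ^ 3 * b) * (q\<^sup>2 + w)"
    by (simp add: power2_eq_square algebra_simps)
  then have "q\<^sup>2 * (q - h) < h ^ 3 * b" by (simp only: mult_less_cancel2)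
  then have "a \<in> psums R d (Suc 2)"
    by (intro psums_coset a) (simp only: b_def q_def)
  then show ?thesis by (simp add: numeral_3_eq_3 numeral_2_eq_2)
qed

end

section \<open>Certificates for small fields\<close>

text \<open>The ring operations are parameters, so that one checker serves both residues modulo a
  prime and coefficient lists. Exponents are binary numerals and powers are computed by repeated
  squaring.\<close>

fun pw :: "('c \<Rightarrow> 'c \<Rightarrow> 'c) \<Rightarrow> 'c \<Rightarrow> num \<Rightarrow> 'c" where
  "pw tm x num.One = x"
| "pw tm x (num.Bit0 e) = (let y = pw tm x e in tm y y)"
| "pw tm x (num.Bit1 e) = (let y = pw tm x e in tm x (tm y y))"

fun pwsum :: "('c \<Rightarrow> 'c \<Rightarrow> 'c) \<Rightarrow> ('c \<Rightarrow> 'c \<Rightarrow> 'c) \<Rightarrow> num \<Rightarrow> 'c \<Rightarrow> 'c list \<Rightarrow> 'c" where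
  "pwsum tm pl d z [] = z"
| "pwsum tm pl d z (x # xs) = pl (pw tm x d) (pwsum tm pl d z xs)"

definition num_of :: "int \<Rightarrow> num" where "num_of i = num_of_nat (nat i)"
text \<open>For evaluation a positive numeral is taken as it is; the definition would lead through
  unary natural numbers.\<close>

lemma num_of_code [code]: "num_of (Int.Pos n) = n"
  by (simp add: num_of_def)

fun short :: "int \<Rightarrow> 'c list \<Rightarrow> bool" where
  "short n [] = (0 \<le> n)"
| "short n (x # xs) = short (n - 1) xs"

text \<open>Row by row the target \<open>t\<close> is multiplied by \<open>g\<close>, and each row
  has to represent the current target. The counter \<open>j\<close> holds the number of rows still
  owed, so acceptance means that there are at least \<open>j\<close> of them.\<close>

fun rows_ok :: "('c \<Rightarrow> 'c \<Rightarrow> 'c) \<Rightarrow> ('c \<Rightarrow> 'c \<Rightarrow> 'c) \<Rightarrow> num \<Rightarrow> 'c \<Rightarrow> int \<Rightarrow> 'c \<Rightarrow> 'c \<Rightarrow> int \<Rightarrow> 'c list list \<Rightarrow> bool" where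
  "rows_ok tm pl d z n g t j [] = (j \<le> 0)"
| "rows_ok tm pl d z n g t j (r # rs) =
     (short n r \<and> pwsum tm pl d z r = t \<and> rows_ok tm pl d z n g (tm g t) (j - 1) rs)"

text \<open>If \<open>z = g\<^sup>h\<close> has order exactly \<open>d\<close>, then the powers of \<open>g\<close> represent all cosets of the group of \<open>d\<close>-th
  powers. It suffices to test the exponents in \<open>E\<close>, the maximal proper divisors of \<open>d\<close>; the inverses
  \<open>invs\<close> of \<open>z\<^sup>e - 1\<close> witness \<open>z\<^sup>e \<noteq> 1\<close>.\<close>

definition gen_ok where
  "gen_ok tm pl un mu d h g E invs =
     (let z = pw tm g h in pw tm z d = un \<and> length invs = length E \<and>
        list_all (\<lambda>(e, v). tm (pl (pw tm z e) mu) v = un) (zip E invs))"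

text \<open>Decoding is a homomorphism that may identify codes. Computed equalities therefore carry
  over to the ring, whereas inequalities have to be witnessed by inverses.\<close>

locale coded_cring = cring +
  fixes ok :: "'c \<Rightarrow> bool" and dec :: "'c \<Rightarrow> 'a"
    and tm pl :: "'c \<Rightarrow> 'c \<Rightarrow> 'c" and zr un mu :: 'c
  assumes dec_closed: "ok x \<Longrightarrow> dec x \<in> carrier R"
    and dec_tm: "ok x \<Longrightarrow> ok y \<Longrightarrow> ok (tm x y) \<and> dec (tm x y) = dec x \<otimes> dec y"
    and dec_pl: "ok x \<Longrightarrow> ok y \<Longrightarrow> ok (pl x y) \<and> dec (pl x y) = dec x \<oplus> dec y"
    and dec_zr: "ok zr" "dec zr = \<zero>"
    and dec_un: "ok un" "dec un = \<one>"
    and dec_mu: "ok mu" "dec mu = \<ominus> \<one>"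
begin

lemma dec_pw: "ok x \<Longrightarrow> ok (pw tm x e) \<and> dec (pw tm x e) = dec x [^] nat_of_num e"
proof (induction e)
  case (Bit0 e)
  then show ?case using dec_closed[of x] by (simp add: dec_tm Let_def nat_pow_mult)
next
  case (Bit1 e)
  then show ?case using dec_closed[of x]
    by (simp add: dec_tm Let_def nat_pow_mult m_comm[of "dec x"])
qed (simp add: dec_closed)

lemma dec_pwsum:
  "list_all ok xs \<Longrightarrow> ok (pwsum tm pl d zr xs) \<and>
    dec (pwsum tm pl d zr xs) \<in> psums R (nat_of_num d) (length xs)"
  by (induction xs) (auto simp: dec_zr dec_pl dec_pw dec_closed intro!: exI)

lemma short_length: "short n xs \<Longrightarrow> int (length xs) \<le> n"
  by (induction n xs rule: short.induct) auto

lemma dec_pwsum_short: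
  assumes "list_all ok xs" "short (int n) xs"
  shows "dec (pwsum tm pl d zr xs) \<in> psums R (nat_of_num d) n"
proof -
  have "0 < nat_of_num d" by (simp add: nat_of_num_pos)
  moreover have "length xs \<le> n" using short_length[OF assms(2)] by simp
  ultimately show ?thesis using dec_pwsum[OF assms(1)] psums_mono by blast
qed

lemma rows_ok_psums:
  assumes "rows_ok tm pl d zr (int n) g t j rows" "list_all (list_all ok) rows" "ok g" "ok t"
    "int i < j"
  shows "dec t \<otimes> dec g [^] i \<in> psums R (nat_of_num d) n"
  using assms
proof (induction rows arbitrary: t j i)
  case (Cons r rows)
  show ?case
  proof (cases i)
    case 0
    have "dec t \<in> psums R (nat_of_num d) n" using Cons.prems dec_pwsum_short[of r n d] by auto
    then show ?thesis using 0 Cons.prems dec_closed by simp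
  next
    case (Suc i')
    have c: "dec g \<in> carrier R" "dec t \<in> carrier R" using dec_closed Cons.prems by auto
    have "dec (tm g t) \<otimes> dec g [^] i' \<in> psums R (nat_of_num d) n"
      using Cons.prems Suc dec_tm by (intro Cons.IH) auto
    moreover have "dec (tm g t) \<otimes> dec g [^] i' = dec t \<otimes> dec g [^] i"
      using c Cons.prems Suc by (simp add: dec_tm m_ac)
    ultimately show ?thesis by simp
  qed
qed auto

end

text \<open>If z^d = 1 but the order of z is less than d, then z^e = 1 for some e with 0 < e < d,
  hence z to the power gcd(e, d) is 1. It is then enough to test one multiple of each such
  gcd.\<close>

definition proper_exponents :: "nat \<Rightarrow> num list \<Rightarrow> bool" where
  "proper_exponents d E \<longleftrightarrow> (\<forall>e\<in>{1..<d}. \<exists>e'\<in>set E. gcd e d dvd nat_of_num e')"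

context finite_field_powers
begin

lemma pow_gcd_eq_one:
  assumes "z \<in> Units R" "z [^] (a::nat) = \<one>" "z [^] (b::nat) = \<one>"
  shows "z [^] gcd a b = \<one>"
proof (cases "a = 0")
  case False
  have z: "z \<in> carrier R" using assms(1) by blast
  obtain x y where xy: "a * x = b * y + gcd a b" using bezout_nat[OF False, of b] by blast
  have "\<one> = (z [^] a) [^] x" using assms(2) by simp
  also have "\<dots> = (z [^] b) [^] y \<otimes> z [^] gcd a b"
    using z by (simp add: nat_pow_pow xy nat_pow_mult)
  finally show ?thesis using assms(3) z by simp
qed (use assms in simp)

text \<open>As z = g^h has order d, its powers are all the d-th roots of unity. For nonzero a the
  element a^h is one of them, say z^i, so the h-th power of a g^(-i) is 1, which characterizes the
  d-th powers.\<close>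

lemma coset_representatives:
  assumes g: "g \<in> carrier R" and zd: "(g [^] h) [^] d = \<one>"
    and E: "proper_exponents d E"
    and ne: "\<And>e. e \<in> set E \<Longrightarrow> (g [^] h) [^] nat_of_num e \<noteq> \<one>"
    and a: "a \<in> carrier R" "a \<noteq> \<zero>"
  shows "\<exists>i<d. \<exists>c\<in>carrier R. a = g [^] i \<otimes> c [^] d"
proof -
  define z where "z = g [^] h"
  have z: "z \<in> carrier R" using g by (simp add: z_def)
  have z0: "z \<noteq> \<zero>" using zd d_pos one_not_zero by (auto simp: z_def nat_pow_zero)
  have zU: "z \<in> Units R" using z z0 by (simp add: field_Units)
  have g0: "g \<noteq> \<zero>" using z0 h_pos by (auto simp: z_def nat_pow_zero)
  have gU: "g \<in> Units R" using g g0 by (simp add: field_Units)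
  let ?K = "{x \<in> carrier R. x [^] d = \<one>}"
  have ne': False if "i < j" "j < d" "z [^] i = z [^] j" for i j
  proof -
    have "z [^] i \<otimes> z [^] (j - i) = z [^] j" using that(1) nat_pow_mult[OF z, of i "j - i"] by simp
    then have "z [^] i \<otimes> z [^] (j - i) = z [^] i \<otimes> \<one>" using that(3) z by simp
    then have "z [^] (j - i) = \<one>" using zU z Units_pow_closed[OF zU, of i] by (subst (asm) Units_l_cancel) auto
    then have "z [^] gcd (j - i) d = \<one>" using pow_gcd_eq_one zU zd by (simp add: z_def)
    moreover have "j - i \<in> {1..<d}" using that by auto
    then obtain e where e: "e \<in> set E" "gcd (j - i) d dvd nat_of_num e"
      using E unfolding proper_exponents_def by blast
    ultimately have "z [^] nat_of_num e = \<one>"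
      using z by (auto simp: dvd_def nat_pow_pow[symmetric])
    then show False using ne e(1) by (simp add: z_def)
  qed
  have "inj_on (\<lambda>i::nat. z [^] i) {..<d}"
    by (intro inj_onI) (metis lessThan_iff linorder_neqE_nat ne')
  then have "card ((\<lambda>i::nat. z [^] i) ` {..<d}) = d" by (simp add: card_image)
  moreover have "(\<lambda>i::nat. z [^] i) ` {..<d} \<subseteq> ?K"
    using z zd by (auto simp: z_def nat_pow_pow mult.commute[of _ d]) (simp add: nat_pow_pow[symmetric])
  moreover have "card ?K \<le> d" using num_roots_le_deg[OF finite_carrier, of d] d_pos by simp
  ultimately have K: "(\<lambda>i::nat. z [^] i) ` {..<d} = ?K"
    using finite_carrier by (intro card_seteq) auto
  have "a [^] h \<in> ?K" using pow_dh[OF a] a by (simp add: nat_pow_pow mult.commute)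
  then obtain i where i: "i < d" "a [^] h = z [^] i" using K by (metis (no_types, lifting) imageE lessThan_iff)
  let ?b = "a \<otimes> inv (g [^] i)"
  have giU: "g [^] i \<in> Units R" using gU by (simp add: Units_pow_closed)
  have "?b [^] h = a [^] h \<otimes> inv (g [^] i) [^] h" using a giU by (simp add: nat_pow_distrib)
  also have "a [^] h = (g [^] i) [^] h" using i g by (simp add: z_def nat_pow_pow mult.commute)
  also have "(g [^] i) [^] h \<otimes> inv (g [^] i) [^] h = \<one>"
    using giU nat_pow_distrib[of "g [^] i" "inv (g [^] i)" h] by (simp add: Units_closed)
  finally have "?b \<in> H" using kernel_eq_H a giU by blast
  then obtain c where c: "c \<in> carrier R" "?b = c [^] d" unfolding H_def by blast
  have "a = g [^] i \<otimes> ?b" 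
    using a giU m_lcomm[of "g [^] i" a "inv (g [^] i)"] by (simp add: Units_closed)
  then show ?thesis using i c by auto
qed

end

locale coded_field_powers = coded_cring + finite_field_powers
begin

lemma gen_ok_psums:
  assumes "gen_ok tm pl un mu (num_of (int d)) (num_of (int h)) g E invs"
    and "rows_ok tm pl (num_of (int d)) zr (int n) g un (int d) rows"
    and ok: "ok g" "list_all ok invs" "list_all (list_all ok) rows"
    and E: "proper_exponents d E"
    and a: "a \<in> carrier R" "a \<noteq> \<zero>"
  shows "a \<in> psums R d n"
proof -
  have num: "nat_of_num (num_of (int d)) = d" "nat_of_num (num_of (int h)) = h"
    using d_pos h_pos by (simp_all add: num_of_def num_of_nat_inverse)
  have g: "dec g \<in> carrier R" using ok dec_closed by blast
  let ?z = "pw tm g (num_of (int h))"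
  have z: "ok ?z" "dec ?z = dec g [^] h" using dec_pw[OF ok(1)] num by auto
  have z1: "pw tm ?z (num_of (int d)) = un" and len: "length invs = length E"
    and inv: "list_all (\<lambda>(e, v). tm (pl (pw tm ?z e) mu) v = un) (zip E invs)"
    using assms(1) by (auto simp: gen_ok_def Let_def)
  have zd: "(dec g [^] h) [^] d = \<one>" using dec_pw[OF z(1), of "num_of (int d)"] z1 z(2) num dec_un by simp
  have ne: "(dec g [^] h) [^] nat_of_num e \<noteq> \<one>" if e: "e \<in> set E" for e
  proof
    assume eq: "(dec g [^] h) [^] nat_of_num e = \<one>"
    obtain k where k: "k < length E" "E ! k = e" using e unfolding in_set_conv_nth by blast
    let ?v = "invs ! k"
    have v: "ok ?v" "tm (pl (pw tm ?z e) mu) ?v = un"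
      using k len ok(2) inv by (auto simp: list_all_length)
    have p: "ok (pw tm ?z e)" "dec (pw tm ?z e) = \<one>"
      using dec_pw[OF z(1), of e] z(2) eq by auto
    \<comment> \<open>If z^e were 1, the code of z^e - 1 would decode to 0, and so would its product
      with the witness; but that product is the code of 1.\<close>
    have "dec (pl (pw tm ?z e) mu) = \<zero>" using dec_pl[OF p(1) dec_mu(1)] p(2) dec_mu by (simp add: r_neg)
    then have "dec un = \<zero>"
      using dec_tm[of "pl (pw tm ?z e) mu" ?v] dec_pl[OF p(1) dec_mu(1)] v dec_closed[OF v(1)] by simp
    then show False using dec_un by simp
  qed
  obtain i c where i: "i < d" "c \<in> carrier R" "a = dec g [^] i \<otimes> c [^] d"
    using coset_representatives[OF g zd E ne a] by blast
  have "dec un \<otimes> dec g [^] i \<in> psums R (nat_of_num (num_of (int d))) n"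
    using rows_ok_psums[OF assms(2) ok(3) ok(1) dec_un(1)] i(1) by simp
  then have "dec g [^] i \<in> psums R d n" using num dec_un g by simp
  then have "c [^] d \<otimes> dec g [^] i \<in> psums R d n" using psums_mult_pow i by blast
  then show ?thesis using i g by (simp add: m_comm)
qed

end

text \<open>Lists of length \<open>m\<close> represent elements of $\mathbb{Z}[X] / (p, X^m - f)$, where \<open>f\<close> of degree less than
  \<open>m\<close> is given by its coefficients \<open>fr\<close>, constant term first; \<open>vgen\<close> is $X$.\<close>

fun vplus :: "int \<Rightarrow> int list \<Rightarrow> int list \<Rightarrow> int list" where
  "vplus p (a # as) (b # bs) = ((a + b) mod p) # vplus p as bs"
| "vplus p _ _ = []"

definition vscale :: "int \<Rightarrow> int \<Rightarrow> int list \<Rightarrow> int list" where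
  "vscale p c as = (if c = 0 then map (\<lambda>_. 0) as else if c = 1 then as else map (\<lambda>a. (c * a) mod p) as)"

text \<open>Multiplication by X: the top coefficient would belong to X^m and is carried back as a
  multiple of f.\<close>

definition vshift :: "int \<Rightarrow> int list \<Rightarrow> int list \<Rightarrow> int list" where
  "vshift p fr as = (if last as = 0 then 0 # butlast as
     else vplus p (0 # butlast as) (vscale p (last as) fr))"

fun vtimes :: "int \<Rightarrow> int list \<Rightarrow> int list \<Rightarrow> int list \<Rightarrow> int list" where
  "vtimes p fr [] bs = map (\<lambda>_. 0) bs"
| "vtimes p fr [a] bs = vscale p a bs"
| "vtimes p fr (a # as) bs = (let v = vshift p fr (vtimes p fr as bs) in
     if a = 0 then v else vplus p (vscale p a bs) v)"

fun vconst :: "int \<Rightarrow> int list \<Rightarrow> int list" where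
  "vconst c [] = []"
| "vconst c (_ # r) = c # map (\<lambda>_. 0) r"

fun vgen :: "int list \<Rightarrow> int list" where
  "vgen (_ # _ # r) = 0 # 1 # map (\<lambda>_. 0) r"
| "vgen _ = []"

section \<open>Soundness of arithmetic with residues and coefficient lists\<close>

context cring
begin

lemma int_embed_mod:
  assumes "[p] \<cdot> \<one> = \<zero>"
  shows "[(a mod p :: int)] \<cdot> \<one> = [a] \<cdot> \<one>"
proof -
  have "[a] \<cdot> \<one> = [(p * (a div p) + a mod p)] \<cdot> \<one>" by simp
  also have "\<dots> = [p] \<cdot> \<one> \<otimes> [(a div p)] \<cdot> \<one> \<oplus> [(a mod p)] \<cdot> \<one>"
    by (simp only: int_embed_add int_embed_mult)
  finally show ?thesis using assms by simp
qed

lemma coded_cring_int: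
  assumes "[(q::int)] \<cdot> \<one> = \<zero>"
  shows "coded_cring R (\<lambda>_. True) (\<lambda>c. [c] \<cdot> \<one>) (\<lambda>a b. (a * b) mod q) (\<lambda>a b. (a + b) mod q) 0 1 (q - 1)"
proof (intro coded_cring.intro coded_cring_axioms.intro cring_axioms)
  have "[(q - 1)] \<cdot> \<one> = [q] \<cdot> \<one> \<oplus> [(- 1 :: int)] \<cdot> \<one>" using int_embed_add[of q "- 1"] by simp
  then show "[(q - 1)] \<cdot> \<one> = \<ominus> \<one>" using assms by (simp add: int_embed_neg int_embed_one)
qed (simp_all add: int_embed_mod[OF assms] int_embed_add int_embed_mult int_embed_one int_embed_zero)

lemma horner_append:
  assumes "s \<in> carrier R"
  shows "horner R s (as @ [c]) = horner R s as \<oplus> [c] \<cdot> \<one> \<otimes> s [^] length as"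
proof (induction as)
  case (Cons a as)
  have "s \<otimes> ([c] \<cdot> \<one> \<otimes> s [^] length as) = [c] \<cdot> \<one> \<otimes> s [^] length (a # as)"
    using assms m_lcomm[of s "[c] \<cdot> \<one>" "s [^] length as"] nat_pow_Suc2[of s "length as"] by simp
  with Cons show ?case using assms by (simp add: r_distr a_assoc)
qed (use assms in simp)

lemma horner_zeros: "s \<in> carrier R \<Longrightarrow> horner R s (map (\<lambda>_. 0) as) = \<zero>"
  by (induction as) (auto simp: int_embed_zero)

end

text \<open>The element \<open>s\<close> is used in two roles: as the class of X in the polynomial
  ring modulo X^m - f, and as a root of X^m - f in the given field.\<close>

locale horner_mod = cring +
  fixes p :: int and fr :: "int list" and s
  assumes p: "[p] \<cdot> \<one> = \<zero>" and s: "s \<in> carrier R"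
    and fr: "fr \<noteq> []" and rel: "s [^] length fr = horner R s fr"
begin

lemma horner_vplus:
  assumes "length as = length bs"
  shows "length (vplus p as bs) = length as \<and>
    horner R s (vplus p as bs) = horner R s as \<oplus> horner R s bs"
  using assms
  by (induction rule: list_induct2)
    (use s in \<open>auto simp: int_embed_mod[OF p] int_embed_add r_distr a_ac\<close>)

lemma horner_vscale:
  "length (vscale p c as) = length as \<and> horner R s (vscale p c as) = [c] \<cdot> \<one> \<otimes> horner R s as"
proof -
  have "horner R s (map (\<lambda>a. (c * a) mod p) as) = horner R s (map ((*) c) as)"
    by (induction as) (use s in \<open>auto simp: int_embed_mod[OF p]\<close>)
  moreover have "map ((*) 0) as = map (\<lambda>_. 0) as" "map ((*) 1) as = as"
    by (simp_all add: map_idI)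
  ultimately have "horner R s (vscale p c as) = horner R s (map ((*) c) as)"
    unfolding vscale_def by (cases "c = 0"; cases "c = 1") (simp_all only: if_True if_False simp_thms)
  then show ?thesis using horner_smult s by (simp add: vscale_def)
qed

lemma horner_vshift:
  assumes "length as = length fr"
  shows "length (vshift p fr as) = length fr \<and> horner R s (vshift p fr as) = s \<otimes> horner R s as"
proof -
  have ne: "as \<noteq> []" using assms fr by auto
  let ?b = "butlast as" and ?c = "last as"
  have len: "length (0 # ?b) = length fr" "Suc (length ?b) = length fr" using ne assms fr by simp_all
  have "horner R s (vshift p fr as) = s \<otimes> horner R s ?b \<oplus> [?c] \<cdot> \<one> \<otimes> s [^] length fr"
    using horner_vplus[of "0 # ?b" "vscale p ?c fr"] horner_vscale[of ?c fr] len s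
    by (simp add: vshift_def rel[symmetric] int_embed_zero)
  also have "s [^] length fr = s \<otimes> s [^] length ?b"
    using len(2) s nat_pow_Suc2[of s "length ?b"] by simp
  also have "s \<otimes> horner R s ?b \<oplus> [?c] \<cdot> \<one> \<otimes> (s \<otimes> s [^] length ?b) = s \<otimes> horner R s (?b @ [?c])"
    using s by (simp only: horner_append) (simp add: r_distr m_lcomm)
  finally show ?thesis
    using horner_vplus[of "0 # ?b" "vscale p ?c fr"] horner_vscale[of ?c fr] len ne
    by (simp add: vshift_def)
qed

lemma horner_vtimes:
  assumes "length bs = length fr"
  shows "length (vtimes p fr as bs) = length fr \<and>
    horner R s (vtimes p fr as bs) = horner R s as \<otimes> horner R s bs"
proof (induction as)
  case Nil
  then show ?case using assms s by (simp add: horner_zeros)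
next
  case (Cons a as)
  show ?case
  proof (cases as)
    case Nil
    then show ?thesis using horner_vscale[of a bs] assms s by simp
  next
    case (Cons a' as')
    then have "vtimes p fr (a # as) bs = (if a = 0 then vshift p fr (vtimes p fr as bs)
        else vplus p (vscale p a bs) (vshift p fr (vtimes p fr as bs)))"
      by (simp add: Let_def)
    then show ?thesis
      using horner_vplus[of "vscale p a bs" "vshift p fr (vtimes p fr as bs)"] horner_vscale[of a bs]
        horner_vshift[of "vtimes p fr as bs"] Cons.IH assms s
      by (simp add: l_distr m_assoc int_embed_zero)
  qed
qed

lemma coded_cring_list:
  "coded_cring R (\<lambda>v. length v = length fr) (horner R s) (vtimes p fr) (vplus p)
    (map (\<lambda>_. 0) fr) (vconst 1 fr) (vconst (p - 1) fr)"
proof (intro coded_cring.intro coded_cring_axioms.intro cring_axioms)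
  obtain f fs where f: "fr = f # fs" using fr by (cases fr) auto
  have c: "length (vconst c fr) = length fr" "horner R s (vconst c fr) = [c] \<cdot> \<one>" for c
    using s by (simp_all add: f horner_zeros)
  show "length (vconst 1 fr) = length fr" "horner R s (vconst 1 fr) = \<one>"
    "length (vconst (p - 1) fr) = length fr"
    using c by (simp_all add: int_embed_one)
  show "horner R s (vconst (p - 1) fr) = \<ominus> \<one>"
    using c p int_embed_add[of p "- 1"] by (simp add: int_embed_neg int_embed_one)
qed (use s horner_vtimes horner_vplus in \<open>auto simp: horner_zeros\<close>)

lemma horner_vgen:
  assumes "2 \<le> length fr"
  shows "length (vgen fr) = length fr" "horner R s (vgen fr) = s"
proof -
  obtain a b r where "fr = a # b # r" using assms by (metis Suc_le_length_iff numeral_2_eq_2)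
  then show "length (vgen fr) = length fr" "horner R s (vgen fr) = s"
    using s by (simp_all add: horner_zeros int_embed_zero int_embed_one)
qed

end

section \<open>A root of the defining polynomial in the given field\<close>

lemma (in ring_hom_ring) hom_int_embed: "h ([c] \<cdot>\<^bsub>R\<^esub> \<one>\<^bsub>R\<^esub>) = [(c::int)] \<cdot>\<^bsub>S\<^esub> \<one>\<^bsub>S\<^esub>"
proof -
  interpret A: group_hom "add_monoid R" "add_monoid S" h by (rule a_group_hom)
  show ?thesis using A.hom_int_pow[of "\<one>\<^bsub>R\<^esub>" c] by (simp add: add_pow_def)
qed

lemma (in ring_hom_ring) hom_horner:
  "x \<in> carrier R \<Longrightarrow> h (horner R x cs) = horner S (h x) cs"
  by (induction cs) (simp_all add: hom_int_embed)

text \<open>With x = X this shows that the part subtracted from X^m has smaller degree and cannot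
  cancel the leading term.\<close>

lemma (in UP_ring) deg_horner:
  assumes "x \<in> carrier P" "deg R x \<le> 1"
  shows "horner P x cs = \<zero>\<^bsub>P\<^esub> \<or> deg R (horner P x cs) < length cs"
proof (induction cs)
  case (Cons c cs)
  interpret C: ring_hom_ring R P "\<lambda>a. up_ring.monom P a 0"
    by (intro ring_hom_ringI2 R.ring_axioms P.ring_axioms const_ring_hom)
  have "[c] \<cdot>\<^bsub>P\<^esub> \<one>\<^bsub>P\<^esub> = up_ring.monom P ([c] \<cdot>\<^bsub>R\<^esub> \<one>\<^bsub>R\<^esub>) 0"
    using C.hom_int_embed[of c] by simp
  then have "deg R ([c] \<cdot>\<^bsub>P\<^esub> \<one>\<^bsub>P\<^esub>) = 0" by simp
  moreover have "deg R (x \<otimes>\<^bsub>P\<^esub> horner P x cs) \<le> length cs"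
  proof (cases "horner P x cs = \<zero>\<^bsub>P\<^esub>")
    case True
    then show ?thesis using assms by simp
  next
    case False
    have "deg R (x \<otimes>\<^bsub>P\<^esub> horner P x cs) \<le> deg R x + deg R (horner P x cs)"
      using assms by (intro deg_mult_ring) auto
    then show ?thesis using False Cons assms by simp
  qed
  ultimately have "deg R (horner P x (c # cs)) \<le> length cs"
    using deg_add[of "[c] \<cdot>\<^bsub>P\<^esub> \<one>\<^bsub>P\<^esub>" "x \<otimes>\<^bsub>P\<^esub> horner P x cs"] assms by simp
  then show ?case by simp
qed simp

text \<open>Without a root of $f$, the cofactor of $f$ in $X^q - X$ would vanish on the whole field.\<close>

lemma (in field) exists_root:
  assumes fin: "finite (carrier R)" and q: "card (carrier R) = nat_of_num q"
    and p: "[p] \<cdot> \<one> = \<zero>" and len: "2 \<le> length fr"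
    and frob: "pw (vtimes p fr) (vgen fr) q = vgen fr"
  shows "\<exists>\<theta>\<in>carrier R. \<theta> [^] length fr = horner R \<theta> fr"
proof (rule ccontr)
  assume noroot: "\<not> ?thesis"
  define P where "P = UP R"
  interpret P: UP_domain R P by unfold_locales (simp add: P_def)
  define x where "x = up_ring.monom P \<one> 1"
  define f where "f = up_ring.monom P \<one> (length fr) \<ominus>\<^bsub>P\<^esub> horner P x fr"
  define N where "N = nat_of_num q"
  have xc: "x \<in> carrier P" by (simp add: x_def)
  have fc: "f \<in> carrier P" using xc by (simp add: f_def)
  have xpow: "x [^]\<^bsub>P\<^esub> (n::nat) = up_ring.monom P \<one> n" for n
    using P.monom_pow[of \<one> 1 n] by (simp add: x_def)
  have "card {\<zero>, \<one>} \<le> N"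
    using card_mono[OF fin, of "{\<zero>, \<one>}"] q by (simp add: N_def)
  then have N2: "2 \<le> N" using one_not_zero by simp
  interpret C: ring_hom_ring R P "\<lambda>a. up_ring.monom P a 0"
    by (intro ring_hom_ringI2 ring_axioms P.P.ring_axioms P.const_ring_hom)
  interpret I: ideal "PIdl\<^bsub>P\<^esub> f" P by (rule P.P.cgenideal_ideal[OF fc])
  let ?S = "P Quot (PIdl\<^bsub>P\<^esub> f)"
  interpret h: ring_hom_ring P ?S "(+>\<^bsub>P\<^esub>) (PIdl\<^bsub>P\<^esub> f)" by (rule I.rcos_ring_hom_ring)
  interpret S: cring ?S using I.quotient_is_cring[OF P.P.cring_axioms] .
  let ?h = "(+>\<^bsub>P\<^esub>) (PIdl\<^bsub>P\<^esub> f)"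
  have hf: "?h f = \<zero>\<^bsub>?S\<^esub>"
    by (rule trans[OF trans[OF I.a_rcos_const[OF P.P.cgenideal_self[OF fc]]
          I.a_rcos_const[OF I.zero_closed, symmetric]] h.hom_zero])
  interpret M: horner_mod ?S p fr "?h x"
  proof
    have "[p] \<cdot>\<^bsub>P\<^esub> \<one>\<^bsub>P\<^esub> = \<zero>\<^bsub>P\<^esub>" using C.hom_int_embed[of p] p by simp
    then show "[p] \<cdot>\<^bsub>?S\<^esub> \<one>\<^bsub>?S\<^esub> = \<zero>\<^bsub>?S\<^esub>" using h.hom_int_embed[of p] by simp
    show "?h x \<in> carrier ?S" using xc by simp
    show "fr \<noteq> []" using len by auto
    have "up_ring.monom P \<one> (length fr) = f \<oplus>\<^bsub>P\<^esub> horner P x fr"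
      using xc by (simp add: f_def P.P.minus_eq P.P.a_assoc P.P.l_neg)
    then have "?h (x [^]\<^bsub>P\<^esub> length fr) = ?h (f \<oplus>\<^bsub>P\<^esub> horner P x fr)" by (simp add: xpow)
    then show "?h x [^]\<^bsub>?S\<^esub> length fr = horner ?S (?h x) fr"
      using xc fc hf by (simp add: h.hom_nat_pow h.hom_horner)
  qed
  \<comment> \<open>The evaluated power check says that X^N = X in the quotient ring, so that X^N -
    X is a multiple of X^m - f.\<close>
  have "?h x [^]\<^bsub>?S\<^esub> N = ?h x"
    using coded_cring.dec_pw[OF M.coded_cring_list, of "vgen fr" q] M.horner_vgen[OF len] frob
    by (simp add: N_def)
  then have "?h (x [^]\<^bsub>P\<^esub> N) = ?h x" using xc by (simp add: h.hom_nat_pow)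
  define w where "w = x [^]\<^bsub>P\<^esub> N \<ominus>\<^bsub>P\<^esub> x"
  have wc: "w \<in> carrier P" using xc by (simp add: w_def)
  have "?h w = \<zero>\<^bsub>?S\<^esub>"
    using \<open>?h (x [^]\<^bsub>P\<^esub> N) = ?h x\<close> xc
    by (simp add: w_def P.P.minus_eq h.S.r_neg del: h.hom_nat_pow)
  then have "w \<in> PIdl\<^bsub>P\<^esub> f"
    using ideal.rcos_const_imp_mem[OF I.is_ideal wc]
      trans[OF h.hom_zero[symmetric] I.a_rcos_const[OF I.zero_closed]] by (simp only:)
  then obtain g where g: "g \<in> carrier P" "w = g \<otimes>\<^bsub>P\<^esub> f"
    unfolding cgenideal_def by blast
  have wcoeff: "up_ring.coeff P w N = \<one>"
    using N2 xc by (simp add: w_def xpow) (simp add: x_def minus_eq)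
  then have "w \<noteq> \<zero>\<^bsub>P\<^esub>" by auto
  then have ne: "g \<noteq> \<zero>\<^bsub>P\<^esub>" "f \<noteq> \<zero>\<^bsub>P\<^esub>" using g fc by auto
  have "deg R w \<le> max (deg R (x [^]\<^bsub>P\<^esub> N)) (deg R (\<ominus>\<^bsub>P\<^esub> x))"
    unfolding w_def P.P.minus_eq using xc by (intro P.deg_add) auto
  then have "deg R w \<le> N"
    using N2 xc one_not_zero by (simp add: xpow) (simp add: x_def)
  moreover have "deg R w = deg R g + deg R f" using g fc ne by simp
  moreover have "0 < deg R f"
  proof (rule ccontr)
    assume "\<not> 0 < deg R f"
    then have "up_ring.coeff P f (length fr) = \<zero>" using len fc by (intro P.deg_aboveD) auto
    moreover have "up_ring.coeff P (horner P x fr) (length fr) = \<zero>"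
      using P.deg_horner[OF xc, of fr] xc P.deg_aboveD[of "horner P x fr" "length fr"]
      by (auto simp: x_def one_not_zero)
    ultimately show False using xc one_not_zero by (simp add: f_def minus_eq)
  qed
  \<comment> \<open>At every a of the field X^N - X vanishes and X^m - f does not, so g has N roots.
    Together with the positive degree of the other factor this exceeds the degree N of the
    product.\<close>
  moreover have "N \<le> deg R g"
  proof -
    have "UnivPoly.eval R R id a g = \<zero>" if a: "a \<in> carrier R" for a
    proof -
      interpret E: UP_pre_univ_prop R R id P by unfold_locales (simp_all add: P_def)
      interpret e: ring_hom_ring P R "UnivPoly.eval R R id a"
        by (intro ring_hom_ringI2 P.P.ring_axioms ring_axioms E.eval_ring_hom a)
      have x: "UnivPoly.eval R R id a x = a" using a by (simp add: x_def P.evalRR_monom)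
      have "UnivPoly.eval R R id a f = a [^] length fr \<ominus> horner R a fr"
        using a xc e.hom_horner[OF xc, of fr]
        by (simp add: f_def P.evalRR_sub P.evalRR_monom x)
      then have "UnivPoly.eval R R id a f \<noteq> \<zero>" using noroot a by auto
      moreover have "UnivPoly.eval R R id a w = \<zero>"
      proof -
        have "a [^] N = a"
        proof (cases "a = \<zero>")
          case False
          have "a [^] N = a [^] (N - 1) \<otimes> a" using a N2 nat_pow_mult[OF a, of "N - 1" 1] by simp
          then show ?thesis using pow_card_minus_one[OF fin a False] q a by (simp add: N_def)
        qed (use N2 in \<open>simp add: nat_pow_zero\<close>)
        then show ?thesis using a xc x by (simp add: w_def xpow P.evalRR_sub P.evalRR_monom)
      qed
      ultimately show ?thesis
        using g a fc P.evalRR_mult[OF g(1) fc a] P.carrier_evalRR[OF a] integral by metis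
    qed
    then have "{a \<in> carrier R. UnivPoly.eval R R id a g = \<zero>} = carrier R" by auto
    then show ?thesis using P.roots_bound[OF g(1) ne(1) fin] q by (simp add: N_def)
  qed
  ultimately show False by simp
qed

section \<open>The order of a finite field is a prime power\<close>

context field
begin

lemma card_embed_zero:
  assumes "finite (carrier R)"
  shows "[int (card (carrier R))] \<cdot> \<one> = \<zero>"
  using add.pow_order_eq_1[OF one_closed] by (simp add: add_pow_int_ge order_def)

text \<open>Sylow's theorem with exponent 1 yields an additive subgroup of order p, hence a nonzero
  x with p x = 0; in a field x can be cancelled.\<close>

lemma prime_embed_zero:
  assumes fin: "finite (carrier R)" and p: "Factorial_Ring.prime p" "p dvd card (carrier R)"
  shows "[int p] \<cdot> \<one> = \<zero>"
proof -
  let ?G = "add_monoid R"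
  obtain m where m: "order ?G = p ^ 1 * m" using p by (auto simp: order_def)
  obtain K where K: "subgroup K ?G" "card K = p ^ 1"
    using sylow_thm[OF p(1) add.is_group m] fin by auto
  interpret K: group "?G\<lparr>carrier := K\<rparr>" by (rule add.subgroup_imp_group[OF K(1)])
  have "\<not> K \<subseteq> {\<zero>}"
    using card_mono[of "{\<zero>}" K] K(2) prime_gt_1_nat[OF p(1)] by auto
  then obtain x where x: "x \<in> K" "x \<noteq> \<zero>" by blast
  have xc: "x \<in> carrier R" using x subgroup.subset[OF K(1)] by auto
  have "x [^]\<^bsub>?G\<lparr>carrier := K\<rparr>\<^esub> order (?G\<lparr>carrier := K\<rparr>) = \<one>\<^bsub>?G\<lparr>carrier := K\<rparr>\<^esub>"
    using x by (intro K.pow_order_eq_1) simp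
  then have "[p] \<cdot> x = \<zero>" using K(2) by (simp add: order_def add_pow_def nat_pow_def)
  then have "[int p] \<cdot> \<one> \<otimes> x = \<zero>" using int_mult_one(1)[OF xc, of "int p"] by (simp add: add_pow_int_ge)
  then show ?thesis using integral xc x by blast
qed

text \<open>Two distinct primes dividing the order would both annihilate 1, and a Bezout combination
  of them would give 1 = 0.\<close>

lemma card_prime_power:
  assumes fin: "finite (carrier R)"
  shows "\<exists>p m. Factorial_Ring.prime p \<and> card (carrier R) = p ^ m"
proof -
  let ?q = "card (carrier R)"
  have "?q \<noteq> 1" using one_not_zero one_closed zero_closed by (metis card_1_singletonE singletonD)
  then obtain p where p: "Factorial_Ring.prime p" "p dvd ?q" using prime_factor_nat by blast
  have uniq: "r = p" if r: "Factorial_Ring.prime r" "r dvd ?q" for r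
  proof (rule ccontr)
    assume "r \<noteq> p"
    then have "coprime r p" using primes_coprime r p by blast
    then have "gcd (int r) (int p) = 1" by simp
    then obtain u v where "u * int r + v * int p = 1" using bezout_int by metis
    then have "\<one> = [u] \<cdot> \<one> \<otimes> [int r] \<cdot> \<one> \<oplus> [v] \<cdot> \<one> \<otimes> [int p] \<cdot> \<one>"
      by (metis int_embed_add int_embed_mult int_embed_one)
    then show False using prime_embed_zero[OF fin] r p one_not_zero by simp
  qed
  have q0: "?q \<noteq> 0" using fin one_closed by auto
  have "prime_factors ?q = {p}"
    unfolding prime_factors_dvd[OF q0] using uniq p by blast
  then have "?q = p ^ multiplicity p ?q"
    using prod_prime_factors[of ?q] q0 by simp
  then show ?thesis using p by blast
qed

end

text \<open>The numerical hypothesis of \<open>psums_three\<close> in integers, with q in place of d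
  h + 1.\<close>

definition bound_ok :: "int \<Rightarrow> int \<Rightarrow> int \<Rightarrow> bool" where
  "bound_ok q h n \<longleftrightarrow> 3 \<le> n \<and> h ^ 5 * (h + 1) > q * (q - h) * (q * q + h ^ 3 + h * h)"

text \<open>The \<open>d\<close>-th powers of \<open>zrow\<close> sum to \<open>-1\<close>, which makes 0 a nontrivial sum of powers; those of row \<open>j\<close> sum to
  \<open>g\<^sup>j\<close>, with row 0 left out. Without rows the nonzero elements are covered by \<open>bound_ok\<close>, and \<open>g\<close> and \<open>invs\<close> are ignored.\<close>

definition cert_ok where
  "cert_ok tm pl zr un mu d E q n g invs rows zrow =
     (q mod d = 1 \<and> short (n - 1) zrow \<and> pwsum tm pl (num_of d) zr zrow = mu \<and>
      (if rows = [] then bound_ok q ((q - 1) div d) n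
       else gen_ok tm pl un mu (num_of d) (num_of ((q - 1) div d)) g E invs \<and>
         rows_ok tm pl (num_of d) zr n g un d ([un] # rows)))"

definition prime_ok where
  "prime_ok d E = (\<lambda>(q :: int, n, g, invs, rows, zrow).
     cert_ok (\<lambda>a b. (a * b) mod q) (\<lambda>a b. (a + b) mod q) 0 1 (q - 1) d E q n g invs rows zrow)"

fun same_length :: "'c list \<Rightarrow> 'c list \<Rightarrow> bool" where
  "same_length [] [] = True"
| "same_length (_ # xs) (_ # ys) = same_length xs ys"
| "same_length _ _ = False"

text \<open>The condition on \<open>vgen fr\<close> says that the degree m is at least 2, and the
  fold computes p^m. The power check is the divisibility of X^q - X by X^m - f that
  \<open>exists_root\<close> relies on.\<close>

definition ext_ok where
  "ext_ok d E = (\<lambda>(q :: int, n, p, fr, g, invs, rows, zrow).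
     vgen fr \<noteq> [] \<and> foldr (\<lambda>_ a. p * a) fr 1 = q \<and> same_length fr g \<and>
     list_all (same_length fr) invs \<and> list_all (list_all (same_length fr)) rows \<and>
     list_all (same_length fr) zrow \<and> pw (vtimes p fr) (vgen fr) (num_of q) = vgen fr \<and>
     cert_ok (vtimes p fr) (vplus p) (map (\<lambda>_. 0) fr) (vconst 1 fr) (vconst (p - 1) fr)
       d E q n g invs rows zrow)"

lemma same_length: "same_length xs ys \<longleftrightarrow> length xs = length ys"
  by (induction xs ys rule: same_length.induct) auto

lemma (in coded_cring) cert_ok_unit_psums:
  assumes R: "field R" "finite (carrier R)"
    and q: "int (card (carrier R)) = q" and d: "1 < d" and E: "proper_exponents d E"
    and cert: "cert_ok tm pl zr un mu (int d) E q n g invs rows zrow"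
    and ok: "ok g" "list_all ok invs" "list_all (list_all ok) rows" "list_all ok zrow"
  shows "carrier R \<subseteq> unit_psums R d (nat n)"
proof -
  define h where "h = (card (carrier R) - 1) div d"
  have "int (card (carrier R)) mod int d = 1" using cert q by (simp add: cert_ok_def)
  then have "card (carrier R) mod d = 1" by (simp flip: zmod_int)
  then have ch: "card (carrier R) = d * h + 1"
    by (metis h_def div_mult_mod_eq add_diff_cancel_right' mult.commute nonzero_mult_div_cancel_right d not_less_zero)
  interpret field R by fact
  interpret coded_field_powers R ok dec tm pl zr un mu d h
    by unfold_locales (use R ch d in auto)
  have qh: "q = int (d * h + 1)" and hq: "(q - 1) div int d = int h"
    using q ch d by auto
  have num: "nat_of_num (num_of (int d)) = d"
    using d_pos by (simp add: num_of_def num_of_nat_inverse)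
  have sh: "short (n - 1) zrow" using cert by (simp add: cert_ok_def)
  \<comment> \<open>Acceptance by \<open>short\<close> implies that its bound n - 1 is not negative,
    so n can be read as a natural number.\<close>
  then have n: "0 < n" "n = int (nat n)" "n - 1 = int (nat n - 1)" using short_length[OF sh] by auto
  have "short (int (nat n - 1)) zrow" using sh by (simp only: n(3))
  then have "dec (pwsum tm pl (num_of (int d)) zr zrow) \<in> psums R (nat_of_num (num_of (int d))) (nat n - 1)"
    by (rule dec_pwsum_short[OF ok(4)])
  moreover have "pwsum tm pl (num_of (int d)) zr zrow = mu" using cert by (simp add: cert_ok_def)
  ultimately have "\<ominus> \<one> \<in> psums R d (nat n - 1)" by (simp only: num dec_mu(2))
  moreover have "a \<in> psums R d (nat n)" if a: "a \<in> carrier R" "a \<noteq> \<zero>" for a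
  proof (cases "rows = []")
    case True
    then have b: "3 \<le> n" "q * (q - int h) * (q * q + int h ^ 3 + int h * int h) < int h ^ 5 * (int h + 1)"
      using cert by (auto simp: cert_ok_def bound_ok_def hq)
    have "h \<le> d * h + 1" using d by (cases d) auto
    then have r: "q - int h = int (d * h + 1 - h)" using qh by (simp only: of_nat_diff)
    have e: "int (x * y * (x\<^sup>2 + h ^ 3 + h\<^sup>2)) = int x * int y * (int x * int x + int h ^ 3 + int h * int h)"
      for x y by (simp add: power2_eq_square)
    have f: "int (h ^ 5 * (h + 1)) = int h ^ 5 * (int h + 1)" by (simp add: algebra_simps)
    have "int ((d * h + 1) * (d * h + 1 - h) * ((d * h + 1)\<^sup>2 + h ^ 3 + h\<^sup>2)) < int (h ^ 5 * (h + 1))"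
      using b(2) by (simp only: e f r flip: qh)
    then have "a \<in> psums R d 3" using a by (intro psums_three) (simp only: of_nat_less_iff)
    moreover have "psums R d 3 \<subseteq> psums R d (nat n)" using b(1) d by (intro psums_mono) auto
    ultimately show ?thesis by blast
  next
    case False
    then have "gen_ok tm pl un mu (num_of (int d)) (num_of (int h)) g E invs"
      "rows_ok tm pl (num_of (int d)) zr (int (nat n)) g un (int d) ([un] # rows)"
      using cert n(1) by (simp_all add: cert_ok_def hq)
    moreover have "list_all (list_all ok) ([un] # rows)" using ok(3) dec_un by simp
    ultimately show ?thesis using gen_ok_psums ok E a by blast
  qed
  ultimately show ?thesis using d by (intro carrier_unit_psumsI) auto
qed

lemma (in field) prime_ok_unit_psums:
  assumes "finite (carrier R)" "int (card (carrier R)) = q" "1 < d" "proper_exponents d E"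
    and "prime_ok (int d) E (q, n, g, invs, rows, zrow)"
  shows "carrier R \<subseteq> unit_psums R d (nat n)"
proof -
  interpret coded_cring R "\<lambda>_. True" "\<lambda>c. [c] \<cdot> \<one>" "\<lambda>a b. (a * b) mod q" "\<lambda>a b. (a + b) mod q" 0 1 "q - 1"
    using card_embed_zero assms by (intro coded_cring_int) auto
  show ?thesis
    using assms by (intro cert_ok_unit_psums field_axioms) (auto simp: prime_ok_def list_all_iff)
qed

lemma (in field) ext_ok_unit_psums:
  assumes fin: "finite (carrier R)" and q: "int (card (carrier R)) = q" and "1 < d" "proper_exponents d E"
    and cert: "ext_ok (int d) E (q, n, p, fr, g, invs, rows, zrow)"
  shows "carrier R \<subseteq> unit_psums R d (nat n)"
proof -
  have len: "2 \<le> length fr" using cert by (cases fr rule: vgen.cases) (auto simp: ext_ok_def)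
  then have ne: "fr \<noteq> []" by auto
  have "foldr (\<lambda>_ a. p * a) fr 1 = p ^ length fr" by (induction fr) auto
  then have qp: "q = p ^ length fr" using cert by (simp add: ext_ok_def)
  \<comment> \<open>The order p^m of the field annihilates 1; since a field has no nonzero nilpotent
    elements, p does so already.\<close>
  have "[(p ^ m)] \<cdot> \<one> = ([p] \<cdot> \<one>) [^] m" for m :: nat
    by (induction m) (simp_all add: int_embed_one int_embed_mult mult.commute[of p])
  then have "([p] \<cdot> \<one>) [^] length fr = \<zero>" using card_embed_zero[OF fin] q qp by simp
  then have p: "[p] \<cdot> \<one> = \<zero>" using pow_eq_zero_iff[of "[p] \<cdot> \<one>" "length fr"] ne by simp
  have "carrier R \<noteq> {}" using one_closed by blast
  then have "q > 0" using q fin card_gt_0_iff[of "carrier R"] by simp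
  then have "card (carrier R) = nat_of_num (num_of q)"
    using q by (simp add: num_of_def num_of_nat_inverse)
  then obtain \<theta> where t: "\<theta> \<in> carrier R" "\<theta> [^] length fr = horner R \<theta> fr"
    using exists_root[OF fin _ p len] cert by (auto simp: ext_ok_def)
  interpret horner_mod R p fr \<theta>
    using p t ne by unfold_locales auto
  interpret coded_cring R "\<lambda>v. length v = length fr" "horner R \<theta>" "vtimes p fr" "vplus p"
    "map (\<lambda>_. 0) fr" "vconst 1 fr" "vconst (p - 1) fr"
    by (rule coded_cring_list)
  show ?thesis
    using assms
    by (intro cert_ok_unit_psums field_axioms) (auto simp: ext_ok_def list_all_iff same_length)
qed

fun composite_ok :: "(int \<times> int) list \<Rightarrow> int \<Rightarrow> bool" where
  "composite_ok [] q = False"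
| "composite_ok ((l, L) # ls) q = (if q mod l = 0 then L mod q \<noteq> 0 else composite_ok ls q)"

text \<open>In a pair \<open>(l, L)\<close> of the table, \<open>L\<close> is the largest power of the prime \<open>l\<close> below 13312, so a multiple of
  \<open>l\<close> below 13312 that does not divide \<open>L\<close> is not a prime power.\<close>

definition prime_table :: "(int \<times> int) list" where
    "prime_table = [(2, 8192), (3, 6561), (5, 3125), (7, 2401), (11, 1331), (13, 2197), (17, 4913),
    (19, 6859), (23, 12167), (29, 841), (31, 961), (37, 1369), (41, 1681), (43, 1849), (47, 2209),
    (53, 2809), (59, 3481), (61, 3721), (67, 4489), (71, 5041), (73, 5329), (79, 6241), (83, 6889),
    (89, 7921), (97, 9409), (101, 10201), (103, 10609), (107, 11449), (109, 11881), (113, 12769)]"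

text \<open>The arguments are \<open>q n g invs rows zrow\<close> for a field of prime order \<open>q\<close>, with \<open>p fr\<close> inserted after \<open>n\<close>
  for other fields; \<open>Zero\<close> is the case without rows. Nothing is claimed for the \<open>Excluded\<close> orders.\<close>

datatype cert =
    Zero int "int list"
  | Prime int int int "int list" "int list list" "int list"
  | Ext int int int "int list" "int list" "int list list" "int list list list" "int list list"
  | Excluded int

fun cert_key :: "cert \<Rightarrow> int" where
  "cert_key (Zero q _) = q"
| "cert_key (Prime q _ _ _ _ _) = q"
| "cert_key (Ext q _ _ _ _ _ _ _) = q"
| "cert_key (Excluded q) = q"

text \<open>A number of summands that differs from the default \<open>n0\<close> is accepted only if
  it is declared in \<open>exc\<close>, and an order may be skipped only if it is declared in
  \<open>bad\<close>; these two lists are what the final comparison with the triples sees.\<close>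

fun cert_check :: "int \<Rightarrow> num list \<Rightarrow> int \<Rightarrow> (int \<times> int) list \<Rightarrow> int list \<Rightarrow> cert \<Rightarrow> bool" where
  "cert_check d E n0 exc bad (Zero q zrow) = prime_ok d E (q, n0, 0, [], [], zrow)"
| "cert_check d E n0 exc bad (Prime q n g invs rows zrow) =
     (prime_ok d E (q, n, g, invs, rows, zrow) \<and> (if n = n0 then True else (q, n) \<in> set exc))"
| "cert_check d E n0 exc bad (Ext q n p fr g invs rows zrow) =
     (ext_ok d E (q, n, p, fr, g, invs, rows, zrow) \<and> (if n = n0 then True else (q, n) \<in> set exc))"
| "cert_check d E n0 exc bad (Excluded q) = (q \<in> set bad)"


text \<open>The certificates are listed by increasing order. Every candidate d i + 1 between two
  neighbours must be recognized as no prime power, so the completeness of the table is itself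
  checked by evaluation.\<close>

fun scan :: "int \<Rightarrow> num list \<Rightarrow> int \<Rightarrow> (int \<times> int) list \<Rightarrow> int list \<Rightarrow> int \<Rightarrow> int \<Rightarrow> cert list \<Rightarrow> bool" where
  "scan d E n0 exc bad h h0 [] = list_all (\<lambda>i. composite_ok prime_table (d * i + 1)) [h..h0]"
| "scan d E n0 exc bad h h0 (c # cs) = (let k = (cert_key c - 1) div d in
     cert_key c = d * k + 1 \<and> list_all (\<lambda>i. composite_ok prime_table (d * i + 1)) [h..k - 1] \<and>
     cert_check d E n0 exc bad c \<and> scan d E n0 exc bad (k + 1) h0 cs)"

text \<open>The first two inequalities place every h beyond \<open>h0\<close> under the general
  estimate; the third keeps all scanned orders in the range where the table of primes is
  valid.\<close>

definition certificates_ok where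
  "certificates_ok d E n0 h0 exc bad cs \<longleftrightarrow>
     d * d * (d - 1) \<le> h0 + 1 \<and> 3 * d * d \<le> h0 + 1 \<and> d * h0 + 1 < 13312 \<and>
     scan d E n0 exc bad 1 h0 cs"

lemma scan_covers:
  assumes "scan d E n0 exc bad h h0 cs" "h \<le> i" "i \<le> h0"
  shows "composite_ok prime_table (d * i + 1) \<or>
    (\<exists>c. cert_key c = d * i + 1 \<and> cert_check d E n0 exc bad c)"
  using assms
proof (induction cs arbitrary: h)
  case Nil
  then show ?case by (auto simp: list_all_iff)
next
  case (Cons c cs)
  define k where "k = (cert_key c - 1) div d"
  have c: "cert_key c = d * k + 1" "list_all (\<lambda>i. composite_ok prime_table (d * i + 1)) [h..k - 1]"
    "cert_check d E n0 exc bad c" "scan d E n0 exc bad (k + 1) h0 cs"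
    using Cons.prems(1) by (auto simp: Let_def k_def)
  consider "i < k" | "i = k" | "k < i" by linarith
  then show ?case
  proof cases
    case 1
    then show ?thesis using c(2) Cons.prems by (auto simp: list_all_iff)
  next
    case 2
    then show ?thesis using c by blast
  next
    case 3
    then show ?thesis using Cons.IH[OF c(4)] Cons.prems by simp
  qed
qed

text \<open>The exponents of the largest powers below 13312. The list ends with 113 because the
  square of the next prime, 127, is 16129, so every composite number in the range has a prime factor
  listed here.\<close>

definition prime_exponents :: "(nat \<times> nat) list" where
    "prime_exponents = [(2, 13), (3, 8), (5, 5), (7, 4), (11, 3), (13, 3), (17, 3), (19, 3), (23,
    3), (29, 2), (31, 2), (37, 2), (41, 2), (43, 2), (47, 2), (53, 2), (59, 2), (61, 2), (67, 2),
    (71, 2), (73, 2), (79, 2), (83, 2), (89, 2), (97, 2), (101, 2), (103, 2), (107, 2), (109, 2),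
    (113, 2)]"

lemma prime_table:
  assumes "(l, L) \<in> set prime_table"
  shows "\<exists>p e. l = int p \<and> Factorial_Ring.prime p \<and> L = int (p ^ e) \<and> 13312 \<le> p ^ Suc e"
proof -
  have eq: "prime_table = map (\<lambda>(p, e). (int p, int (p ^ e))) prime_exponents"
    by (simp add: prime_table_def prime_exponents_def)
  obtain p e where "(p, e) \<in> set prime_exponents" "l = int p" "L = int (p ^ e)"
    using assms unfolding eq by auto
  moreover have "list_all (\<lambda>(p, e). Factorial_Ring.prime p \<and> 13312 \<le> p ^ Suc e) prime_exponents"
    by (simp add: prime_exponents_def)
  ultimately show ?thesis unfolding list_all_iff by fast
qed

text \<open>A listed prime that divides p^m is p itself, and the size of p^m forces it to divide the
  largest power in the range.\<close>

lemma composite_ok_not_prime_power: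
  assumes "composite_ok ls q" "set ls \<subseteq> set prime_table" "Factorial_Ring.prime p" "q = int (p ^ m)" "q < 13312"
  shows False
  using assms(1,2)
proof (induction ls)
  case (Cons x ls)
  obtain l L where x: "x = (l, L)" by (cases x)
  then obtain r e where r: "l = int r" "Factorial_Ring.prime r" "L = int (r ^ e)" "13312 \<le> r ^ Suc e"
    using prime_table Cons.prems(2) by (metis list.set_intros(1) subsetD)
  show ?case
  proof (cases "q mod l = 0")
    case True
    then have "r dvd p ^ m" using r(1) assms(4) by (metis int_dvd_int_iff mod_0_imp_dvd)
    then have "r = p" using r(2) assms(3) prime_dvd_power primes_dvd_imp_eq by blast
    have "p ^ m < 13312" using assms(4,5) by (metis of_nat_less_iff of_nat_numeral)
    then have "p ^ m < p ^ Suc e" using r(4) unfolding \<open>r = p\<close> by linarith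
    then have "m < Suc e" by (rule power_less_imp_less_exp[OF prime_gt_1_nat[OF assms(3)]])
    then have "q dvd L" unfolding r(3) \<open>r = p\<close> assms(4) by (simp add: le_imp_power_dvd)
    then show False using True Cons.prems(1) x by simp
  next
    case False
    then show False using Cons x by simp
  qed
qed simp

text \<open>On the right h^3 (h + 1) = h^4 + h^3. The first hypothesis on h bounds the cubic term on
  the left by h^4; the second makes h^3 large enough for all lower terms.\<close>

lemma large_index_bound:
  fixes d h :: nat
  assumes "2 \<le> d" "d\<^sup>2 * (d - 1) \<le> h" "3 * d\<^sup>2 \<le> h"
  shows "(d * h + 1)\<^sup>2 * (d * h + 1 - h) < h ^ 3 * (h + 1)"
proof -
  obtain e where e: "d = e + 1" "1 \<le> e" using assms(1) that[of "d - 1"] by simp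
  have "d * h + 1 - h = e * h + 1" by (simp add: e)
  then have "(d * h + 1)\<^sup>2 * (d * h + 1 - h)
      = d\<^sup>2 * e * h ^ 3 + (d\<^sup>2 + 2 * d * e) * h\<^sup>2 + (2 * d + e) * h + 1"
    by (simp add: power2_eq_square power3_eq_cube algebra_simps)
  moreover have "d\<^sup>2 * e * h ^ 3 \<le> h * h ^ 3" using assms(2) e by (intro mult_right_mono) auto
  \<comment> \<open>The additional 2 d h^2 is reserved for the linear and constant terms; with it
    the coefficient is exactly 3 d^2, the origin of that constant.\<close>
  moreover have "(d\<^sup>2 + 2 * d * e) * h\<^sup>2 + 2 * d * h\<^sup>2 \<le> h ^ 3"
  proof -
    have "(d\<^sup>2 + 2 * d * e) * h\<^sup>2 + 2 * d * h\<^sup>2 = 3 * d\<^sup>2 * h\<^sup>2"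
      by (simp add: e power2_eq_square algebra_simps)
    also have "\<dots> \<le> h * h\<^sup>2" using assms(3) by (intro mult_right_mono) auto
    finally show ?thesis by (simp add: power2_eq_square power3_eq_cube)
  qed
  moreover have "(2 * d + e) * h + 1 < 2 * d * h\<^sup>2"
  proof -
    have h: "12 \<le> h"
    proof -
      have "2\<^sup>2 \<le> d\<^sup>2" using assms(1) by (intro power_mono) auto
      then show ?thesis using assms(3) by simp
    qed
    have "(2 * d + e) * h + 1 < 4 * d * h" using h e by (simp add: algebra_simps)
    also have "4 * d * h \<le> 2 * d * h * h" using h by simp
    finally show ?thesis by (simp add: power2_eq_square algebra_simps)
  qed
  ultimately have "(d * h + 1)\<^sup>2 * (d * h + 1 - h) < h * h ^ 3 + h ^ 3" by linarith
  then show ?thesis by (simp add: algebra_simps)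
qed

lemma (in ring) unit_psums_mono:
  assumes "0 < d" "m \<le> n"
  shows "unit_psums R d m \<subseteq> unit_psums R d n"
  using psums_mono[OF assms(1), of "m - 1" "n - 1"] assms(2) by (force simp: unit_psums_def)

text \<open>For odd d the element -1 is its own d-th power, so two summands suffice for zero. For
  even d it is written as a sum of two powers, which costs a third summand.\<close>

lemma (in field) large_unit_psums:
  assumes "finite (carrier R)" "card (carrier R) = d * h + 1" "2 \<le> d" "d\<^sup>2 * (d - 1) \<le> h" "3 * d\<^sup>2 \<le> h"
    and n: "2 \<le> n" "even d \<Longrightarrow> 3 \<le> n"
  shows "carrier R \<subseteq> unit_psums R d n"
proof -
  interpret finite_field_powers R d h
    by unfold_locales (use assms in auto)
  have two: "a \<in> psums R d 2" if "a \<in> carrier R" "a \<noteq> \<zero>" for a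
    using psums_two[OF large_index_bound] assms that by blast
  have "\<ominus> \<one> \<in> psums R d (n - 1)"
  proof (cases "even d")
    case True
    have "\<ominus> \<one> \<in> psums R d 2" 
      using two[of "\<ominus> \<one>"] one_not_zero by (metis a_inv_closed minus_minus minus_zero one_closed)
    moreover have "2 \<le> n - 1" using n(2)[OF True] by simp
    ultimately show ?thesis using psums_mono[OF d_pos] by blast
  next
    case False
    then have "(\<ominus> \<one>) [^] d = \<ominus> \<one>"
    proof (induction d rule: less_induct)
      case (less d)
      show ?case
      proof (cases "d = 1")
        case False
        then obtain j where j: "d = Suc (Suc j)" "odd j" using less.prems
          by (metis even_Suc even_zero One_nat_def not0_implies_Suc)
        then show ?thesis using less.IH[of j] by (simp add: l_minus r_minus)
      qed simp
    qed
    then have "\<ominus> \<one> \<in> psums R d 1" using psumsI[of "\<ominus> \<one>" \<zero> d 0] by simp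
    moreover have "1 \<le> n - 1" using n(1) by simp
    ultimately show ?thesis using psums_mono[OF d_pos] by blast
  qed
  then show ?thesis
    using two psums_mono[OF d_pos n(1)] by (intro carrier_unit_psumsI d_pos) auto
qed

text \<open>The large fields come from the estimate and the small ones from the scan. The escapes
  \<open>exc\<close> and \<open>bad\<close> stay in the conclusion because they depend only on d,
  whereas the excluded divisors depend on the triple.\<close>

lemma (in field) unit_psums_certified:
  fixes n0 :: int
  assumes fin: "finite (carrier R)" and card: "card (carrier R) mod d = 1"
    and d: "2 \<le> d" and E: "proper_exponents d E" and n0: "2 \<le> n0" "even d \<Longrightarrow> 3 \<le> n0"
    and certs: "certificates_ok (int d) E n0 h0 exc bad cs"
  shows "int (card (carrier R)) \<in> set bad \<or>
    (\<exists>n. carrier R \<subseteq> unit_psums R d (nat n) \<and> (n = n0 \<or> (int (card (carrier R)), n) \<in> set exc))"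
proof -
  let ?q = "int (card (carrier R))"
  define h where "h = card (carrier R) div d"
  have ch: "card (carrier R) = d * h + 1" using card mult_div_mod_eq[of d "card (carrier R)"] by (simp add: h_def)
  interpret finite_field_powers R d h
    by unfold_locales (use fin ch d in auto)
  show ?thesis
  proof (cases "int h \<le> h0")
    case False
    have "int (d\<^sup>2 * (d - 1)) \<le> int h" "int (3 * d\<^sup>2) \<le> int h"
      using certs False d by (auto simp: certificates_ok_def power2_eq_square of_nat_diff)
    then have "d\<^sup>2 * (d - 1) \<le> h" "3 * d\<^sup>2 \<le> h" by (simp_all only: of_nat_le_iff)
    then have "carrier R \<subseteq> unit_psums R d (nat n0)"
      using n0 by (intro large_unit_psums[OF fin ch d]) auto
    then show ?thesis by blast
  next
    case True
    have "?q = int d * int h + 1" using ch by simp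
    have scan: "scan (int d) E n0 exc bad 1 h0 cs"
      using certs by (simp add: certificates_ok_def)
    have "1 \<le> int h" using h_pos by simp
    have "composite_ok prime_table ?q \<or> (\<exists>c. cert_key c = ?q \<and> cert_check (int d) E n0 exc bad c)"
      using scan_covers[OF scan \<open>1 \<le> int h\<close> True] by (simp only: \<open>?q = int d * int h + 1\<close>)
    moreover have "\<not> composite_ok prime_table ?q"
    proof
      assume "composite_ok prime_table ?q"
      moreover obtain p m where "Factorial_Ring.prime p" "card (carrier R) = p ^ m"
        using card_prime_power[OF fin] by blast
      moreover have "?q < 13312"
      proof -
        have "int d * int h \<le> int d * h0" using True by (intro mult_left_mono) auto
        then show ?thesis using certs ch by (simp add: certificates_ok_def)
      qed
      ultimately show False using composite_ok_not_prime_power[of prime_table ?q p m] by simp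
    qed
    ultimately obtain c where c: "cert_key c = ?q" "cert_check (int d) E n0 exc bad c" by blast
    show ?thesis
    proof (cases c)
      case (Zero q zrow)
      then have "prime_ok (int d) E (?q, n0, 0, [], [], zrow)" using c by simp
      then show ?thesis using prime_ok_unit_psums[OF fin refl _ E] d by force
    next
      case (Prime q n g invs rows zrow)
      then have "prime_ok (int d) E (?q, n, g, invs, rows, zrow)" "n = n0 \<or> (?q, n) \<in> set exc"
        using c by (auto split: if_splits)
      then show ?thesis using prime_ok_unit_psums[OF fin refl _ E] d by force
    next
      case (Ext q n p fr g invs rows zrow)
      then have "ext_ok (int d) E (?q, n, p, fr, g, invs, rows, zrow)" "n = n0 \<or> (?q, n) \<in> set exc"
        using c by (auto split: if_splits)
      then show ?thesis using ext_ok_unit_psums[OF fin refl _ E] d by force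
    next
      case (Excluded q)
      then show ?thesis using c by simp
    qed
  qed
qed

section \<open>Tables of certificates\<close>

definition certificates_2 :: "cert list" where
  "certificates_2 = [
 Prime 3 3 2 [1] [[1,1]] [1,1], Prime 5 3 2 [2] [[1,1]] [2], Prime 7 3 3 [3] [[1,3]] [2,3], Ext 9 3
 3 [2,0] [1,1] [[1,0]] [[[1,0],[1,2]]] [[0,1]], Zero 11 [1,3], Zero 13 [5], Zero 17 [4], Zero 19
 [1,6], Zero 23 [2,8]]"

text \<open>The bound 11 is one less than the maximum of d^2 (d - 1) and 3 d^2. The same rule gives
  the bounds for the other exponents; from d = 4 on the first expression decides.\<close>

lemma certificates_2_ok:
  "certificates_ok 2 [num.One] 3 11
     []
     [] certificates_2"
  by code_simp

text \<open>For odd d the row for -1 consists of -1 alone; over a prime field its code is left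
  unreduced.\<close>

definition certificates_3 :: "cert list" where
  "certificates_3 = [
 Excluded 4, Prime 7 3 2 [5] [[1,1],[3,3,3]] [-1], Prime 13 2 2 [7] [[1,1],[4,7]] [-1], Excluded 16,
 Prime 19 2 2 [16] [[1,1],[5,10]] [-1], Ext 25 2 5 [2,0] [1,1] [[2,4]] [[[1,0],[0,2]],[[0,1],[2,0]]]
 [[4,0]], Prime 31 2 3 [22] [[1,4],[1,2]] [-1], Prime 37 2 2 [3] [[1,1],[3,5]] [-1], Prime 43 2 3
 [16] [[1,20],[1,2]] [-1], Ext 49 2 7 [3,0] [0,1] [[1,0]] [[[0,3],[0,3]],[[2,1],[1,3]]] [[6,0]],
 Prime 61 2 2 [4] [[1,1],[1,4]] [-1], Ext 64 2 2 [1,0,0,0,0,1] [0,0,0,0,0,1] [[0,0,0,1,1,1]]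
 [[[0,0,0,1,0,0],[1,1,0,0,0,0]],[[0,0,0,0,1,0],[1,0,0,0,0,0]]] [[1,0,0,0,0,0]], Prime 67 2 2 [54]
 [[1,1],[1,18]] [-1], Prime 73 2 2 [51] [[1,1],[1,25]] [-1], Prime 79 2 2 [18] [[1,1],[9,18]] [-1]]"

lemma certificates_3_ok:
  "certificates_ok 3 [num.One] 2 26
     [(7, 3)]
     [4,16] certificates_3"
  by code_simp

definition certificates_4 :: "cert list" where
  "certificates_4 = [
 Prime 5 5 2 [2] [[1,1],[1,1,1,1],[1,1,1]] [1,1,1,1], Excluded 9, Prime 13 3 2 [6]
 [[1,1],[1,2],[2,4,4]] [2,4], Prime 17 3 3 [8] [[2,6],[3,3],[1,3,3]] [2], Ext 25 3 5 [2,0] [0,1]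
 [[2,0]] [[[2,1],[1,4]],[[1,0],[1,0]],[[0,1],[0,1],[1,1]]] [[0,1]], Prime 29 4 2 [14]
 [[1,1],[1,2,2],[1,8]] [1,6,8], Prime 37 3 2 [18] [[1,1],[3,4],[1,3]] [8,10], Prime 41 3 3 [20]
 [[3,11],[3,4],[7,11]] [3], Ext 49 3 7 [3,0] [1,1] [[3,0]]
 [[[1,0],[1,5]],[[0,2],[1,1]],[[1,2],[1,3]]] [[2,1]], Prime 53 3 2 [26] [[1,1],[5,8],[8,17]] [3,6],
 Prime 61 3 2 [30] [[1,1],[8,15],[4,10]] [13,14], Prime 73 3 5 [36] [[4,5],[2,17],[2,15]] [10],
 Excluded 81, Zero 89 [12], Zero 97 [33], Zero 101 [2,6], Zero 109 [3,16], Zero 113 [18], Ext 121 3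
 11 [2,0] [0,0] [] [] [[4,5]], Ext 125 3 5 [1,0,1] [0,0,0] [] [] [[0,1,0],[1,0,2]], Zero 137 [10],
 Zero 149 [3,39], Zero 157 [3,41], Ext 169 3 13 [2,0] [0,0] [] [] [[0,2]], Zero 173 [12,32], Zero
 181 [7,26]]"

text \<open>In the field with 9 elements the nonzero fourth powers are 1 and -1, so all sums stay in
  the prime field. The order 81 can be skipped too, because 9 divides it.\<close>

lemma certificates_4_ok:
  "certificates_ok 4 [num.Bit0 num.One] 3 47
     [(5, 5), (29, 4)]
     [9,81] certificates_4"
  by code_simp

definition certificates_5 :: "cert list" where
  "certificates_5 = [
 Prime 11 5 2 [4] [[1,1],[1,1,1,1],[2,2,2],[1,1,1,1,1]] [-1], Excluded 16, Prime 31 3 2 [1]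
 [[1,1],[7,15],[1,1,11],[3,3,3]] [-1], Prime 41 3 2 [32] [[1,1],[1,11],[4,5],[1,1,15]] [-1], Prime
 61 3 2 [23] [[1,1],[1,2,2],[4,10],[4,6]] [-1], Prime 71 2 2 [67] [[1,1],[3,18],[13,18],[9,21]]
 [-1], Ext 81 2 3 [1,0,0,1] [0,0,0,1] [[2,1,0,1]]
 [[[0,0,2,0],[0,1,1,0]],[[1,0,0,0],[0,0,2,1]],[[0,0,1,1],[0,0,1,2]],[[0,0,1,0],[0,0,1,2]]]
 [[2,0,0,0]], Prime 101 2 2 [72] [[1,1],[4,39],[4,5],[6,13]] [-1], Ext 121 2 11 [2,0] [0,1] [[4,0]]
 [[[1,0],[4,2]],[[1,0],[1,0]],[[1,2],[2,7]],[[1,2],[1,5]]] [[10,0]], Prime 131 2 2 [63]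
 [[1,1],[23,27],[2,4],[12,27]] [-1], Prime 151 2 3 [138] [[1,22],[1,9],[7,27],[11,15]] [-1], Prime
 181 2 2 [103] [[1,1],[9,11],[1,8],[5,63]] [-1], Prime 191 2 2 [4] [[1,1],[7,18],[11,31],[3,38]]
 [-1], Prime 211 2 2 [2] [[1,1],[11,32],[11,34],[1,61]] [-1], Prime 241 2 3 [227]
 [[1,3],[1,27],[13,21],[5,68]] [-1], Prime 251 2 3 [38] [[1,43],[1,55],[2,6],[1,21]] [-1], Excluded
 256, Prime 271 2 2 [29] [[1,1],[2,3],[15,51],[14,42]] [-1], Prime 281 2 2 [118]
 [[1,1],[2,20],[6,196],[4,29]] [-1], Prime 311 2 2 [61] [[1,1],[4,15],[1,45],[1,5]] [-1], Prime 331
 2 2 [310] [[1,1],[10,30],[4,103],[16,23]] [-1], Ext 361 2 19 [2,0] [1,1] [[9,4]]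
 [[[0,1],[2,2]],[[3,0],[5,6]],[[0,3],[5,6]],[[2,0],[2,1]]] [[18,0]], Prime 401 2 2 [305]
 [[1,1],[3,44],[18,66],[47,74]] [-1], Prime 421 2 2 [368] [[1,1],[3,4],[4,49],[8,58]] [-1], Prime
 431 2 5 [415] [[1,19],[1,72],[6,28],[2,4]] [-1], Prime 461 2 2 [53] [[1,1],[8,45],[9,45],[4,40]]
 [-1], Prime 491 2 2 [115] [[1,1],[1,11],[7,12],[6,22]] [-1]]"

lemma certificates_5_ok:
  "certificates_ok 5 [num.One] 2 99
     [(11, 5), (31, 3), (41, 3), (61, 3)]
     [16,256] certificates_5"
  by code_simp

definition certificates_6 :: "cert list" where
  "certificates_6 = [
 Prime 7 7 3 [1,3] [[1,1,1],[1,1],[1,1,1,1,1,1],[1,1,1,1],[1,1,1,1,1]] [1,1,1,1,1,1], Prime 13 6 2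
 [7,6] [[1,1],[1,1,1,1],[2,2,2,2,2],[1,1,1],[1,1,1,1,1,1]] [2], Prime 19 4 2 [16,9]
 [[1,1],[1,4,4],[1,2],[1,1,2,2],[1,1,4]] [2,4], Excluded 25, Prime 31 5 3 [22,15]
 [[1,2],[1,8],[1,2,3,8],[1,2,3],[2,3,8]] [2,3,4,8], Prime 37 3 2 [3,18]
 [[1,1],[3,3,3],[6,6,9],[2,3],[5,5,9]] [6], Prime 43 3 3 [16,21]
 [[4,10],[3,4],[4,5],[1,2,5],[1,4,5]] [1,3], Ext 49 3 7 [3,0] [1,1] [[5,0],[3,0]]
 [[[0,1],[1,2]],[[1,2],[1,2]],[[1,0],[3,1]],[[1,1],[1,2]],[[0,1],[1,1],[1,2]]] [[0,1]], Prime 61 3 2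
 [4,30] [[1,1],[1,2],[4,11],[3,11,16],[6,7]] [11], Prime 67 4 2 [54,33]
 [[1,1],[4,12],[1,3,17],[3,6],[3,8]] [1,1,2], Prime 73 3 5 [21,36]
 [[4,11],[1,14],[5,13],[12,13],[1,6,13]] [3], Prime 79 4 3 [18,39] [[2,3],[1,9],[1,3,9],[1,1],[3,4]]
 [1,4,15], Prime 97 3 5 [20,48] [[9,10],[9,18],[3,9],[26,26],[4,6]] [6], Prime 103 3 5 [15,51]
 [[3,6],[2,2],[2,15],[10,17],[1,17]] [4,7], Prime 109 3 6 [51,54]
 [[1,1,6],[4,18],[8,8],[4,10],[5,8]] [8], Ext 121 3 11 [2,0] [1,1] [[5,4],[5,0]]
 [[[1,0],[1,4]],[[3,0],[2,3]],[[0,5],[1,5]],[[0,2],[1,4]],[[0,1],[3,7]]] [[0,4]], Prime 127 3 3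
 [6,63] [[1,10],[1,16],[4,15],[9,16],[8,18]] [3,4], Prime 139 4 2 [60,69]
 [[1,1],[2,31],[1,6,7],[2,6],[4,22]] [1,5,17], Prime 151 3 6 [39,75]
 [[6,20],[2,39],[1,2],[6,15],[6,10]] [2,30], Prime 157 3 5 [100,78]
 [[1,21],[2,15],[4,8],[1,9],[1,32]] [22], Prime 163 3 2 [19,81] [[1,1],[4,24],[4,12],[2,16],[8,18]]
 [3,21], Ext 169 3 13 [2,0] [0,1] [[7,0],[6,0]]
 [[[1,0],[2,1]],[[1,0],[1,0]],[[2,1],[1,6]],[[0,2],[2,0]],[[2,3],[3,2]]] [[2,0]], Prime 181 3 2
 [104,90] [[1,1],[3,7],[2,27],[2,17],[3,12]] [7], Prime 193 3 5 [100,96]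
 [[11,28],[1,17],[1,22],[4,56],[2,24]] [49], Prime 199 3 3 [163,99]
 [[11,18],[1,20],[5,16],[11,42],[3,9]] [19,21], Prime 211 3 2 [145,105]
 [[1,1],[2,39],[3,12],[5,11],[7,25]] [3,49], Prime 223 4 3 [87,111]
 [[1,25],[1,15],[2,5,36],[6,9],[7,20]] [2,3,21], Prime 229 3 6 [31,114]
 [[11,16],[5,31],[7,57],[8,31],[1,16]] [18], Prime 241 3 7 [155,120]
 [[1,3],[1,26],[6,28],[4,38],[1,8]] [4], Prime 271 3 6 [9,135] [[3,31],[1,7],[4,42],[2,16],[1,3]]
 [13,23], Prime 277 3 5 [53,138] [[2,4],[4,13],[7,7],[9,51],[15,46]] [35], Prime 283 3 3 [203,141]
 [[4,18],[4,15],[5,9],[4,60],[11,79]] [1,27], Ext 289 3 17 [3,0] [1,2] [[8,5],[8,0]]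
 [[[0,1],[5,5]],[[0,3],[1,3]],[[5,0],[2,2]],[[0,7],[5,5]],[[1,0],[2,7]]] [[4,0]], Prime 307 3 5
 [210,153] [[1,15],[1,9],[9,10],[6,39],[1,14]] [1,61], Zero 313 [25], Zero 331 [7,9], Zero 337 [72],
 Ext 343 3 7 [2,0,0] [0,0,0] [] [] [[0,0,1],[0,1,0]], Zero 349 [24], Ext 361 3 19 [2,0] [0,0] [] []
 [[0,2]], Zero 367 [10,54], Zero 373 [69], Zero 379 [6,107], Zero 397 [63], Zero 409 [49], Zero 421
 [29], Zero 433 [64], Zero 439 [7,109], Zero 457 [18], Zero 463 [4,58], Zero 487 [9,60], Zero 499
 [6,6], Zero 523 [2,5], Ext 529 3 23 [5,0] [0,0] [] [] [[0,3]], Zero 541 [52], Zero 547 [2,37], Zero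
 571 [16,81], Zero 577 [24], Zero 601 [5], Zero 607 [6,160], Zero 613 [35], Zero 619 [9,35],
 Excluded 625, Zero 631 [4,51], Zero 643 [1,35], Zero 661 [106], Zero 673 [16], Zero 691 [1,42],
 Zero 709 [91], Zero 727 [2,34], Zero 733 [113], Zero 739 [1,21], Zero 751 [56,67], Zero 757 [78],
 Zero 769 [19], Zero 787 [5,67], Zero 811 [2,20], Zero 823 [4,115], Zero 829 [77], Ext 841 3 29
 [2,0] [0,0] [] [] [[12,0]], Zero 853 [98], Zero 859 [22,57], Zero 877 [151], Zero 883 [16,51], Zero
 907 [75,79], Zero 919 [5,200], Zero 937 [196], Ext 961 3 31 [3,0] [0,0] [] [] [[0,8]], Zero 967
 [5,228], Zero 991 [3,32], Zero 997 [91], Zero 1009 [160], Zero 1021 [171], Zero 1033 [14], Zero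
 1039 [5,329], Zero 1051 [1,147], Zero 1063 [7,49], Zero 1069 [34]]"

text \<open>In the field with 7 elements the sixth powers are 0 and 1, so seven summands are needed
  for a nontrivial zero; with 13 elements they are 0, 1 and -1, and the element 6 takes six.\<close>

lemma certificates_6_ok:
  "certificates_ok 6 [num.Bit0 num.One, num.Bit1 num.One] 3 179
     [(7, 7), (13, 6), (19, 4), (31, 5), (67, 4), (79, 4), (139, 4), (223, 4)]
     [25,625] certificates_6"
  by code_simp

definition certificates_7 :: "cert list" where
  "certificates_7 = [
 Excluded 8, Prime 29 4 2 [2] [[1,1],[4,8,8],[1,2,2,2],[4,8],[1,1,1],[1,8,8]] [-1], Prime 43 4 2
 [28] [[1,1],[2,2,6],[1,7],[1,1,7,7],[1,3,3],[7,7,7]] [-1], Excluded 64, Prime 71 3 2 [49]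
 [[1,1],[10,23],[4,5],[14,23],[2,28],[1,14,28]] [-1], Prime 113 3 2 [45]
 [[1,1],[12,18],[12,39],[1,2],[1,12,20],[4,10]] [-1], Prime 127 3 2 [17]
 [[1,1],[3,13],[3,47],[7,21],[15,47],[3,11,63]] [-1], Ext 169 2 13 [2,0] [1,1] [[6,11]]
 [[[1,0],[0,8]],[[3,0],[0,10]],[[6,0],[0,12]],[[4,0],[0,5]],[[0,11],[11,0]],[[5,0],[0,12]]]
 [[12,0]], Prime 197 2 2 [44] [[1,1],[8,34],[2,13],[15,27],[4,6],[7,23]] [-1], Prime 211 2 2 [36]
 [[1,1],[8,39],[8,54],[3,6],[5,71],[16,41]] [-1], Prime 239 2 2 [49]
 [[1,1],[4,39],[3,5],[6,7],[14,63],[3,19]] [-1], Prime 281 2 2 [17]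
 [[1,1],[10,85],[1,5],[11,45],[3,12],[37,63]] [-1], Prime 337 2 2 [107]
 [[1,1],[4,19],[10,11],[18,19],[2,14],[18,28]] [-1], Prime 379 2 2 [162]
 [[1,1],[15,38],[4,17],[7,145],[6,87],[3,92]] [-1], Prime 421 2 2 [170]
 [[1,1],[12,54],[9,20],[5,30],[4,7],[10,12]] [-1], Prime 449 2 2 [74]
 [[1,1],[8,65],[20,45],[16,33],[4,12],[3,11]] [-1], Prime 463 2 2 [186]
 [[1,1],[3,61],[15,100],[1,57],[10,24],[17,88]] [-1], Prime 491 2 2 [448]
 [[1,1],[26,69],[7,11],[10,15],[15,22],[3,27]] [-1], Excluded 512, Prime 547 2 2 [253]
 [[1,1],[4,105],[8,56],[22,48],[2,5],[12,94]] [-1], Prime 617 2 2 [483]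
 [[1,1],[7,299],[10,64],[1,30],[1,94],[14,19]] [-1], Prime 631 2 3 [445]
 [[1,196],[2,5],[6,35],[2,88],[1,36],[12,29]] [-1], Prime 659 2 2 [28]
 [[1,1],[8,88],[5,80],[1,52],[9,65],[1,47]] [-1], Prime 673 2 3 [245]
 [[1,128],[1,18],[6,60],[11,45],[26,66],[5,23]] [-1], Prime 701 2 2 [39]
 [[1,1],[5,98],[12,62],[4,25],[2,13],[1,165]] [-1], Ext 729 2 3 [1,0,0,0,0,1] [0,0,0,0,0,1]
 [[1,2,0,0,1,0]]
 [[[1,0,0,0,0,0],[1,0,2,0,0,0]],[[0,0,1,0,0,0],[1,0,0,1,1,1]],[[1,0,0,0,0,0],[0,0,0,0,0,2]],[[0,0,2,0,0,0],[0,1,0,0,1,0]],[[0,0,2,0,0,0],[2,0,0,1,0,2]],[[0,0,0,0,2,0],[0,0,0,1,1,2]]]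
 [[2,0,0,0,0,0]], Prime 743 2 2 [456] [[1,1],[7,78],[3,57],[5,63],[17,35],[6,92]] [-1], Prime 757 2
 2 [272] [[1,1],[1,81],[7,70],[9,48],[8,140],[5,215]] [-1], Prime 827 2 2 [372]
 [[1,1],[10,28],[2,8],[26,55],[3,39],[8,22]] [-1], Ext 841 2 29 [2,0] [0,1] [[2,0]]
 [[[1,0],[6,4]],[[1,0],[1,0]],[[1,9],[6,4]],[[0,2],[2,7]],[[1,3],[9,2]],[[1,4],[5,6]]] [[28,0]],
 Prime 883 2 2 [439] [[1,1],[1,207],[83,159],[2,13],[8,234],[38,76]] [-1], Prime 911 2 2 [527]
 [[1,1],[4,24],[9,201],[4,8],[1,39],[3,41]] [-1], Prime 953 2 3 [216]
 [[4,38],[1,211],[4,40],[25,54],[21,29],[14,88]] [-1], Prime 967 2 2 [488]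
 [[1,1],[2,252],[5,89],[1,59],[2,98],[8,205]] [-1], Prime 1009 2 2 [456]
 [[1,1],[4,440],[12,72],[6,133],[18,103],[23,98]] [-1], Prime 1051 2 2 [984]
 [[1,1],[8,200],[2,86],[3,113],[10,48],[4,37]] [-1], Prime 1093 2 2 [410]
 [[1,1],[2,188],[5,362],[7,86],[10,547],[47,56]] [-1], Prime 1163 2 3 [594]
 [[1,41],[1,66],[8,96],[11,75],[37,38],[9,141]] [-1], Prime 1289 2 2 [874]
 [[1,1],[1,74],[28,154],[9,34],[6,22],[3,236]] [-1], Prime 1303 2 2 [403]
 [[1,1],[8,36],[4,366],[9,344],[2,220],[6,60]] [-1], Ext 1331 2 11 [2,0,1] [0,0,1] [[2,9,1]]
 [[[1,0,0],[4,3,8]],[[0,0,2],[7,0,6]],[[0,1,3],[1,0,6]],[[0,0,4],[0,4,5]],[[0,0,1],[8,7,0]],[[0,1,0],[1,0,2]]]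
 [[10,0,0]], Prime 1373 2 2 [244] [[1,1],[3,170],[8,91],[8,65],[16,67],[9,12]] [-1], Prime 1429 2 2
 [21] [[1,1],[9,11],[8,449],[7,50],[1,54],[18,95]] [-1], Prime 1471 2 2 [772]
 [[1,1],[4,66],[12,89],[5,351],[8,216],[7,17]] [-1], Prime 1499 2 2 [1262]
 [[1,1],[5,376],[1,277],[1,625],[5,450],[28,54]] [-1], Prime 1583 2 2 [776]
 [[1,1],[4,63],[5,63],[20,70],[7,693],[3,22]] [-1], Prime 1597 2 2 [1140]
 [[1,1],[1,48],[2,90],[6,54],[9,28],[9,42]] [-1], Prime 1667 2 2 [347]
 [[1,1],[4,78],[2,6],[42,48],[26,92],[32,87]] [-1], Ext 1681 2 41 [3,0] [1,1] [[20,7]]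
 [[[1,0],[0,27]],[[7,0],[1,3]],[[8,2],[19,4]],[[0,24],[7,5]],[[0,9],[11,0]],[[7,0],[3,4]]] [[40,0]],
 Prime 1709 2 3 [1151] [[1,166],[1,88],[9,113],[8,268],[36,94],[7,319]] [-1], Prime 1723 2 2 [747]
 [[1,1],[5,37],[10,12],[1,19],[4,26],[3,80]] [-1], Ext 1849 2 43 [2,0] [0,1] [[28,0]]
 [[[2,3],[1,5]],[[1,0],[1,0]],[[2,0],[1,6]],[[2,3],[10,8]],[[1,6],[2,31]],[[1,0],[7,0]]] [[42,0]],
 Prime 1877 2 2 [1207] [[1,1],[1,23],[7,31],[5,109],[6,443],[5,136]] [-1], Prime 1933 2 2 [312]
 [[1,1],[22,79],[15,52],[2,788],[2,153],[1,564]] [-1], Prime 2003 2 3 [1733]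
 [[1,299],[1,5],[8,194],[21,60],[1,549],[1,231]] [-1], Prime 2017 2 2 [1217]
 [[1,1],[6,67],[42,71],[8,679],[7,83],[9,302]] [-1]]"

lemma certificates_7_ok:
  "certificates_ok 7 [num.One] 2 293
     [(29, 4), (43, 4), (71, 3), (113, 3), (127, 3)]
     [8,64,512] certificates_7"
  by code_simp

definition certificates_8 :: "cert list" where
  "certificates_8 = [
 Excluded 9, Prime 17 8 3 [8]
 [[1,1,1],[3,3,3,3,3,3,3,3],[3,3,3,3,3,3,3],[3,3,3,3],[1,1,1,1,1],[3,3],[3,3,3,3,3,3]] [3], Ext 25 4
 5 [2,0] [0,1] [[2,0]]
 [[[0,1],[1,1],[1,1]],[[0,1],[0,1]],[[0,1],[0,1],[0,1],[1,2]],[[1,1],[1,2]],[[0,1],[1,2],[1,2]],[[0,1],[0,1],[0,1]],[[0,1],[0,1],[0,1],[1,1]]]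
 [[1,1],[1,2]], Prime 41 5 3 [20] [[1,1,1],[4,8,8],[1,2,8],[1,1,1,7],[1,7],[8,8],[4,7]] [1,1,1,7],
 Excluded 49, Prime 73 3 5 [36] [[1,18],[1,9,12],[6,12,18],[2,18],[4,18],[1,5],[1,4,6]] [3,9],
 Excluded 81, Prime 89 4 3 [44] [[1,9],[1,6],[4,10,20],[1,2,9],[1,3],[1,25],[5,6,20]] [2,6,9], Prime
 97 3 5 [48] [[5,8],[4,4],[5,28],[1,5,11],[8,28],[1,1,5],[2,19]] [8], Prime 113 3 3 [56]
 [[3,4],[7,14],[11,35],[5,5],[1,14],[1,1,9],[3,5,9]] [35], Ext 121 3 11 [2,0] [1,1] [[5,0]]
 [[[2,1],[3,5]],[[0,1],[1,2],[3,2]],[[0,2],[2,1]],[[1,0],[1,1]],[[1,1],[2,5]],[[1,0],[1,0],[4,1]],[[2,1],[3,2]]]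
 [[0,1],[0,1]], Prime 137 4 3 [68] [[1,1,1],[12,24],[2,3,18],[9,21,24],[4,21],[3,8],[8,32]]
 [1,2,31], Ext 169 3 13 [2,0] [0,1] [[6,0]]
 [[[2,0],[4,1]],[[1,0],[1,0]],[[0,1],[2,3]],[[0,1],[1,0]],[[0,1],[1,3]],[[4,1],[6,1]],[[1,0],[2,8]]]
 [[0,1],[2,0]], Prime 193 3 5 [96] [[5,51],[4,4],[4,34],[4,6],[17,25],[3,5],[13,56]] [3], Prime 233
 4 3 [116] [[1,49],[1,16],[2,28],[1,23,85],[5,22],[10,15],[7,25]] [2,5,27], Prime 241 3 7 [120]
 [[17,36],[43,51],[2,6],[1,77],[6,25],[46,46],[12,13]] [44], Prime 257 3 3 [128]
 [[1,42],[1,18],[1,7,9],[11,43],[1,5],[9,14],[26,42]] [2], Prime 281 3 3 [140]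
 [[5,10],[6,55],[5,12],[17,24],[49,62],[15,77],[8,77]] [1,11], Ext 289 3 17 [3,0] [0,1] [[8,0]]
 [[[1,7],[7,2]],[[0,3],[3,0]],[[0,1],[1,0],[2,5]],[[0,1],[0,1]],[[2,1],[5,1]],[[1,1],[1,16]],[[2,1],[7,2]]]
 [[3,0]], Prime 313 3 5 [156] [[9,84],[6,7],[3,12],[8,22],[8,11],[9,9],[9,33]] [8,22], Prime 337 3 5
 [168] [[1,14],[9,30],[18,38],[2,37],[6,46],[5,45],[1,2,53]] [30], Prime 353 3 3 [176]
 [[8,24],[4,21],[12,26],[11,72],[8,16],[1,32],[2,38]] [36], Ext 361 3 19 [2,0] [1,1] [[9,0]]
 [[[0,8],[2,5]],[[2,0],[4,3]],[[1,0],[2,2]],[[1,0],[5,7]],[[2,1],[2,3]],[[4,0],[6,4]],[[2,8],[6,4]]]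
 [[1,0],[0,8]], Prime 401 3 3 [200] [[11,48],[7,14],[4,16],[1,13],[4,46],[2,29],[15,64]] [30], Prime
 409 3 7 [204] [[1,70],[12,38],[6,45],[1,7],[11,34],[1,96],[15,51]] [7,38], Prime 433 3 5 [216]
 [[16,57],[6,69],[3,5],[10,81],[4,26],[7,8],[28,84]] [151], Prime 449 3 3 [224]
 [[8,57],[25,65],[14,46],[1,124],[10,28],[3,51],[9,19]] [35], Prime 457 3 5 [228]
 [[39,65],[1,39],[40,45],[4,74],[1,45],[9,39],[10,29]] [2,40], Prime 521 3 3 [260]
 [[8,55],[9,17],[8,79],[9,45],[9,92],[10,88],[5,117]] [5,22], Ext 529 3 23 [5,0] [1,1] [[11,0]]
 [[[0,2],[3,5]],[[1,4],[6,4]],[[3,1],[5,1]],[[6,1],[4,7]],[[4,0],[5,1]],[[1,2],[9,1]],[[0,5],[4,8]]]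
 [[2,1]], Prime 569 3 3 [284] [[17,42],[8,56],[8,12],[1,11],[4,65],[9,22],[11,19]] [8,122], Prime
 577 3 5 [288] [[5,60],[1,35],[1,30],[4,18],[2,44],[9,153],[3,23]] [27], Prime 593 3 3 [296]
 [[73,126],[27,79],[38,57],[4,87],[9,55],[12,87],[2,25]] [82], Prime 601 3 7 [300]
 [[1,34],[1,15],[7,68],[3,73],[2,17],[1,12],[13,23]] [5,25], Prime 617 3 3 [308]
 [[7,30],[22,59],[9,72],[11,13],[1,158],[64,96],[15,18]] [4,9], Ext 625 3 5 [2,0,0,0] [0,0,0,1]
 [[2,0,0,0]]
 [[[0,0,1,1],[0,0,2,1]],[[0,1,1,0],[1,0,0,2]],[[0,1,0,2],[1,0,2,3]],[[0,0,0,1],[0,0,0,1]],[[0,0,1,1],[0,0,1,2]],[[1,0,1,0],[0,1,0,2]],[[0,1,0,1],[1,2,1,0]]]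
 [[0,0,0,1]], Prime 641 3 3 [320] [[4,48],[9,63],[6,69],[31,172],[2,81],[1,38],[4,18]] [16], Prime
 673 3 5 [336] [[13,67],[22,34],[10,36],[6,18],[4,143],[8,38],[1,65]] [8], Excluded 729, Prime 761 4
 0 [] [] [1,11,21], Zero 769 [27], Zero 809 [6,7], Ext 841 3 29 [2,0] [0,0] [] [] [[2,1],[7,1]],
 Zero 857 [13,90], Zero 881 [68], Zero 929 [40], Zero 937 [8,46], Zero 953 [5,7], Ext 961 3 31 [3,0]
 [0,0] [] [] [[7,4]], Zero 977 [52], Zero 1009 [62], Zero 1033 [5,63], Zero 1049 [1,13], Zero 1097
 [8,82], Zero 1129 [8,39], Zero 1153 [67], Zero 1193 [3,3], Zero 1201 [104], Zero 1217 [287], Zero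
 1249 [98], Zero 1289 [7,73], Zero 1297 [157], Zero 1321 [11,46], Zero 1361 [63], Ext 1369 3 37
 [2,0] [0,0] [] [] [[0,2],[8,0]], Zero 1409 [100], Zero 1433 [3,49], Zero 1481 [1,44], Zero 1489
 [143], Zero 1553 [99], Zero 1601 [257], Zero 1609 [2,89], Zero 1657 [4,43], Ext 1681 3 41 [3,0]
 [0,0] [] [] [[0,1]], Zero 1697 [36], Zero 1721 [10,263], Zero 1753 [1,62], Zero 1777 [189], Zero
 1801 [8,145], Ext 1849 3 43 [2,0] [0,0] [] [] [[1,0],[2,0]], Zero 1873 [151], Zero 1889 [458], Zero
 1913 [8,77], Zero 1993 [10,58], Zero 2017 [108], Zero 2081 [155], Zero 2089 [16,185], Zero 2113
 [348], Zero 2129 [105], Zero 2137 [42,81], Zero 2153 [5,7], Zero 2161 [227], Ext 2209 3 47 [5,0]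
 [0,0] [] [] [[9,4]], Zero 2273 [598], Zero 2281 [1,115], Zero 2297 [8,84], Zero 2377 [2,695], Zero
 2393 [1,422], Excluded 2401, Zero 2417 [67], Zero 2441 [10,63], Zero 2473 [1,132], Zero 2521
 [2,43], Zero 2593 [25], Zero 2609 [460], Zero 2617 [3,380], Zero 2633 [3,840], Zero 2657 [169],
 Zero 2689 [250], Zero 2713 [21,86], Zero 2729 [2,273], Zero 2753 [342], Zero 2777 [8,22], Zero 2801
 [24], Ext 2809 3 53 [2,0] [0,0] [] [] [[0,1],[0,3]], Zero 2833 [423], Zero 2857 [1,140], Zero 2897
 [286], Zero 2953 [43,70], Zero 2969 [5,478], Zero 3001 [4,613], Zero 3041 [221], Zero 3049 [1,163],
 Zero 3089 [627], Zero 3121 [113], Zero 3137 [107], Zero 3169 [206], Zero 3209 [16,81], Zero 3217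
 [279], Zero 3257 [15,332], Zero 3313 [506], Zero 3329 [630], Zero 3361 [57], Zero 3433 [4,856],
 Zero 3449 [5,116], Zero 3457 [39], Ext 3481 3 59 [2,0] [0,0] [] [] [[3,0],[4,0]], Zero 3529 [1,254]]"

text \<open>For the order 761 the estimate gives three summands for nonzero elements; the fourth
  comes from the row for -1, which has three entries.\<close>

lemma certificates_8_ok:
  "certificates_ok 8 [num.Bit0 (num.Bit0 num.One)] 3 447
     [(17, 8), (25, 4), (41, 5), (89, 4), (137, 4), (233, 4), (761, 4)]
     [9,49,81,729,2401] certificates_8"
  by code_simp

definition certificates_9 :: "cert list" where
  "certificates_9 = [
 Prime 19 9 2 [16]
 [[1,1],[1,1,1,1],[1,1,1,1,1,1,1,1],[2,2,2],[2,2,2,2,2,2],[1,1,1,1,1,1,1],[2,2,2,2,2],[1,1,1,1,1,1,1,1,1]]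
 [-1], Prime 37 5 2 [3] [[1,1],[3,3,5],[1,1,5],[3,3,5,5,5],[1,2],[1,1,2,2],[3,5,5,5],[3,3,3]] [-1],
 Excluded 64, Prime 73 3 2 [51] [[1,1],[9,13,25],[5,9,9],[9,17,25],[5,11],[1,17],[1,25,25],[5,25]]
 [-1], Prime 109 3 3 [51] [[1,1,1],[1,13],[11,11],[2,11,12],[6,8],[2,4],[4,13],[2,12,13]] [-1],
 Prime 127 3 3 [6] [[1,16],[1,13],[10,23,33],[1,4,8],[1,2,39],[10,20],[11,23],[2,4,8]] [-1], Prime
 163 3 2 [19] [[1,1],[2,4,36],[9,24],[1,10,18],[15,67],[3,36],[2,8],[3,9]] [-1], Prime 181 3 2 [104]
 [[1,1],[2,24],[1,27,54],[24,26],[1,21],[27,63],[2,6],[1,8]] [-1], Prime 199 3 2 [163]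
 [[1,1],[9,22],[1,7,25],[6,22],[3,4,7],[1,35],[5,7],[1,3,11]] [-1], Prime 271 3 2 [9]
 [[1,1],[1,38],[13,14],[6,11],[33,38],[1,9,22],[5,8],[1,3,86]] [-1], Ext 289 2 17 [3,0] [1,1]
 [[8,5]]
 [[[1,0],[0,4]],[[4,0],[0,8]],[[7,0],[0,10]],[[6,0],[0,13]],[[8,0],[0,11]],[[0,4],[4,0]],[[10,0],[0,14]],[[0,3],[12,0]]]
 [[16,0]], Prime 307 3 5 [210] [[9,52],[1,26],[8,72],[3,32],[5,39],[7,32],[2,4,32],[14,78]] [-1],
 Ext 343 3 7 [2,0,0] [0,0,1] [[1,0,0]]
 [[[1,3,2],[3,2,3]],[[0,0,1],[3,2,3]],[[0,0,3],[0,0,3],[0,0,3]],[[1,3,3],[1,4,3]],[[0,0,1],[5,3,1]],[[0,0,1],[0,0,1]],[[3,1,1],[5,3,1]],[[0,0,1],[1,3,3]]]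
 [[6,0,0]], Ext 361 2 19 [2,0] [0,1] [[16,0]]
 [[[1,0],[2,1]],[[1,0],[1,0]],[[2,1],[1,9]],[[1,3],[4,3]],[[3,2],[5,3]],[[2,3],[3,5]],[[1,3],[1,7]],[[1,2],[9,1]]]
 [[18,0]], Prime 379 2 2 [143] [[1,1],[40,49],[2,147],[12,24],[3,42],[22,34],[2,31],[1,4]] [-1],
 Prime 397 2 3 [385] [[1,21],[4,5],[26,92],[3,6],[2,13],[11,35],[44,62],[7,23]] [-1], Prime 433 2 3
 [222] [[3,69],[1,72],[5,14],[7,30],[3,28],[1,5],[1,31],[9,86]] [-1], Prime 487 2 2 [409]
 [[1,1],[7,33],[7,14],[3,7],[10,76],[5,45],[19,65],[1,5]] [-1], Prime 523 2 2 [194]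
 [[1,1],[1,65],[6,55],[2,50],[2,24],[8,98],[5,54],[48,49]] [-1], Prime 541 2 2 [317]
 [[1,1],[6,18],[8,52],[3,14],[4,11],[9,242],[7,69],[4,8]] [-1], Prime 577 2 2 [263]
 [[1,1],[5,24],[12,75],[6,58],[3,34],[3,31],[1,66],[24,104]] [-1], Prime 613 2 2 [182]
 [[1,1],[7,52],[3,91],[52,182],[3,122],[36,42],[6,8],[48,68]] [-1], Prime 631 2 2 [616]
 [[1,1],[10,62],[14,33],[3,17],[22,52],[10,35],[5,66],[11,24]] [-1], Prime 739 2 3 [139]
 [[6,114],[1,29],[10,90],[5,55],[15,53],[4,120],[24,57],[26,34]] [-1], Prime 757 2 2 [495]
 [[1,1],[14,56],[8,35],[7,221],[40,44],[5,28],[1,64],[1,65]] [-1], Prime 811 2 3 [43]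
 [[46,233],[1,23],[5,31],[7,59],[8,35],[33,41],[5,22],[10,81]] [-1], Prime 829 2 2 [234]
 [[1,1],[11,48],[6,47],[1,58],[1,87],[19,28],[3,88],[48,87]] [-1], Prime 883 2 2 [112]
 [[1,1],[11,104],[1,119],[6,242],[25,31],[29,53],[5,225],[3,242]] [-1], Prime 919 2 5 [901]
 [[7,34],[3,14],[3,31],[12,42],[9,131],[1,1],[35,79],[8,114]] [-1], Prime 937 2 2 [107]
 [[1,1],[19,82],[2,257],[9,33],[3,54],[4,219],[19,44],[19,53]] [-1], Prime 991 2 2 [292]
 [[1,1],[6,204],[4,110],[22,82],[15,29],[20,47],[3,100],[10,40]] [-1], Prime 1009 2 2 [211]
 [[1,1],[8,38],[8,41],[4,166],[31,202],[17,91],[53,148],[5,32]] [-1], Prime 1063 2 2 [948]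
 [[1,1],[33,67],[76,80],[13,61],[3,127],[80,82],[65,78],[5,26]] [-1], Prime 1117 2 2 [412]
 [[1,1],[2,5],[15,20],[9,54],[13,15],[6,362],[5,61],[7,115]] [-1], Prime 1153 2 2 [167]
 [[1,1],[6,45],[32,79],[9,133],[3,49],[2,38],[20,61],[1,415]] [-1], Prime 1171 2 2 [640]
 [[1,1],[5,152],[4,94],[20,39],[30,36],[4,92],[5,90],[10,88]] [-1], Prime 1279 2 2 [594]
 [[1,1],[10,22],[7,55],[7,88],[70,71],[11,128],[1,107],[21,218]] [-1], Prime 1297 2 2 [310]
 [[1,1],[13,74],[7,106],[3,94],[19,74],[37,82],[37,83],[19,571]] [-1], Ext 1369 2 37 [2,0] [0,1]
 [[3,0]]
 [[[0,1],[0,5]],[[1,0],[1,0]],[[2,2],[5,6]],[[5,4],[8,1]],[[1,0],[5,8]],[[8,1],[1,9]],[[3,4],[7,3]],[[2,4],[7,4]]]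
 [[36,0]], Prime 1423 2 3 [214] [[9,156],[6,17],[17,86],[1,357],[8,100],[12,76],[20,43],[4,46]]
 [-1], Prime 1459 2 3 [859] [[13,18],[1,162],[64,66],[1,61],[6,132],[8,38],[14,688],[7,93]] [-1],
 Prime 1531 2 2 [215] [[1,1],[1,284],[1,17],[1,37],[9,32],[9,22],[46,72],[16,65]] [-1], Prime 1549 2
 2 [1124] [[1,1],[19,397],[7,126],[25,49],[7,35],[8,88],[3,30],[3,133]] [-1], Prime 1567 2 2 [1388]
 [[1,1],[7,117],[7,14],[9,36],[19,39],[20,236],[55,177],[9,10]] [-1], Prime 1621 2 2 [61]
 [[1,1],[1,19],[11,41],[6,209],[7,43],[8,66],[1,51],[1,47]] [-1], Prime 1657 2 3 [23]
 [[1,54],[1,49],[1,448],[56,234],[76,80],[1,8],[25,707],[5,632]] [-1], Prime 1693 2 2 [144]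
 [[1,1],[6,22],[2,82],[27,38],[6,256],[56,154],[33,45],[27,77]] [-1], Prime 1747 2 2 [458]
 [[1,1],[10,73],[9,265],[9,21],[54,80],[8,121],[3,24],[18,47]] [-1], Prime 1783 2 2 [1718]
 [[1,1],[3,62],[15,32],[8,19],[20,36],[8,12],[4,124],[7,160]] [-1], Prime 1801 2 3 [24]
 [[8,12],[1,81],[3,29],[87,91],[16,96],[7,118],[7,344],[8,106]] [-1], Prime 1873 2 2 [1210]
 [[1,1],[8,391],[5,435],[10,60],[10,573],[23,31],[7,51],[24,58]] [-1], Prime 1999 2 3 [1729]
 [[16,19],[1,119],[5,133],[43,54],[33,82],[3,298],[5,186],[2,107]] [-1], Prime 2017 2 3 [1246]
 [[9,107],[8,92],[9,62],[5,278],[16,54],[1,135],[11,197],[7,58]] [-1], Prime 2053 2 2 [1434]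
 [[1,1],[7,588],[48,75],[4,80],[8,49],[45,88],[4,82],[3,274]] [-1], Prime 2089 2 3 [1813]
 [[1,15],[1,188],[7,97],[6,109],[20,199],[27,97],[7,110],[8,9]] [-1], Prime 2143 2 3 [116]
 [[40,58],[1,64],[2,619],[3,518],[19,63],[8,408],[7,158],[6,21]] [-1], Prime 2161 2 2 [1638]
 [[1,1],[8,284],[5,110],[11,46],[8,83],[13,69],[37,76],[30,93]] [-1], Prime 2179 2 5 [767]
 [[14,57],[1,470],[8,34],[6,92],[1,93],[9,60],[11,18],[2,3]] [-1], Ext 2197 2 13 [2,0,0] [0,0,1]
 [[5,0,0]]
 [[[1,0,2],[2,2,5]],[[2,0,0],[2,5,1]],[[0,0,1],[2,0,0]],[[0,4,3],[6,1,3]],[[0,1,0],[3,1,3]],[[0,1,0],[0,1,0]],[[1,0,6],[2,5,2]],[[2,0,0],[2,2,9]]]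
 [[12,0,0]], Prime 2251 2 5 [986] [[3,104],[1,453],[8,30],[5,202],[3,374],[5,542],[9,303],[59,71]]
 [-1], Prime 2269 2 2 [27] [[1,1],[1,331],[6,550],[8,16],[32,42],[7,11],[1,92],[43,68]] [-1], Prime
 2287 2 7 [1030] [[1,35],[1,167],[8,95],[7,14],[2,644],[6,90],[2,560],[4,574]] [-1], Prime 2341 2 5
 [411] [[6,581],[2,179],[16,50],[17,177],[2,335],[32,58],[7,147],[4,156]] [-1], Prime 2377 2 2 [240]
 [[1,1],[32,78],[13,56],[23,74],[8,106],[13,63],[31,284],[9,460]] [-1], Prime 2467 2 2 [894]
 [[1,1],[4,107],[27,311],[55,85],[45,52],[3,37],[67,83],[1,63]] [-1], Prime 2503 2 2 [2077]
 [[1,1],[7,888],[3,260],[15,67],[8,690],[8,27],[4,440],[30,44]] [-1], Prime 2521 2 2 [1065]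
 [[1,1],[9,12],[9,137],[40,51],[3,338],[1,158],[8,608],[81,83]] [-1], Prime 2539 2 2 [1590]
 [[1,1],[4,609],[8,43],[8,101],[3,334],[8,238],[2,10],[8,912]] [-1], Prime 2557 2 2 [2278]
 [[1,1],[2,86],[5,17],[2,254],[8,85],[10,219],[6,45],[56,59]] [-1], Prime 2593 2 2 [1349]
 [[1,1],[5,231],[2,418],[11,916],[10,17],[9,18],[7,158],[4,637]] [-1], Prime 2647 2 2 [1826]
 [[1,1],[3,41],[17,928],[3,81],[7,360],[36,81],[2,271],[1,219]] [-1], Prime 2683 2 2 [1106]
 [[1,1],[16,134],[61,94],[1,279],[1,369],[41,60],[1,28],[1,620]] [-1], Prime 2719 2 2 [484]
 [[1,1],[2,349],[6,530],[4,196],[14,51],[14,79],[9,78],[1,239]] [-1], Prime 2791 2 3 [2760]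
 [[7,158],[1,227],[4,590],[1,659],[5,71],[4,222],[1,6],[9,221]] [-1], Ext 2809 2 53 [2,0] [1,1]
 [[26,45]]
 [[[5,0],[9,7]],[[0,3],[26,0]],[[4,0],[5,31]],[[26,0],[2,7]],[[4,1],[7,8]],[[0,6],[28,0]],[[0,3],[4,3]],[[9,0],[13,6]]]
 [[52,0]], Prime 2917 2 3 [2834] [[3,227],[1,731],[62,70],[9,24],[3,17],[12,76],[5,547],[27,30]]
 [-1], Prime 2953 2 3 [717] [[7,629],[2,53],[4,79],[6,466],[5,177],[9,254],[33,81],[8,94]] [-1],
 Prime 2971 2 5 [1008] [[1,183],[2,89],[26,39],[42,77],[35,49],[2,99],[44,50],[9,145]] [-1], Prime
 3061 2 3 [1853] [[25,139],[1,139],[2,525],[4,327],[67,81],[6,56],[23,81],[7,25]] [-1], Prime 3079 2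
 2 [1870] [[1,1],[1,329],[3,247],[36,55],[26,212],[3,44],[6,358],[5,93]] [-1], Prime 3169 2 2 [3136]
 [[1,1],[10,130],[7,37],[29,51],[3,632],[11,74],[2,569],[8,536]] [-1], Prime 3187 2 2 [438]
 [[1,1],[1,29],[8,148],[27,44],[10,79],[2,73],[25,89],[3,40]] [-1], Prime 3259 2 3 [1888]
 [[8,599],[1,137],[9,86],[5,396],[5,159],[7,664],[9,95],[17,129]] [-1], Prime 3313 2 2 [2938]
 [[1,1],[67,87],[2,390],[70,82],[2,30],[11,196],[11,359],[7,31]] [-1], Prime 3331 2 3 [2708]
 [[15,30],[1,278],[6,494],[32,411],[1,98],[1,19],[8,288],[7,89]] [-1], Prime 3457 2 3 [911]
 [[57,97],[8,23],[6,25],[1,158],[1,385],[6,629],[9,78],[4,319]] [-1], Prime 3511 2 2 [1422]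
 [[1,1],[6,268],[14,164],[10,257],[18,68],[37,69],[7,299],[3,60]] [-1], Prime 3529 2 2 [3379]
 [[1,1],[2,7],[1,24],[21,59],[7,231],[6,28],[7,109],[5,277]] [-1], Prime 3547 2 2 [387]
 [[1,1],[4,885],[1,178],[1,24],[12,107],[8,194],[2,21],[5,324]] [-1], Prime 3583 2 2 [2042]
 [[1,1],[7,254],[9,49],[9,144],[8,75],[6,55],[6,409],[8,169]] [-1], Prime 3637 2 2 [2656]
 [[1,1],[8,453],[51,56],[3,274],[3,23],[4,137],[3,46],[7,374]] [-1], Prime 3673 2 2 [2832]
 [[1,1],[7,111],[13,96],[7,88],[45,65],[34,96],[5,39],[4,587]] [-1], Prime 3691 2 2 [1388]
 [[1,1],[21,91],[42,57],[1,168],[15,292],[6,149],[7,21],[51,97]] [-1], Prime 3709 2 2 [2306]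
 [[1,1],[24,59],[1,570],[2,513],[63,98],[12,64],[1,61],[27,77]] [-1], Prime 3727 2 2 [2088]
 [[1,1],[6,859],[2,277],[14,43],[8,1013],[20,64],[3,219],[11,41]] [-1], Prime 3853 2 2 [2948]
 [[1,1],[2,649],[5,920],[8,70],[3,153],[3,136],[50,53],[46,85]] [-1], Prime 3889 2 5 [1926]
 [[7,576],[5,149],[77,98],[16,69],[3,382],[3,414],[4,412],[4,93]] [-1], Prime 3907 2 2 [2625]
 [[1,1],[22,212],[7,32],[3,21],[4,336],[2,469],[1,324],[6,151]] [-1], Prime 3943 2 3 [3564]
 [[1,166],[3,80],[4,131],[20,845],[9,28],[5,990],[25,974],[7,97]] [-1], Prime 4051 2 3 [1084]
 [[3,107],[1,1041],[7,31],[6,740],[18,314],[3,730],[2,676],[8,96]] [-1], Excluded 4096, Prime 4159 2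
 2 [851] [[1,1],[8,517],[38,46],[1,141],[25,26],[58,85],[1,4],[8,450]] [-1], Prime 4177 2 5 [367]
 [[3,501],[1,315],[24,52],[8,207],[18,46],[43,83],[14,503],[4,1205]] [-1], Prime 4231 2 2 [3027]
 [[1,1],[5,87],[6,32],[60,206],[24,29],[5,310],[4,368],[3,438]] [-1], Prime 4339 2 5 [2813]
 [[10,315],[1,297],[68,71],[7,83],[9,75],[9,122],[8,11],[22,256]] [-1], Prime 4357 2 2 [3917]
 [[1,1],[3,87],[3,292],[51,81],[2,249],[4,133],[24,62],[4,285]] [-1], Prime 4447 2 2 [4408]
 [[1,1],[10,222],[3,101],[3,163],[2,226],[9,772],[8,27],[42,864]] [-1], Prime 4483 2 2 [4314]
 [[1,1],[8,228],[8,140],[5,83],[8,1034],[6,654],[58,74],[6,254]] [-1], Prime 4519 2 3 [2660]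
 [[38,51],[4,527],[3,184],[9,720],[10,323],[10,369],[88,93],[1,84]] [-1], Prime 4591 2 2 [103]
 [[1,1],[18,478],[5,48],[2,696],[2,350],[2,470],[4,577],[5,424]] [-1], Prime 4663 2 3 [3965]
 [[2,91],[1,270],[4,215],[17,48],[68,89],[5,210],[8,261],[4,502]] [-1], Prime 4789 2 2 [3752]
 [[1,1],[3,52],[12,74],[13,378],[8,421],[9,202],[4,482],[5,578]] [-1], Prime 4861 2 2 [4754]
 [[1,1],[4,787],[9,51],[5,631],[4,981],[1,367],[6,277],[5,67]] [-1], Prime 4933 2 2 [4222]
 [[1,1],[1,485],[1,263],[9,296],[3,497],[1,833],[4,494],[17,34]] [-1], Prime 4951 2 2 [896]
 [[1,1],[31,73],[8,761],[19,74],[7,105],[16,342],[52,54],[9,993]] [-1], Prime 4969 2 2 [1718]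
 [[1,1],[10,99],[19,533],[2,54],[9,755],[1,255],[3,258],[6,117]] [-1], Prime 4987 2 2 [3703]
 [[1,1],[2,453],[18,81],[28,29],[13,93],[1,942],[54,87],[7,65]] [-1], Prime 5023 2 2 [3666]
 [[1,1],[3,67],[4,359],[4,411],[2,197],[2,89],[2,72],[10,829]] [-1], Ext 5041 2 71 [7,0] [1,1]
 [[35,29]]
 [[[1,0],[0,15]],[[0,8],[15,1]],[[1,4],[2,3]],[[4,0],[7,32]],[[1,4],[9,9]],[[4,0],[19,3]],[[2,0],[2,4]],[[4,0],[0,68]]]
 [[70,0]], Prime 5059 2 2 [637] [[1,1],[5,186],[5,835],[2,60],[6,33],[2,350],[63,78],[27,58]] [-1],
 Prime 5077 2 2 [2235] [[1,1],[3,435],[3,1561],[47,79],[29,46],[3,282],[10,62],[21,422]] [-1], Prime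
 5113 2 11 [1680] [[4,246],[8,70],[4,174],[13,38],[53,64],[3,184],[50,62],[6,483]] [-1], Prime 5167
 2 3 [41] [[21,388],[32,87],[11,201],[2,51],[8,74],[10,431],[53,86],[5,514]] [-1], Ext 5329 2 73
 [5,0] [0,1] [[21,0]]
 [[[5,0],[5,27]],[[5,3],[4,5]],[[1,3],[1,27]],[[0,5],[9,65]],[[3,1],[12,7]],[[3,9],[6,7]],[[2,3],[1,24]],[[1,3],[9,9]]]
 [[72,0]], Prime 5347 2 3 [3724] [[1,62],[1,383],[6,282],[4,51],[4,918],[9,53],[12,23],[5,502]]
 [-1], Prime 5419 2 3 [42] [[7,78],[1,32],[30,69],[10,81],[29,349],[9,1035],[9,260],[53,85]] [-1],
 Prime 5437 2 3 [2569] [[10,327],[2,109],[17,57],[3,251],[13,985],[21,87],[6,602],[7,266]] [-1],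
 Prime 5527 2 2 [3392] [[1,1],[8,242],[3,48],[44,906],[1,112],[27,292],[42,99],[81,95]] [-1], Prime
 5563 2 2 [3471] [[1,1],[2,1869],[3,567],[9,449],[4,149],[2,286],[14,544],[7,391]] [-1], Prime 5581
 2 3 [4761] [[9,21],[7,72],[36,54],[3,373],[23,76],[57,99],[6,275],[7,558]] [-1], Prime 5653 2 3
 [4015] [[69,80],[1,158],[5,5],[3,453],[9,213],[13,401],[16,583],[2,150]] [-1], Prime 5689 2 2
 [4882] [[1,1],[27,909],[11,45],[70,84],[2,229],[2,203],[7,64],[17,18]] [-1], Prime 5743 2 2 [1847]
 [[1,1],[4,830],[6,1203],[4,48],[5,382],[3,474],[24,887],[6,131]] [-1], Prime 5779 2 2 [4828]
 [[1,1],[3,1966],[17,62],[2,93],[7,117],[6,130],[10,394],[1,228]] [-1]]"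

lemma certificates_9_ok:
  "certificates_ok 9 [num.Bit1 num.One] 2 647
     [(19, 9), (37, 5), (73, 3), (109, 3), (127, 3), (163, 3), (181, 3), (199, 3), (271, 3), (307, 3),
      (343, 3)]
     [64,4096] certificates_9"
  by code_simp

definition certificates_10 :: "cert list" where
  "certificates_10 = [
 Prime 11 11 2 [4,5]
 [[1,1],[1,1,1,1],[1,1,1,1,1,1,1,1],[1,1,1,1,1],[1,1,1,1,1,1,1,1,1,1],[1,1,1,1,1,1,1,1,1],[1,1,1,1,1,1,1],[1,1,1],[1,1,1,1,1,1]]
 [1,1,1,1,1,1,1,1,1,1], Prime 31 5 3 [29,15]
 [[1,1,1],[3,5,5,5],[1,1,3],[3,3],[1,3],[1,5,5,5],[1,1,5,5,5],[1,3,3],[3,3,5,5]] [3,5], Prime 41 4 6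
 [32,20] [[2,2,2,3],[3,3,3,3],[1,1,3],[1,1,6,6],[3,3,3],[2,2],[2,2,2,6],[1,3],[1,3,3]] [2], Prime 61
 4 2 [23,30] [[1,1],[1,1,1,1],[2,2,2,4],[1,1,10],[4,4,8],[1,1,1],[2,4,4,4],[5,8],[5,5,8,8]] [8],
 Prime 71 4 7 [67,35] [[2,3],[1,3],[3,7,18],[1,6,18],[1,2,6],[1,1],[3,18],[2,3,6],[1,1,7]] [1,9,18],
 Excluded 81, Prime 101 3 2 [72,50]
 [[1,1],[1,8,13],[2,4],[8,10],[1,2,8],[3,10],[2,2,10],[1,5,8],[1,26]] [10], Ext 121 3 11 [2,0] [2,1]
 [[4,0],[5,0]]
 [[[1,1],[1,2]],[[1,5],[1,5]],[[1,3],[1,5]],[[1,0],[1,0],[2,3]],[[0,1],[5,1],[1,10]],[[1,1],[3,2],[1,10]],[[1,0],[1,10]],[[2,1],[3,1]],[[1,0],[1,0],[1,5]]]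
 [[0,1]], Prime 131 4 2 [63,65]
 [[1,1],[2,2,4],[1,3,12],[11,33],[1,3,33],[1,33],[2,2,14],[7,14],[7,12]] [1,11,14], Prime 151 3 3
 [138,75] [[1,5],[1,3],[3,29],[1,9,15],[15,30],[1,12,29],[1,3,9],[9,22],[11,30]] [2,4], Prime 181 3
 2 [103,90] [[1,1],[3,10],[11,18],[5,15],[7,14],[15,19],[14,25],[1,1,11],[6,50]] [19], Prime 191 3 7
 [186,95] [[1,36],[3,3,8],[1,1,38],[38,38],[3,6],[3,32],[8,12],[1,2,6],[3,19]] [3,6], Prime 211 3 2
 [2,105] [[1,1],[7,22],[13,22],[7,32],[13,16],[1,26,32],[17,22],[1,1,20],[5,17]] [10,14], Prime 241
 3 7 [158,120] [[6,23],[4,5],[3,4,7],[6,26],[1,30],[1,13,23],[9,43],[7,38],[3,7,38]] [6], Prime 251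
 3 6 [38,125] [[1,19],[2,68],[15,19],[6,68],[17,19],[2,45],[2,34],[1,4,6],[1,2,6]] [1,11], Prime 271
 3 3 [219,135] [[3,66],[5,5],[5,63],[6,11],[1,3],[1,9,63],[8,66],[7,66],[21,22]] [3,9], Prime 281 3
 3 [162,140] [[3,30],[2,32],[7,27],[2,2],[1,21],[38,54],[2,3],[3,43],[2,6,8]] [7], Prime 311 4 17
 [80,155] [[1,1,80],[20,37],[20,21],[9,19],[1,1,14],[2,63],[11,37],[20,41],[4,22]] [1,7,14], Prime
 331 3 2 [310,165] [[1,1],[1,12,34],[2,13],[7,100],[1,2],[12,14],[2,3,19],[6,100],[1,7]] [2,4], Ext
 361 3 19 [2,0] [1,1] [[9,4],[9,0]]
 [[[1,0],[2,1]],[[0,9],[7,7]],[[7,0],[10,5]],[[2,0],[4,4]],[[0,9],[2,4]],[[4,0],[2,2]],[[8,0],[1,5]],[[7,0],[1,10]],[[6,0],[6,3]]]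
 [[0,3]], Prime 401 3 3 [305,200] [[12,25],[2,6],[5,26],[8,16],[10,60],[8,8],[15,36],[1,5,5],[2,65]]
 [20], Prime 421 3 2 [368,210] [[1,1],[2,17],[2,7],[3,14],[8,23],[79,84],[11,32],[2,13,36],[8,17]]
 [13], Prime 431 4 7 [188,215]
 [[1,38],[1,46],[12,38],[11,15],[2,20,28],[1,4,57],[6,40],[5,39],[22,25]] [2,53,69], Prime 461 3 2
 [53,230] [[1,1],[9,36],[3,11],[8,33],[6,48],[3,91],[23,82],[1,2,49],[27,28]] [48], Prime 491 4 2
 [115,245] [[1,1],[1,7],[23,96],[3,22],[1,6,50],[12,20],[6,60],[4,96],[5,114]] [1,8,15], Prime 521 3
 3 [152,260] [[18,22],[12,74],[22,132],[2,32],[18,68],[2,57],[18,36],[12,48],[14,57]] [47], Prime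
 541 3 2 [518,270] [[1,1],[3,72],[2,84],[1,15],[1,14],[22,33],[33,59],[14,20],[4,55]] [44], Prime
 571 3 3 [320,285] [[6,39],[9,138],[3,67],[14,40],[7,7],[4,14],[36,39],[23,98],[15,94]] [1,35],
 Prime 601 3 7 [47,300] [[6,7],[17,52],[5,33],[3,68],[26,141],[6,45],[12,20],[4,26],[17,66]] [13],
 Prime 631 3 3 [487,315] [[6,62],[31,62],[19,135],[28,46],[42,45],[21,67],[6,184],[38,71],[10,41]]
 [8,44], Prime 641 3 3 [632,320]
 [[1,96],[1,75],[3,30],[1,60],[40,84],[60,75],[22,92],[7,24],[1,21,40]] [13], Prime 661 3 2
 [352,330] [[1,1],[1,86],[5,85],[3,81],[71,76],[50,172],[36,79],[79,103],[9,61]] [71], Prime 691 3 2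
 [211,345] [[1,1],[6,9],[30,75],[5,18],[5,165],[3,20],[57,64],[3,13],[29,81]] [4,40], Prime 701 3 2
 [161,350] [[1,1],[29,82],[14,76],[17,19],[8,72],[1,84],[32,84],[6,72],[12,31]] [93], Prime 751 3 3
 [732,375] [[2,27],[7,166],[3,127],[1,41],[5,24],[12,82],[25,64],[22,81],[3,83]] [5,79], Prime 761 3
 6 [565,380] [[6,71],[15,85],[4,13],[7,14],[66,76],[31,93],[13,21],[16,61],[3,156]] [39], Prime 811
 3 2 [12,405] [[1,1],[38,109],[1,29],[6,56],[5,51],[8,59],[24,97],[1,17],[87,89]] [14,58], Prime 821
 3 2 [814,410] [[1,1],[23,37],[26,74],[50,69],[31,85],[1,20],[57,58],[1,52],[6,25]] [99], Ext 841 3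
 29 [2,0] [2,1] [[14,7],[14,0]]
 [[[3,0],[5,8]],[[4,0],[8,10]],[[8,0],[7,3]],[[2,0],[9,1]],[[1,0],[7,8]],[[0,4],[3,4]],[[1,0],[1,3]],[[0,6],[7,9]],[[6,0],[4,8]]]
 [[12,0]], Prime 881 3 3 [847,440]
 [[39,47],[4,85],[11,41],[18,50],[5,6],[22,44],[15,91],[4,28],[11,31]] [159], Prime 911 4 17
 [658,455] [[1,52],[10,32],[7,74],[5,61],[1,18,44],[5,181],[22,158],[23,218],[1,30]] [5,23,105],
 Prime 941 3 2 [854,470] [[1,1],[60,118],[7,211],[6,67],[7,24],[11,65],[22,42],[4,95],[19,60]] [23],
 Ext 961 3 31 [3,0] [1,1] [[1,0],[15,0]]
 [[[0,3],[15,2]],[[3,2],[10,1]],[[4,1],[6,5]],[[5,4],[3,9]],[[5,1],[9,6]],[[1,2],[6,3]],[[0,5],[5,2]],[[1,0],[10,3]],[[0,1],[9,7]]]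
 [[0,3]], Prime 971 3 6 [654,485]
 [[4,9],[3,20],[8,40],[14,112],[4,78],[26,41],[8,140],[3,17],[4,107]] [1,51], Prime 991 3 3
 [450,495] [[2,80],[2,79],[3,200],[4,65],[82,115],[27,50],[4,92],[16,70],[4,73]] [71,86], Prime 1021
 3 2 [415,510] [[1,1],[1,2],[4,226],[7,100],[21,82],[7,188],[5,67],[4,35],[3,13]] [226], Prime 1031
 3 14 [933,515] [[9,204],[6,104],[14,38],[9,127],[6,162],[2,108],[7,49],[2,67],[26,54]] [19,67],
 Prime 1051 3 2 [79,525] [[1,1],[21,75],[11,269],[6,22],[10,85],[6,13],[6,18],[1,49],[1,26]]
 [12,75], Prime 1061 3 2 [779,530]
 [[1,1],[3,176],[5,17],[56,57],[1,258],[6,96],[4,32],[11,80],[5,31]] [14], Prime 1091 3 2 [1008,545]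
 [[1,1],[8,24],[2,7],[1,53],[20,144],[65,66],[2,40],[27,39],[7,38]] [14,67], Prime 1151 3 17
 [991,575] [[40,83],[7,22],[4,161],[3,21],[6,104],[6,109],[4,249],[7,125],[25,80]] [25,34], Prime
 1171 3 2 [594,585] [[1,1],[9,55],[2,187],[4,5],[5,48],[5,25],[11,45],[3,31],[6,69]] [6,36], Prime
 1181 3 3 [309,590] [[3,67],[11,28],[42,77],[2,152],[3,8],[2,42],[1,181],[14,69],[12,83]] [3], Prime
 1201 3 11 [1038,600] [[7,17],[14,41],[2,38],[1,13],[2,5],[56,70],[27,51],[3,116],[16,32]] [49],
 Prime 1231 3 3 [397,615] [[27,73],[5,30],[2,73],[5,96],[5,7],[1,41],[3,4],[1,228],[9,161]]
 [31,180], Prime 1291 3 2 [271,645]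
 [[1,1],[3,8],[5,107],[11,72],[11,28],[2,95],[5,28],[2,241],[36,106]] [8,298], Prime 1301 3 2
 [779,650] [[1,1],[3,107],[9,43],[9,31],[2,73],[15,61],[19,77],[35,234],[1,108]] [51], Prime 1321 3
 13 [1311,660] [[9,24],[35,38],[2,91],[8,21],[6,157],[13,33],[14,234],[6,17],[58,94]] [8], Ext 1331
 3 11 [2,0,1] [0,1,0] [[4,0,0],[5,0,0]]
 [[[1,1,0],[0,1,3]],[[1,3,1],[1,3,4]],[[3,0,1],[2,1,1]],[[0,2,1],[2,9,1]],[[0,2,1],[7,1,4]],[[1,0,0],[1,9,1]],[[3,1,1],[4,1,7]],[[0,2,3],[2,0,3]],[[1,0,3],[8,3,1]]]
 [[0,1,0],[3,2,0]], Prime 1361 3 3 [512,680]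
 [[12,99],[7,30],[4,10],[2,38],[7,197],[5,218],[7,16],[18,54],[9,24]] [209], Prime 1381 3 2
 [1091,690] [[1,1],[22,90],[15,77],[1,43],[6,125],[7,89],[48,56],[2,133],[21,51]] [170], Prime 1451
 3 2 [100,725] [[1,1],[2,262],[15,58],[33,43],[15,82],[10,70],[3,174],[10,38],[3,4]] [3,217], Prime
 1471 3 6 [132,735] [[4,48],[11,105],[44,67],[6,30],[5,44],[10,42],[1,216],[8,20],[7,243]] [21,48],
 Prime 1481 3 3 [1107,740] [[5,124],[7,46],[9,44],[1,138],[12,50],[6,168],[2,21],[36,36],[4,232]]
 [341], Zero 1511 [10,49], Zero 1531 [59,130], Zero 1571 [5,330], Zero 1601 [40], Zero 1621 [166],
 Ext 1681 3 41 [3,0] [0,0] [] [] [[2,0]], Zero 1721 [282], Zero 1741 [59], Zero 1801 [240], Zero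
 1811 [3,5], Zero 1831 [4,367], Zero 1861 [61], Zero 1871 [2,202], Zero 1901 [218], Zero 1931
 [18,110], Zero 1951 [4,105], Zero 2011 [1,89], Zero 2081 [102], Zero 2111 [92,94], Zero 2131
 [14,54], Zero 2141 [248], Zero 2161 [52], Zero 2221 [114], Zero 2251 [5,283], Zero 2281 [73], Zero
 2311 [49,60], Zero 2341 [87], Zero 2351 [2,108], Zero 2371 [20,443], Zero 2381 [69], Ext 2401 3 7
 [1,0,1,0] [0,0,0,0] [] [] [[2,0,3,0]], Zero 2411 [8,68], Zero 2441 [214], Zero 2521 [42], Zero 2531
 [27,44], Zero 2551 [18,41], Zero 2591 [9,354], Zero 2621 [115], Zero 2671 [29,38], Zero 2711
 [6,85], Zero 2731 [1,16], Zero 2741 [65], Zero 2791 [9,98], Zero 2801 [20], Zero 2851 [14,59], Zero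
 2861 [160], Zero 2971 [31,69], Zero 3001 [382], Zero 3011 [78,84], Zero 3041 [268], Zero 3061
 [501], Zero 3121 [79], Zero 3181 [164], Zero 3191 [8,186], Zero 3221 [234], Zero 3251 [1,189], Zero
 3271 [4,183], Zero 3301 [230], Zero 3331 [1,60], Zero 3361 [329], Zero 3371 [11,254], Zero 3391
 [8,61], Zero 3461 [406], Ext 3481 3 59 [2,0] [0,0] [] [] [[0,18]], Zero 3491 [25,84], Zero 3511
 [13,34], Zero 3541 [10], Zero 3571 [7,341], Zero 3581 [364], Zero 3631 [6,78], Zero 3671 [3,203],
 Zero 3691 [9,237], Zero 3701 [134], Ext 3721 3 61 [2,0] [0,0] [] [] [[8,0]], Zero 3761 [604], Zero
 3821 [89], Zero 3851 [9,205], Zero 3881 [197], Zero 3911 [5,88], Zero 3931 [6,50], Zero 4001 [152],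
 Zero 4021 [7], Zero 4051 [6,43], Zero 4091 [19,98], Zero 4111 [34,275], Zero 4201 [135], Zero 4211
 [1,217], Zero 4231 [33,176], Zero 4241 [247], Zero 4261 [501], Zero 4271 [2,480], Zero 4391
 [4,246], Zero 4421 [332], Zero 4441 [310], Zero 4451 [15,66], Zero 4481 [43], Zero 4561 [242], Zero
 4591 [33,38], Zero 4621 [152], Zero 4651 [13,169], Zero 4691 [2,59], Zero 4721 [33], Zero 4751
 [67,97], Zero 4801 [1038], Zero 4831 [30,70], Zero 4861 [493], Zero 4871 [10,56], Zero 4931 [1,61],
 Zero 4951 [42,56], Zero 5011 [8,566], Zero 5021 [1084], Ext 5041 3 71 [7,0] [0,0] [] [] [[0,9]],
 Zero 5051 [3,258], Zero 5081 [529], Zero 5101 [46], Zero 5171 [69,90], Zero 5231 [26,278], Zero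
 5261 [132], Zero 5281 [1144], Zero 5351 [58,692], Zero 5381 [824], Zero 5431 [3,307], Zero 5441
 [893], Zero 5471 [14,360], Zero 5501 [40], Zero 5521 [765], Zero 5531 [17,25], Zero 5581 [224],
 Zero 5591 [5,526], Zero 5641 [456], Zero 5651 [7,777], Zero 5701 [88], Zero 5711 [2,427], Zero 5741
 [393], Zero 5791 [4,529], Zero 5801 [1145], Zero 5821 [866], Zero 5851 [48,53], Zero 5861 [336],
 Zero 5881 [1098], Zero 5981 [1030], Zero 6011 [14,353], Zero 6091 [50,665], Zero 6101 [247], Zero
 6121 [127], Zero 6131 [62,95], Zero 6151 [5,84], Zero 6211 [15,860], Zero 6221 [388], Ext 6241 3 79
 [3,0] [0,0] [] [] [[0,37]], Zero 6271 [51,92], Zero 6301 [430], Zero 6311 [7,382], Zero 6361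
 [1061], Zero 6421 [825], Zero 6451 [9,96], Zero 6481 [387], Zero 6491 [6,902], Zero 6521 [1027],
 Zero 6551 [9,222], Excluded 6561, Zero 6571 [2,57], Zero 6581 [401], Zero 6661 [658], Zero 6691
 [35,923], Zero 6701 [410], Zero 6761 [1465], Zero 6781 [6], Zero 6791 [6,327], Zero 6841 [1625],
 Zero 6871 [3,97], Zero 6911 [8,173], Zero 6961 [344], Zero 6971 [3,694], Zero 6991 [5,712], Zero
 7001 [1198], Zero 7121 [580], Zero 7151 [3,157], Zero 7211 [6,650], Zero 7321 [121], Zero 7331
 [5,121], Zero 7351 [13,637], Zero 7411 [25,778], Zero 7451 [2,84], Zero 7481 [201], Zero 7541
 [755], Zero 7561 [1151], Zero 7591 [18,500], Zero 7621 [2038], Zero 7681 [221], Zero 7691 [39,499],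
 Zero 7741 [1959], Zero 7841 [198], Zero 7901 [697], Ext 7921 3 89 [3,0] [0,0] [] [] [[34,0]], Zero
 7951 [17,963], Zero 8011 [3,479], Zero 8081 [1099], Zero 8101 [32], Zero 8111 [4,414], Zero 8161
 [202], Zero 8171 [13,591], Zero 8191 [6,519], Zero 8221 [758], Zero 8231 [13,44], Zero 8291
 [6,447], Zero 8311 [2,847], Zero 8431 [2,264], Zero 8461 [1786], Zero 8501 [656], Zero 8521 [486],
 Zero 8581 [131], Zero 8641 [1212], Zero 8681 [1502], Zero 8731 [7,289], Zero 8741 [383], Zero 8761
 [440], Zero 8821 [297], Zero 8831 [4,395], Zero 8861 [654], Zero 8941 [1605], Zero 8951 [7,1276],
 Zero 8971 [3,666]]"

lemma certificates_10_ok: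
  "certificates_ok 10 [num.Bit0 num.One, num.Bit1 (num.Bit0 num.One)] 3 899
     [(11, 11), (31, 5), (41, 4), (61, 4), (71, 4), (131, 4), (311, 4), (431, 4), (491, 4), (911, 4)]
     [81,6561] certificates_10"
  by code_simp

definition certificates_11 :: "cert list" where
  "certificates_11 = [
 Excluded 23, Prime 67 5 2 [50]
 [[1,1],[1,1,1,1],[2,4],[2,2,4,4],[1,1,7],[3,3,3],[1,7,7],[2,2,2,2,4],[3,4,4,4],[3,6,6,6]] [-1],
 Prime 89 4 2 [37]
 [[1,1],[1,3,5],[5,5,11,13],[1,33,33],[9,11,11],[19,33],[1,1,3],[1,13],[5,19],[9,11,19]] [-1], Prime
 199 3 2 [136] [[1,1],[1,30,47],[2,20,25],[3,47],[3,9,41],[6,27],[15,27],[2,11],[12,15],[4,22,25]]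
 [-1], Ext 243 2 3 [1,1,0,0,0] [0,0,0,0,1] [[2,2,2,2,0]]
 [[[0,0,2,0,0],[0,1,0,0,1]],[[2,0,0,0,0],[0,1,0,2,0]],[[0,0,0,0,1],[0,0,0,1,2]],[[0,0,0,1,0],[0,0,2,0,0]],[[0,0,2,0,0],[0,1,1,0,0]],[[2,0,0,0,0],[0,0,1,2,0]],[[2,0,0,0,0],[0,0,2,2,0]],[[0,0,2,0,0],[0,0,1,0,2]],[[0,1,0,0,0],[0,0,2,2,0]],[[0,0,0,1,2],[0,0,2,2,0]]]
 [[2,0,0,0,0]], Prime 331 3 3 [16]
 [[1,62],[1,8],[88,101],[5,53],[2,73],[22,41],[4,5],[19,20],[14,56],[1,11,62]] [-1], Prime 353 3 2
 [192] [[1,1],[28,77],[3,7],[8,18],[35,59],[4,5],[1,7,30],[1,9,9],[13,15],[1,41]] [-1], Prime 397 2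
 2 [136] [[1,1],[46,71],[12,40],[8,9],[23,36],[1,2],[12,18],[9,15],[6,36],[33,46]] [-1], Prime 419 3
 2 [190] [[1,1],[9,89],[1,16],[12,17],[9,51],[18,51],[10,25],[11,24],[1,2,9],[9,81]] [-1], Prime 463
 3 2 [174] [[1,1],[13,29],[3,25],[13,37],[10,42],[7,26],[14,42],[1,23,148],[19,37],[13,46]] [-1],
 Excluded 529, Prime 617 3 2 [472]
 [[1,1],[6,10],[4,119],[3,57],[3,87],[4,8],[1,1,8],[17,18],[23,270],[26,54]] [-1], Prime 661 2 2
 [118] [[1,1],[2,34],[46,64],[11,25],[26,52],[2,3],[35,130],[1,64],[7,85],[3,20]] [-1], Prime 683 2
 2 [90] [[1,1],[7,50],[2,27],[95,98],[14,37],[5,110],[33,58],[14,18],[30,35],[41,59]] [-1], Prime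
 727 2 2 [511] [[1,1],[2,27],[23,75],[34,51],[20,27],[2,47],[41,66],[2,59],[2,23],[9,61]] [-1],
 Prime 859 2 2 [500] [[1,1],[6,18],[9,87],[19,31],[25,89],[31,94],[28,74],[30,62],[5,28],[4,76]]
 [-1], Prime 881 2 2 [363]
 [[1,1],[18,35],[1,101],[18,154],[6,15],[10,18],[8,36],[17,36],[4,12],[6,12]] [-1], Prime 947 2 2
 [385] [[1,1],[15,39],[1,96],[9,125],[8,124],[16,25],[1,83],[7,21],[204,310],[15,64]] [-1], Prime
 991 2 2 [809] [[1,1],[16,33],[17,47],[1,22],[8,13],[33,273],[22,61],[5,73],[5,55],[14,273]] [-1],
 Prime 1013 2 3 [360] [[7,20],[1,120],[43,93],[9,31],[1,47],[6,86],[14,31],[4,173],[14,33],[8,11]]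
 [-1], Ext 1024 2 2 [1,0,0,0,0,0,0,1,0,0] [0,0,0,0,0,0,0,0,0,1] [[1,1,1,0,1,1,1,0,1,0]]
 [[[0,1,0,0,0,0,0,0,0,0],[0,1,0,0,0,0,0,1,0,0]],[[0,0,0,0,0,0,0,1,0,0],[0,1,0,0,0,0,1,0,0,1]],[[0,0,0,0,0,0,0,1,0,0],[0,0,0,0,1,1,0,0,0,1]],[[0,0,0,0,1,0,0,0,0,0],[0,0,0,0,0,0,0,1,0,1]],[[0,0,0,0,0,0,0,1,0,0],[0,0,0,0,1,0,0,1,0,1]],[[0,0,0,0,0,1,0,0,0,0],[0,0,0,0,0,1,0,0,1,0]],[[0,0,0,0,0,0,0,0,1,0],[0,0,1,0,0,1,0,0,1,0]],[[0,0,0,0,0,0,0,0,1,0],[0,0,0,1,0,0,0,0,0,1]],[[0,0,0,1,0,0,0,0,1,0],[0,0,1,1,0,0,0,0,0,0]],[[0,1,0,0,0,0,0,0,0,0],[1,0,1,0,0,0,0,1,0,0]]]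
 [[1,0,0,0,0,0,0,0,0,0]], Prime 1123 2 2 [1005]
 [[1,1],[16,107],[13,48],[1,10],[6,32],[47,52],[13,16],[20,71],[4,64],[33,52]] [-1], Prime 1277 2 2
 [1115] [[1,1],[3,144],[5,203],[16,48],[5,80],[24,52],[1,156],[7,30],[8,98],[35,178]] [-1], Prime
 1321 2 3 [376] [[1,5],[1,125],[11,42],[29,103],[45,75],[2,5],[18,312],[202,428],[1,212],[19,59]]
 [-1], Prime 1409 2 2 [1275]
 [[1,1],[4,18],[8,238],[14,49],[18,94],[78,82],[71,78],[52,99],[11,39],[8,71]] [-1], Prime 1453 2 2
 [1263] [[1,1],[8,98],[32,57],[2,162],[15,73],[7,46],[9,93],[9,143],[8,182],[1,38]] [-1], Prime 1607
 2 2 [1499] [[1,1],[9,423],[3,135],[1,168],[2,140],[2,76],[15,67],[8,102],[14,182],[39,53]] [-1],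
 Prime 1783 2 2 [1252] [[1,1],[9,144],[7,68],[15,99],[8,503],[21,43],[9,72],[9,11],[6,377],[33,117]]
 [-1], Ext 1849 2 43 [2,0] [1,1] [[21,31]]
 [[[1,0],[0,27]],[[24,0],[2,1]],[[1,0],[8,1]],[[9,0],[10,1]],[[4,0],[0,40]],[[0,37],[3,1]],[[26,0],[6,8]],[[12,0],[7,5]],[[0,1],[1,3]],[[0,5],[38,0]]]
 [[42,0]], Prime 1871 2 2 [800]
 [[1,1],[1,32],[8,29],[6,95],[29,229],[27,80],[1,47],[1,30],[8,38],[7,42]] [-1], Prime 2003 2 2
 [1180] [[1,1],[5,121],[11,185],[8,50],[9,127],[6,19],[3,150],[15,350],[6,93],[9,394]] [-1], Prime
 2069 2 2 [458] [[1,1],[2,49],[4,188],[7,74],[2,79],[46,79],[8,230],[17,35],[5,31],[4,27]] [-1],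
 Prime 2113 2 2 [2047] [[1,1],[26,88],[5,70],[8,11],[2,189],[4,8],[31,43],[10,50],[8,17],[14,18]]
 [-1], Prime 2179 2 2 [246]
 [[1,1],[4,348],[3,21],[9,58],[6,34],[8,135],[1,439],[16,31],[2,83],[31,486]] [-1], Prime 2267 2 2
 [918] [[1,1],[3,131],[8,188],[5,315],[53,98],[20,73],[2,42],[4,65],[5,35],[5,83]] [-1], Prime 2311
 2 2 [776] [[1,1],[6,516],[32,344],[2,10],[36,83],[5,274],[8,204],[18,38],[89,98],[8,10]] [-1],
 Prime 2333 2 2 [399] [[1,1],[13,443],[5,12],[20,78],[3,126],[2,38],[8,204],[1,267],[6,22],[63,78]]
 [-1], Prime 2377 2 2 [1044]
 [[1,1],[24,54],[1,168],[6,173],[14,210],[42,80],[6,10],[35,239],[5,269],[8,349]] [-1], Prime 2399 2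
 2 [1583] [[1,1],[28,55],[5,30],[3,516],[4,473],[6,197],[16,38],[2,104],[9,64],[6,239]] [-1], Prime
 2531 2 2 [1083] [[1,1],[8,63],[33,443],[4,935],[26,105],[40,85],[34,42],[1,138],[18,201],[16,378]]
 [-1], Prime 2663 2 2 [838]
 [[1,1],[29,34],[6,130],[12,129],[49,159],[6,388],[7,197],[17,29],[10,14],[32,59]] [-1], Prime 2707
 2 2 [452] [[1,1],[20,403],[6,840],[24,56],[4,221],[4,189],[10,712],[4,230],[9,340],[12,74]] [-1],
 Prime 2729 2 2 [1716] [[1,1],[55,62],[20,30],[1,43],[2,139],[12,68],[1,81],[1,60],[4,99],[31,121]]
 [-1], Prime 2861 2 2 [1361]
 [[1,1],[6,26],[33,88],[16,51],[7,716],[32,80],[6,48],[4,183],[49,91],[11,445]] [-1], Prime 2927 2 2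
 [1001] [[1,1],[7,182],[3,60],[1,97],[12,36],[7,150],[7,168],[1,257],[1,328],[33,355]] [-1], Prime
 2971 2 2 [2880] [[1,1],[3,262],[51,86],[24,45],[28,388],[49,85],[4,346],[4,80],[17,176],[6,319]]
 [-1], Prime 3037 2 2 [693]
 [[1,1],[3,21],[2,71],[16,201],[8,70],[46,596],[21,45],[3,36],[22,189],[36,279]] [-1], Ext 3125 2 5
 [1,1,0,0,0] [0,0,0,0,1] [[1,4,2,1,4]]
 [[[0,0,0,0,3],[0,1,1,3,0]],[[0,0,3,0,0],[3,0,2,0,0]],[[0,3,0,0,1],[2,0,0,2,1]],[[0,0,0,0,3],[1,0,0,0,3]],[[0,0,0,1,1],[0,3,2,0,0]],[[0,0,0,3,0],[0,1,1,3,1]],[[3,0,0,0,0],[1,0,1,0,1]],[[0,1,0,1,0],[2,1,0,0,1]],[[2,0,0,0,0],[0,0,0,3,0]],[[0,0,1,0,0],[0,1,0,4,0]]]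
 [[4,0,0,0,0]], Prime 3169 2 2 [1394]
 [[1,1],[66,82],[17,187],[1,131],[11,129],[2,122],[12,83],[7,11],[42,84],[9,33]] [-1], Prime 3191 2
 2 [1508] [[1,1],[6,118],[2,162],[19,28],[8,367],[1,276],[8,107],[7,13],[11,84],[28,182]] [-1],
 Prime 3257 2 2 [454] [[1,1],[45,77],[36,55],[52,63],[24,70],[9,12],[5,58],[4,69],[26,77],[20,29]]
 [-1], Prime 3301 2 2 [564]
 [[1,1],[15,227],[14,65],[48,81],[8,265],[1,35],[6,355],[5,153],[2,146],[1,93]] [-1], Prime 3323 2 2
 [600] [[1,1],[7,253],[2,140],[2,48],[5,816],[2,57],[3,50],[29,95],[3,296],[22,301]] [-1], Prime
 3389 2 2 [1451] [[1,1],[5,139],[15,206],[9,31],[4,262],[1,172],[6,19],[13,64],[34,38],[19,51]]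
 [-1], Prime 3433 2 2 [1756]
 [[1,1],[7,148],[17,831],[3,802],[2,745],[32,58],[72,553],[7,146],[4,21],[11,32]] [-1], Prime 3499 2
 2 [2443] [[1,1],[2,255],[2,19],[2,452],[1,22],[24,94],[9,259],[6,331],[8,492],[14,332]] [-1], Prime
 3631 2 2 [3414] [[1,1],[18,193],[1,730],[21,156],[38,73],[12,634],[1,91],[9,117],[5,33],[64,89]]
 [-1], Prime 3697 2 2 [3232]
 [[1,1],[9,98],[7,122],[5,176],[10,91],[61,94],[12,116],[22,186],[6,28],[60,799]] [-1], Prime 3719 2
 2 [1501] [[1,1],[15,211],[4,74],[8,381],[59,71],[2,681],[28,86],[2,351],[7,140],[8,173]] [-1],
 Prime 3851 2 2 [2407]
 [[1,1],[53,491],[1,706],[1,95],[20,319],[68,95],[77,125],[20,260],[4,422],[10,41]] [-1], Prime 3917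
 2 2 [312] [[1,1],[9,38],[1,291],[12,97],[4,76],[11,12],[1,283],[1,154],[9,452],[1,112]] [-1], Prime
 4027 2 2 [3139] [[1,1],[7,25],[24,538],[67,79],[5,17],[6,332],[3,54],[16,683],[27,310],[49,471]]
 [-1], Prime 4049 2 2 [2952]
 [[1,1],[18,63],[4,113],[6,227],[9,224],[6,31],[7,264],[4,233],[3,107],[4,231]] [-1], Prime 4093 2 2
 [1323] [[1,1],[7,187],[22,99],[10,539],[9,416],[1,92],[28,57],[40,76],[43,84],[4,20]] [-1], Prime
 4159 2 2 [3403] [[1,1],[7,391],[6,407],[2,138],[12,159],[6,7],[2,447],[43,56],[1,438],[53,98]]
 [-1], Prime 4357 2 2 [3605]
 [[1,1],[1,14],[30,449],[4,486],[25,80],[22,53],[6,182],[7,360],[16,533],[32,392]] [-1], Prime 4423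
 2 2 [2632] [[1,1],[79,86],[6,33],[7,216],[2,565],[16,341],[2,413],[82,92],[1,300],[4,166]] [-1],
 Ext 4489 2 67 [2,0] [0,1] [[50,0]]
 [[[1,2],[7,5]],[[1,0],[1,0]],[[6,0],[4,3]],[[1,7],[13,6]],[[4,3],[34,8]],[[2,0],[4,0]],[[1,9],[8,9]],[[3,5],[8,9]],[[5,3],[9,8]],[[1,3],[4,19]]]
 [[66,0]], Prime 4621 2 2 [1004]
 [[1,1],[34,54],[3,340],[6,305],[15,44],[1,165],[29,64],[7,360],[34,68],[19,71]] [-1], Prime 4643 2
 3 [1967] [[1,98],[1,53],[5,629],[3,88],[7,77],[3,504],[2,64],[11,323],[17,440],[22,331]] [-1],
 Prime 4951 2 2 [2056]
 [[1,1],[60,783],[14,299],[2,23],[1,2033],[18,525],[6,80],[9,24],[7,136],[1,519]] [-1], Prime 4973 2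
 2 [1889] [[1,1],[56,380],[4,248],[37,75],[18,85],[5,380],[9,32],[7,1739],[8,648],[6,591]] [-1],
 Prime 5039 2 2 [1555]
 [[1,1],[13,196],[6,25],[86,96],[7,241],[16,85],[6,163],[25,92],[25,995],[80,82]] [-1], Prime 5171 2
 2 [3760] [[1,1],[1,57],[45,51],[4,224],[9,99],[7,382],[33,684],[4,582],[39,51],[7,150]] [-1], Prime
 5237 2 2 [4502] [[1,1],[2,90],[4,344],[4,36],[1,193],[23,537],[30,41],[11,927],[17,516],[21,856]]
 [-1], Prime 5281 2 2 [219]
 [[1,1],[4,152],[9,665],[29,45],[4,89],[7,158],[4,23],[8,792],[18,29],[3,396]] [-1], Prime 5303 2 2
 [1881] [[1,1],[8,367],[7,554],[23,37],[11,308],[1,329],[28,55],[2,155],[11,85],[3,170]] [-1], Prime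
 5347 2 2 [270] [[1,1],[41,397],[2,324],[19,332],[11,77],[1,413],[29,46],[3,171],[56,92],[22,306]]
 [-1], Prime 5413 2 2 [4933]
 [[1,1],[4,317],[6,264],[15,449],[13,163],[14,49],[9,110],[27,392],[2,18],[6,805]] [-1], Prime 5479
 2 2 [3868] [[1,1],[16,658],[43,87],[10,823],[3,67],[1,366],[3,572],[1,436],[1,456],[15,81]] [-1],
 Prime 5501 2 2 [2645]
 [[1,1],[35,164],[33,82],[38,51],[12,85],[7,168],[38,78],[25,260],[4,780],[4,145]] [-1], Prime 5743
 2 2 [4219] [[1,1],[1,45],[1,663],[4,1139],[38,68],[3,83],[3,10],[38,156],[14,238],[7,96]] [-1],
 Prime 5897 2 2 [1122]
 [[1,1],[8,217],[56,69],[5,877],[15,122],[2,1656],[9,32],[1,778],[6,389],[10,135]] [-1], Prime 6007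
 2 2 [4820] [[1,1],[10,482],[25,56],[32,50],[21,610],[5,168],[6,466],[29,53],[22,76],[1,673]] [-1],
 Prime 6029 2 2 [1419] [[1,1],[7,85],[9,979],[6,359],[3,294],[1,532],[21,28],[7,867],[1,68],[6,654]]
 [-1], Prime 6073 2 2 [4499]
 [[1,1],[71,94],[55,105],[9,530],[1,415],[14,364],[19,93],[14,74],[3,348],[3,297]] [-1], Prime 6271
 2 2 [1701] [[1,1],[5,304],[10,245],[5,154],[10,605],[9,26],[13,336],[10,740],[9,21],[1,524]] [-1],
 Prime 6337 2 3 [3775]
 [[2,101],[1,253],[1,475],[23,27],[27,62],[11,225],[61,339],[5,1566],[30,354],[2,326]] [-1], Prime
 6359 2 2 [2828] [[1,1],[2,661],[7,661],[4,353],[14,122],[62,98],[38,189],[46,866],[32,38],[17,78]]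
 [-1], Prime 6469 2 2 [4342]
 [[1,1],[18,86],[76,534],[52,54],[47,95],[67,74],[4,2014],[5,1235],[34,224],[3,10]] [-1], Prime 6491
 2 2 [1063] [[1,1],[7,342],[5,856],[30,73],[3,382],[4,888],[22,372],[89,198],[50,330],[12,115]]
 [-1], Prime 6689 2 2 [3749]
 [[1,1],[13,1052],[21,141],[5,148],[8,407],[14,152],[4,419],[36,407],[38,87],[1,146]] [-1], Prime
 6733 2 2 [1997] [[1,1],[8,945],[16,64],[32,92],[11,73],[4,155],[22,28],[8,744],[6,2441],[4,1169]]
 [-1], Prime 6997 2 2 [3044]
 [[1,1],[34,90],[6,9],[10,81],[2,299],[8,25],[3,1384],[5,74],[6,1384],[4,87]] [-1], Prime 7019 2 2
 [607] [[1,1],[22,811],[16,819],[41,477],[32,479],[2,849],[7,393],[41,53],[3,29],[12,73]] [-1],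
 Prime 7129 2 2 [6019]
 [[1,1],[5,766],[5,518],[11,42],[24,74],[8,36],[27,444],[12,95],[7,26],[15,994]] [-1], Prime 7151 2
 3 [3086] [[1,748],[1,292],[5,398],[3,216],[4,735],[9,45],[3,176],[7,773],[6,292],[7,379]] [-1],
 Prime 7283 2 2 [1689]
 [[1,1],[22,197],[1,256],[1,767],[9,228],[13,860],[14,81],[5,496],[2,112],[5,299]] [-1], Prime 7349
 2 2 [4401] [[1,1],[22,90],[26,110],[9,46],[6,428],[13,67],[4,142],[60,94],[16,88],[4,827]] [-1],
 Prime 7393 2 2 [6027]
 [[1,1],[2,73],[33,98],[20,304],[1,786],[6,175],[9,89],[27,29],[10,316],[5,317]] [-1], Prime 7459 2
 2 [4094] [[1,1],[3,584],[2,171],[3,1048],[12,154],[5,36],[1,444],[4,841],[6,163],[29,35]] [-1],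
 Prime 7481 2 2 [4076]
 [[1,1],[7,1149],[9,402],[6,601],[4,562],[8,404],[53,69],[8,84],[5,76],[8,854]] [-1], Prime 7547 2 2
 [5352] [[1,1],[38,40],[5,51],[12,114],[4,618],[9,71],[30,45],[23,837],[26,457],[8,547]] [-1], Prime
 7591 2 2 [5367] [[1,1],[25,716],[13,228],[4,800],[16,855],[1,258],[8,157],[1,673],[7,282],[54,66]]
 [-1], Prime 7723 2 2 [6331]
 [[1,1],[22,228],[8,508],[1,46],[68,275],[1,1620],[6,470],[17,92],[13,463],[22,782]] [-1], Prime
 7789 2 2 [5304] [[1,1],[6,2004],[3,771],[18,112],[24,51],[59,72],[5,520],[19,458],[5,344],[15,181]]
 [-1], Prime 7877 2 2 [4769]
 [[1,1],[17,288],[10,504],[39,608],[12,526],[9,950],[11,120],[3,73],[28,196],[22,329]] [-1], Ext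
 7921 2 89 [3,0] [0,1] [[65,0]]
 [[[3,2],[29,1]],[[3,0],[5,0]],[[4,5],[8,9]],[[1,9],[13,43]],[[0,9],[0,11]],[[3,3],[43,7]],[[4,5],[1,29]],[[9,7],[9,8]],[[2,3],[4,37]],[[3,2],[1,13]]]
 [[88,0]], Prime 8009 2 2 [4757]
 [[1,1],[23,529],[30,74],[2,477],[3,54],[5,121],[6,318],[4,1740],[3,2459],[8,13]] [-1], Prime 8053 2
 2 [1992] [[1,1],[53,102],[20,149],[30,70],[8,1344],[19,588],[34,291],[1,729],[4,539],[1,550]] [-1],
 Prime 8273 2 2 [6385]
 [[1,1],[7,21],[7,787],[17,93],[4,437],[4,69],[34,701],[9,658],[3,586],[6,294]] [-1], Prime 8317 2 2
 [4241] [[1,1],[27,85],[12,81],[27,156],[1,289],[3,124],[4,758],[64,255],[24,339],[24,95]] [-1],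
 Prime 8537 2 2 [8194]
 [[1,1],[2,32],[20,175],[18,520],[16,527],[83,96],[19,618],[5,459],[50,52],[24,66]] [-1], Prime 8581
 2 2 [4788] [[1,1],[8,267],[9,417],[2,2245],[9,125],[5,246],[16,58],[1,31],[47,689],[1,541]] [-1],
 Prime 8647 2 2 [1724]
 [[1,1],[20,381],[15,47],[58,62],[4,435],[9,390],[4,840],[1,343],[3,1749],[19,43]] [-1], Prime 8669
 2 2 [4722] [[1,1],[22,688],[15,520],[14,329],[65,94],[6,657],[2,933],[17,90],[2,231],[33,38]] [-1],
 Prime 8713 2 2 [7898]
 [[1,1],[5,489],[1,828],[16,215],[1,588],[4,380],[2,303],[9,27],[3,395],[20,349]] [-1], Prime 8779 2
 2 [798] [[1,1],[21,376],[4,673],[15,188],[13,735],[2,409],[1,575],[9,1166],[2,469],[9,207]] [-1],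
 Prime 8867 2 2 [3248]
 [[1,1],[7,964],[17,365],[11,72],[27,160],[34,817],[3,159],[23,336],[35,304],[1,2011]] [-1], Prime
 8933 2 2 [7685] [[1,1],[24,99],[9,92],[8,323],[7,1094],[3,250],[47,483],[3,705],[4,1891],[8,235]]
 [-1], Prime 8999 2 2 [8533]
 [[1,1],[22,458],[2,2386],[5,151],[14,425],[4,650],[70,72],[75,86],[11,552],[17,370]] [-1], Prime
 9043 2 2 [4177]
 [[1,1],[6,1177],[6,364],[5,18],[13,736],[6,1197],[11,149],[20,358],[2,305],[30,893]] [-1], Prime
 9109 2 2 [3516] [[1,1],[9,913],[9,1084],[28,39],[3,138],[22,832],[14,564],[12,50],[7,802],[1,42]]
 [-1], Prime 9241 2 2 [3731]
 [[1,1],[7,1435],[5,40],[2,593],[6,349],[19,216],[9,853],[2,245],[1,533],[4,541]] [-1], Prime 9439 2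
 2 [4151] [[1,1],[3,284],[2,166],[8,847],[47,59],[4,38],[48,531],[5,717],[6,89],[8,113]] [-1], Prime
 9461 2 2 [5367] [[1,1],[4,335],[34,857],[52,57],[19,353],[54,600],[2,476],[57,71],[16,47],[4,691]]
 [-1], Prime 9769 2 2 [4296]
 [[1,1],[1,559],[44,98],[1,1373],[3,1266],[22,294],[23,362],[3,721],[14,204],[15,107]] [-1], Prime
 9791 2 2 [2764] [[1,1],[16,99],[7,126],[18,624],[32,649],[1,146],[1,245],[61,68],[8,289],[11,30]]
 [-1], Prime 9857 2 2 [8176]
 [[1,1],[1,1516],[35,303],[2,284],[74,90],[15,345],[74,82],[5,265],[12,194],[5,75]] [-1], Prime 9901
 2 2 [4839] [[1,1],[45,934],[1,601],[24,396],[9,1936],[26,50],[7,466],[21,46],[2,1691],[3,466]]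
 [-1], Prime 9923 2 2 [236]
 [[1,1],[37,496],[25,824],[12,617],[43,50],[1,252],[29,707],[1,601],[3,367],[16,452]] [-1], Prime
 9967 2 2 [645] [[1,1],[17,312],[16,52],[8,847],[11,638],[59,971],[4,1050],[26,70],[2,999],[61,98]]
 [-1], Prime 10099 2 2 [5324]
 [[1,1],[8,73],[26,517],[10,693],[37,76],[39,87],[22,40],[16,30],[39,615],[40,124]] [-1], Prime
 10253 2 2 [2273] [[1,1],[29,57],[28,170],[34,62],[20,85],[2,472],[15,29],[70,596],[16,281],[6,605]]
 [-1], Prime 10429 2 2 [2561]
 [[1,1],[20,463],[2,639],[70,591],[9,225],[1,794],[7,490],[3,1202],[63,684],[6,1999]] [-1], Prime
 10627 2 2 [7519]
 [[1,1],[5,269],[12,922],[1,774],[7,533],[7,2407],[5,880],[7,861],[22,804],[29,272]] [-1], Prime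
 10781 2 2 [2941] [[1,1],[9,48],[30,210],[1,732],[1,588],[59,71],[29,2537],[22,417],[62,478],[1,96]]
 [-1], Prime 10847 2 2 [3715]
 [[1,1],[5,654],[33,57],[9,128],[7,40],[2,469],[1,171],[25,275],[66,614],[3,59]] [-1], Prime 10891 2
 2 [7029] [[1,1],[13,386],[14,547],[42,64],[16,61],[4,876],[19,138],[43,862],[6,169],[23,833]] [-1],
 Prime 10957 2 2 [7368]
 [[1,1],[25,447],[26,113],[30,44],[29,171],[47,92],[9,58],[23,864],[16,440],[4,362]] [-1], Prime
 10979 2 2 [5502]
 [[1,1],[8,578],[2,87],[15,606],[18,388],[50,565],[6,1324],[33,111],[39,80],[3,1757]] [-1], Prime
 11177 2 2 [8554]
 [[1,1],[30,49],[19,459],[29,267],[45,62],[1,298],[28,921],[4,232],[8,3079],[3,2416]] [-1], Prime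
 11243 2 2 [9903] [[1,1],[9,87],[5,412],[3,9],[2,2152],[7,4081],[53,98],[66,73],[40,99],[4,183]]
 [-1], Prime 11287 2 2 [4257]
 [[1,1],[48,99],[7,2422],[26,575],[4,14],[22,45],[1,1870],[4,214],[11,207],[1,1745]] [-1], Prime
 11353 2 2 [6163] [[1,1],[18,22],[13,42],[1,795],[33,84],[10,192],[3,285],[19,63],[8,747],[3,994]]
 [-1], Prime 11551 2 2 [2603]
 [[1,1],[9,2382],[56,74],[26,576],[9,1264],[6,66],[3,27],[17,21],[8,718],[3,792]] [-1], Prime 11617
 2 2 [2411] [[1,1],[2,614],[9,404],[17,527],[2,215],[2,83],[47,509],[35,359],[8,305],[6,456]] [-1],
 Ext 11881 2 109 [2,0] [1,1] [[54,87]]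
 [[[1,0],[0,23]],[[6,1],[8,11]],[[6,0],[8,36]],[[10,0],[2,8]],[[8,0],[0,67]],[[9,0],[5,7]],[[9,9],[14,4]],[[5,0],[18,4]],[[0,8],[65,0]],[[4,0],[0,70]]]
 [[108,0]], Prime 11903 2 2 [5835]
 [[1,1],[10,370],[22,256],[60,513],[2,459],[4,983],[8,571],[14,17],[1,458],[9,631]] [-1], Prime
 11969 2 2 [838] [[1,1],[51,66],[22,264],[8,568],[6,784],[2,102],[4,963],[5,293],[1,487],[44,466]]
 [-1], Prime 12101 2 3 [8398]
 [[1,33],[1,438],[3,297],[32,367],[9,66],[25,182],[55,85],[5,544],[7,546],[1,56]] [-1], Excluded
 12167, Prime 12211 2 2 [5157]
 [[1,1],[9,417],[8,2363],[15,86],[7,660],[2,1410],[1,68],[1,542],[9,163],[11,60]] [-1], Prime 12277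
 2 2 [9211] [[1,1],[20,76],[2,429],[16,631],[33,190],[1,8],[5,11],[2,130],[7,149],[5,230]] [-1],
 Prime 12343 2 2 [3452]
 [[1,1],[34,36],[8,1726],[3,476],[2,3597],[54,69],[21,412],[4,337],[5,836],[10,255]] [-1], Prime
 12409 2 2 [2225] [[1,1],[5,25],[4,450],[23,657],[44,54],[5,505],[7,189],[51,637],[38,451],[12,609]]
 [-1], Prime 12497 2 2 [8664]
 [[1,1],[59,69],[21,509],[27,813],[46,206],[6,196],[1,726],[1,643],[21,146],[19,540]] [-1], Prime
 12541 2 2 [4456] [[1,1],[2,70],[5,423],[2,603],[12,188],[34,378],[83,99],[20,306],[2,204],[6,2527]]
 [-1], Prime 12739 2 2 [5470]
 [[1,1],[1,1041],[8,1420],[52,132],[40,47],[3,1331],[7,639],[1,2348],[46,90],[15,526]] [-1], Prime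
 12893 2 3 [7505]
 [[1,2607],[1,1530],[2,257],[9,514],[19,581],[20,342],[6,274],[41,55],[23,244],[7,676]] [-1], Prime
 12959 2 2 [149]
 [[1,1],[49,406],[21,214],[4,526],[11,665],[10,11],[6,2322],[2,2418],[3,594],[7,113]] [-1], Prime
 13003 2 2 [8934]
 [[1,1],[4,851],[32,658],[2,657],[87,681],[25,916],[3,1398],[58,873],[31,231],[7,1534]] [-1], Prime
 13267 2 2 [5898] [[1,1],[6,721],[9,726],[35,383],[87,90],[6,818],[3,484],[12,39],[4,375],[5,1731]]
 [-1]]"

text \<open>In the field with 23 elements the nonzero eleventh powers are 1 and -1, so some elements
  take eleven summands. All triples for this exponent exclude the divisor 23.\<close>

lemma certificates_11_ok:
  "certificates_ok 11 [num.One] 2 1209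
     [(67, 5), (89, 4), (199, 3), (331, 3), (353, 3), (419, 3), (463, 3), (617, 3)]
     [23,529,12167] certificates_11"
  by code_simp

section \<open>Finite rings\<close>

text \<open>An entry \<open>(d, exc, bad)\<close> lists the pairs \<open>(q, n)\<close> such that \<open>n\<close> powers are used in the field with \<open>q\<close>
  elements instead of two (\<open>d\<close> odd) or three (\<open>d\<close> even), and the \<open>q\<close> for which nothing is claimed.\<close>

definition exception_data :: "(nat \<times> (int \<times> int) list \<times> int list) list" where
  "exception_data = [(2, [], []),
     (3, [(7, 3)], [4, 16]),
     (4, [(5, 5), (29, 4)], [9, 81]),
     (5, [(11, 5), (31, 3), (41, 3), (61, 3)], [16, 256]),
     (6, [(7, 7), (13, 6), (19, 4), (31, 5), (67, 4), (79, 4), (139, 4), (223, 4)], [25, 625]),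
     (7, [(29, 4), (43, 4), (71, 3), (113, 3), (127, 3)], [8, 64, 512]),
     (8, [(17, 8), (25, 4), (41, 5), (89, 4), (137, 4), (233, 4), (761, 4)], [9, 49, 81, 729, 2401]),
     (9, [(19, 9), (37, 5), (73, 3), (109, 3), (127, 3), (163, 3), (181, 3), (199, 3), (271, 3), (307,
       3), (343, 3)], [64, 4096]),
     (10, [(11, 11), (31, 5), (41, 4), (61, 4), (71, 4), (131, 4), (311, 4), (431, 4), (491, 4), (911,
       4)], [81, 6561]),
     (11, [(67, 5), (89, 4), (199, 3), (331, 3), (353, 3), (419, 3), (463, 3), (617, 3)], [23, 529,
       12167])]"

lemma (in field) unit_psums_one:
  assumes "2 \<le> n"
  shows "carrier R \<subseteq> unit_psums R 1 n"
proof -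
  have x: "x \<in> psums R 1 1" if "x \<in> carrier R" for x
    using psumsI[of x \<zero> 1 0] that by simp
  have "psums R 1 1 \<subseteq> psums R 1 (n - 1)" "psums R 1 1 \<subseteq> psums R 1 n"
    using assms by (intro psums_mono; simp)+
  with x show ?thesis by (intro carrier_unit_psumsI) (blast intro: a_inv_closed one_closed zero_less_one)+
qed

lemma proper_exponents:
  "proper_exponents 2 [num.One]"
  "proper_exponents 3 [num.One]"
  "proper_exponents 4 [num.Bit0 num.One]"
  "proper_exponents 5 [num.One]"
  "proper_exponents 6 [num.Bit0 num.One, num.Bit1 num.One]"
  "proper_exponents 7 [num.One]"
  "proper_exponents 8 [num.Bit0 (num.Bit0 num.One)]"
  "proper_exponents 9 [num.Bit1 num.One]"
  "proper_exponents 10 [num.Bit0 num.One, num.Bit1 (num.Bit0 num.One)]"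
  "proper_exponents 11 [num.One]"
  by code_simp+

lemma (in field) unit_psums_exceptions:
  assumes fin: "finite (carrier R)" and d: "2 \<le> d" "d \<le> 11" and q: "card (carrier R) mod d = 1"
  shows "\<exists>exc bad. (d, exc, bad) \<in> set exception_data \<and> (int (card (carrier R)) \<in> set bad \<or>
    (\<exists>n. carrier R \<subseteq> unit_psums R d (nat n) \<and>
      (n = (if odd d then 2 else 3) \<or> (int (card (carrier R)), n) \<in> set exc)))"
proof -
  \<comment> \<open>The cases of d differ only in the table that is inserted here.\<close>
  have *: ?thesis if "certificates_ok D E n0 h0 exc bad cs" "D = int d" "n0 = (if odd d then 2 else 3)"
    "proper_exponents d E" "(d, exc, bad) \<in> set exception_data" for D E n0 h0 exc bad cs
    by (intro exI conjI, rule that(5),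
        rule unit_psums_certified[OF fin q d(1) that(4) _ _ that(1)[unfolded that(2,3)]]) auto
  have "d = 2 \<or> d = 3 \<or> d = 4 \<or> d = 5 \<or> d = 6 \<or> d = 7 \<or> d = 8 \<or> d = 9 \<or> d = 10 \<or> d = 11"
    using d by arith
  then consider "d = 2" | "d = 3" | "d = 4" | "d = 5" | "d = 6" | "d = 7" | "d = 8" | "d = 9" | "d = 10" | "d = 11"
    by blast
  then show ?thesis
  proof cases
    case 1
    show ?thesis
      by (rule *[OF certificates_2_ok])
        (simp_all add: \<open>d = 2\<close> exception_data_def proper_exponents)
  next
    case 2
    show ?thesis
      by (rule *[OF certificates_3_ok])
        (simp_all add: \<open>d = 3\<close> exception_data_def proper_exponents)
  next
    case 3
    show ?thesis
      by (rule *[OF certificates_4_ok])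
        (simp_all add: \<open>d = 4\<close> exception_data_def proper_exponents)
  next
    case 4
    show ?thesis
      by (rule *[OF certificates_5_ok])
        (simp_all add: \<open>d = 5\<close> exception_data_def proper_exponents)
  next
    case 5
    show ?thesis
      by (rule *[OF certificates_6_ok])
        (simp_all add: \<open>d = 6\<close> exception_data_def proper_exponents)
  next
    case 6
    show ?thesis
      by (rule *[OF certificates_7_ok])
        (simp_all add: \<open>d = 7\<close> exception_data_def proper_exponents)
  next
    case 7
    show ?thesis
      by (rule *[OF certificates_8_ok])
        (simp_all add: \<open>d = 8\<close> exception_data_def proper_exponents)
  next
    case 8
    show ?thesis
      by (rule *[OF certificates_9_ok])
        (simp_all add: \<open>d = 9\<close> exception_data_def proper_exponents)
  next
    case 9
    show ?thesis
      by (rule *[OF certificates_10_ok])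
        (simp_all add: \<open>d = 10\<close> exception_data_def proper_exponents)
  next
    case 10
    show ?thesis
      by (rule *[OF certificates_11_ok])
        (simp_all add: \<open>d = 11\<close> exception_data_def proper_exponents)
  qed
qed

text \<open>Divisibility rather than equality is asked for, because one excluded divisor such as 9
  also removes orders such as 81.\<close>

definition admissible :: "nat set \<Rightarrow> nat \<Rightarrow> nat \<times> (int \<times> int) list \<times> int list \<Rightarrow> bool" where
  "admissible Q n = (\<lambda>(d, exc, bad). (if odd d then 2 else 3) \<le> n \<and>
     list_all (\<lambda>(q, m). m \<le> int n \<or> (\<exists>c\<in>Q. int c dvd q)) exc \<and>
     list_all (\<lambda>q. \<exists>c\<in>Q. int c dvd q) bad)"

text \<open>All divisors of k have to be compared, since the greatest common divisor of k and q - 1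
  varies with the field. The divisor 1 has no entry in the table and is treated by
  \<open>unit_psums_one\<close>.\<close>

lemma waring_triples_admissible:
  "\<forall>(k, Q, n)\<in>waring_triples. list_all (admissible Q n) (filter (\<lambda>(d, _). d dvd k) exception_data)"
  unfolding waring_triples_def exception_data_def by (simp add: admissible_def)

lemma waring_triples_exceptions:
  assumes "(k, Q, n) \<in> waring_triples" "(d, exc, bad) \<in> set exception_data" "d dvd k"
  shows "(if odd d then 2 else 3) \<le> n \<and> (\<forall>(q, m)\<in>set exc. m \<le> int n \<or> (\<exists>c\<in>Q. int c dvd q))
    \<and> (\<forall>q\<in>set bad. \<exists>c\<in>Q. int c dvd q)"
proof -
  have "admissible Q n (d, exc, bad)"
    using waring_triples_admissible assms by (fastforce simp: list_all_iff)
  then show ?thesis unfolding admissible_def list_all_iff prod.case .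
qed

lemma waring_triples_basic:
  assumes "(k, Q, n) \<in> waring_triples"
  shows "3 \<le> k" "k \<le> 11" "2 \<le> n"
  using assms unfolding waring_triples_def by auto

text \<open>Every Q contains the primes dividing k; this is what allows k-th roots to be taken in 1
  + M.\<close>

lemma waring_triples_coprime:
  assumes t: "(k, Q, n) \<in> waring_triples" and "\<forall>q\<in>Q. \<not> q dvd N"
  shows "coprime k N"
proof -
  have c: "coprime p N" if "p \<in> Q" "Factorial_Ring.prime p" for p
    using that assms(2) prime_imp_coprime by blast
  consider "k = 3 \<or> k = 9" "3 \<in> Q" | "k = 4 \<or> k = 8" "2 \<in> Q" | "k = 5 \<or> k = 7 \<or> k = 11" "k \<in> Q"
    | "k = 6" "2 \<in> Q" "3 \<in> Q" | "k = 10" "2 \<in> Q" "5 \<in> Q"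
    using t unfolding waring_triples_def insert_iff prod.inject by fast
  then show ?thesis
  proof cases
    case 1
    then show ?thesis using c[of 3] coprime_power_left_iff[of 3 2 N] by auto
  next
    case 2
    then show ?thesis using c[of 2] coprime_power_left_iff[of 2 2 N] coprime_power_left_iff[of 2 3 N] by auto
  next
    case 3
    then show ?thesis using c[of k] by auto
  next
    case 4
    then show ?thesis using c[of 2] c[of 3] coprime_mult_left_iff[of 2 3 N] by auto
  next
    case 5
    then show ?thesis using c[of 2] c[of 5] coprime_mult_left_iff[of 2 5 N] by auto
  qed
qed

lemma (in field) waring_field:
  assumes fin: "finite (carrier R)" and t: "(k, Q, n) \<in> waring_triples"
    and Q: "\<forall>q\<in>Q. \<not> q dvd card (carrier R)"
  shows "carrier R \<subseteq> unit_psums R k n"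
proof -
  let ?q = "card (carrier R)"
  define d where "d = gcd k (?q - 1)"
  have k: "3 \<le> k" "k \<le> 11" "2 \<le> n" using waring_triples_basic[OF t] by auto
  have "card {\<zero>, \<one>} \<le> ?q" using fin by (intro card_mono) auto
  then have q2: "2 \<le> ?q" using one_not_zero by simp
  have d0: "0 < d" "d dvd k" "d dvd ?q - 1" using k by (auto simp: d_def)
  have "carrier R \<subseteq> unit_psums R d n"
  proof (cases "d = 1")
    case True
    then show ?thesis using unit_psums_one k by simp
  next
    case False
    then have d2: "2 \<le> d" "d \<le> 11" using d0 k dvd_imp_le[of d k] by auto
    obtain j where "?q - 1 = d * j" using d0(3) by blast
    then have "?q = d * j + 1" using q2 by simp
    then have "?q mod d = 1 mod d" by (metis mod_mult_self4)
    then have "?q mod d = 1" using d2 by simp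
    then obtain exc bad where e: "(d, exc, bad) \<in> set exception_data"
      and w: "int ?q \<in> set bad \<or> (\<exists>m. carrier R \<subseteq> unit_psums R d (nat m) \<and>
        (m = (if odd d then 2 else 3) \<or> (int ?q, m) \<in> set exc))"
      using unit_psums_exceptions[OF fin d2] by blast
    note T = waring_triples_exceptions[OF t e d0(2)]
    have nd: "\<not> int c dvd int ?q" if "c \<in> Q" for c using Q that by simp
    from w obtain m where m: "carrier R \<subseteq> unit_psums R d (nat m)"
      "m = (if odd d then 2 else 3) \<or> (int ?q, m) \<in> set exc"
      using T nd by blast
    have "nat m \<le> n"
      using m(2)
    proof
      assume "m = (if odd d then 2 else 3)"
      then show ?thesis using T by (auto split: if_splits)
    next
      assume "(int ?q, m) \<in> set exc"
      then have "m \<le> int n" using T nd by blast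
      then show ?thesis by simp
    qed
    then show ?thesis using m(1) unit_psums_mono[OF d0(1)] by blast
  qed
  moreover have "unit_psums R d n \<subseteq> unit_psums R k n"
    using k by (intro psums_gcd[OF fin _ d_def]) simp
  ultimately show ?thesis by blast
qed

theorem theorem5p2:
  fixes R :: "('a, 'b) ring_scheme" (structure)
    and k n :: nat and Q :: "nat set"
  assumes "ring R"
    and "finite (carrier R)"
    and "(k, Q, n) \<in> waring_triples"
    and "\<forall>q\<in>Q. \<not> q dvd order R"
  shows "(\<forall>\<alpha>\<in>carrier R. \<exists>x :: nat \<Rightarrow> 'a.
            (\<forall>i\<in>{1..n}. x i \<in> carrier R) \<and> \<alpha> = (\<Oplus>i\<in>{1..n}. x i [^] k))
       \<and> (\<forall>\<alpha>\<in>carrier R. \<exists>B :: nat \<Rightarrow> 'a.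
            (\<forall>i\<in>{1..n}. B i \<in> int_adjoin R \<alpha>) \<and> \<alpha> = (\<Oplus>i\<in>{1..n}. B i [^] k))"
proof -
  interpret ring R by fact
  have main: "\<exists>x. (\<forall>i\<in>{1..n}. x i \<in> range (horner R \<alpha>)) \<and> \<alpha> = (\<Oplus>i\<in>{1..n}. x i [^] k)"
    if \<alpha>: "\<alpha> \<in> carrier R" for \<alpha>
  proof -
    let ?S = "range (horner R \<alpha>)"
    let ?A = "R\<lparr>carrier := ?S\<rparr>"
    have S: "subcring ?S R" by (rule horner_subcring[OF \<alpha>])
    have Sc: "?S \<subseteq> carrier R" using \<alpha> by auto
    have A: "cring ?A" using subcring_iff[OF Sc] S by blast
    have finA: "finite (carrier ?A)" using finite_subset[OF Sc assms(2)] by simp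
    \<comment> \<open>By Lagrange the order of the subring divides that of R. Divisibility is also
      what links residue fields to the subring, so the hypothesis on Q descends all the way to the
      fields.\<close>
    have "subgroup ?S (add_monoid R)" using S by (simp add: subcring_def subring_def)
    then have "card ?S dvd card (carrier R)"
      by (rule card_dvd_of_subgroup)
    then have dvd: "card (carrier ?A) dvd order R" by (simp add: order_def)
    have nd: "\<forall>q\<in>Q. \<not> q dvd card (carrier ?A)" using assms(4) dvd dvd_trans by blast
    have "carrier ?A \<subseteq> psums ?A k n"
    proof (rule finite_cring_psums[OF A finA])
      show "coprime k (card (carrier ?A))" by (rule waring_triples_coprime[OF assms(3) nd])
      show "0 < k" "0 < n" using waring_triples_basic[OF assms(3)] by auto
      show "carrier F \<subseteq> unit_psums F k n" if "field F" "finite (carrier F)"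
        "card (carrier F) dvd card (carrier ?A)" for F :: "'a set ring"
        using field.waring_field[OF that(1,2) assms(3)] nd that(3) dvd_trans by blast
    qed
    then have "\<alpha> \<in> psums ?A k n" using in_range_horner[OF \<alpha>] by auto
    then show ?thesis by (rule psums_finsum[OF Sc])
  qed
  have sub: "range (horner R \<alpha>) \<subseteq> carrier R \<inter> int_adjoin R \<alpha>" if "\<alpha> \<in> carrier R" for \<alpha>
    using horner_int_adjoin[OF that] that by auto
  show ?thesis
  proof (intro conjI ballI)
    fix \<alpha> assume a: "\<alpha> \<in> carrier R"
    obtain x where x: "\<forall>i\<in>{1..n}. x i \<in> range (horner R \<alpha>)" "\<alpha> = (\<Oplus>i\<in>{1..n}. x i [^] k)"
      using main[OF a] by blast
    have c: "\<forall>i\<in>{1..n}. x i \<in> carrier R" "\<forall>i\<in>{1..n}. x i \<in> int_adjoin R \<alpha>"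
      using x(1) sub[OF a] by blast+
    show "\<exists>x. (\<forall>i\<in>{1..n}. x i \<in> carrier R) \<and> \<alpha> = (\<Oplus>i\<in>{1..n}. x i [^] k)"
      using c(1) x(2) by (intro exI[of _ x] conjI)
    show "\<exists>B. (\<forall>i\<in>{1..n}. B i \<in> int_adjoin R \<alpha>) \<and> \<alpha> = (\<Oplus>i\<in>{1..n}. B i [^] k)"
      using c(2) x(2) by (intro exI[of _ x] conjI)
  qed
qed

end
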